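(* Let $f\in L^2(J;L^2(\Omega))$, let $u\in V$ be the solution of the time-periodic heat problem $$\frac{\partial u}{\partial t}-\nu\Delta u=f\ \text{ in }\Omega\times J,\qquad u=0\ \text{ on }\partial\Omega\times J,\qquad u(\cdot,0)=u(\cdot,T)\ \text{ in }\Omega,$$ and let $P_h^k u:=\Pi^k(P_hu)$ be its full-discrete approximation. Then $$\|u-P_h^ku\|_{L^2(J;H^1_0(\Omega))}\le\Bigl\{K_2\,C_\Omega(h)+C_{inv}(h)\,C_J(k)\,\frac{2-\kappa_1}{1-\kappa_1}\Bigr\}\|f\|_{L^2(J;L^2(\Omega))},$$ where $$K_2=\frac1\nu\Bigl\{4+5(1-e^{-\nu\lambda_1T})^{-2}+\bigl(1+(1-e^{-\nu\lambda_1T})^{-2}\bigr)(1-\kappa_1)^{-2}\Bigr\}^{1/2}.$$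
   Context: Setting: $\nu>0$ is a constant, $J=(0,T)$ with $0<T<\infty$, and $\Omega\subset\mathbb{R}^d$ ($d\in\{1,2,3\}$) is a bounded convex polygonal or polyhedral domain (an interval if $d=1$). $\|v\|_{H^1_0(\Omega)}:=\|\nabla v\|_{L^2(\Omega)}$ and $\|v\|_{L^2(J;X)}^2:=\int_0^T\|v(t)\|_X^2\,dt$. $\lambda_1$ is the smallest eigenvalue of $-\Delta$ on $\Omega$ with homogeneous Dirichlet boundary condition. $V:=H^1(J;L^2(\Omega))\cap L^2(J;H^1_0(\Omega))\cap\{u : u(0)=u(T)\text{ in }H^1_0(\Omega)\}$. The problem is known to have a unique solution in $V$; the equation is understood weakly: $(u_t,w)_{L^2(\Omega)}+\nu(\nabla u,\nabla w)_{L^2(\Omega)^d}=(f,w)_{L^2(\Omega)}$ for all $w\in H^1_0(\Omega)$ and a.e. $t\in J$. Spatial discretization: $S_h\subset H^1_0(\Omega)$ is a finite-dimensional subspace. $P_h^1:H^1_0(\Omega)\to S_h$ is the $H^1_0$-projection, $(\nabla(u-P_h^1u),\nabla v_h)_{L^2(\Omega)^d}=0$ for all $v_h\in S_h$. It is assumed that $C_\Omega(h)>0$ is a constant with $\|u-P_h^1u\|_{H^1_0(\Omega)}\le C_\Omega(h)\|\Delta u\|_{L^2(\Omega)}$ for all $u\in H^1_0(\Omega)$ with $\Delta u\in L^2(\Omega)$, and $\|u-P_h^1u\|_{L^2(\Omega)}\le C_\Omega(h)\|u-P_h^1u\|_{H^1_0(\Omega)}$ for all $u\in H^1_0(\Omega)$.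 $C_{inv}(h)>0$ is an inverse-estimate constant: $\|v_h\|_{H^1_0(\Omega)}\le C_{inv}(h)\|v_h\|_{L^2(\Omega)}$ for all $v_h\in S_h$. Semidiscrete projection: for $u\in V$, $P_hu\in H^1(J;S_h)$ is defined by $\bigl(\tfrac{\partial}{\partial t}(u-P_hu),v_h\bigr)_{L^2(\Omega)}+\nu(\nabla(u-P_hu),\nabla v_h)_{L^2(\Omega)^d}=0$ for all $v_h\in S_h$ and a.e. $t\in J$, together with $(P_hu)(0)=(P_hu)(T)$. Time discretization: $0=t_0<t_1<\dots<t_m=T$ are mesh points; $V^1(J):=\{w\in H^1(J): w(0)=w(T)\}$, and $V_k^1\subset V^1(J)$ is the space of continuous piecewise linear functions on this mesh. $\Pi^k:V^1(J)\to V_k^1$ is the interpolation operator, $(\Pi^kw)(t_i)=w(t_i)$ for $i=0,\dots,m$, applied to $S_h$-valued functions in the time variable. $C_J(k)>0$ is an interpolation-error constant: $\|w-\Pi^kw\|_{L^2(J)}\le C_J(k)\|w'\|_{L^2(J)}$ for all $w\in V^1(J)$. $E_h(T):S_h\to S_h$ is the semidiscrete evolution operator: $E_h(T)v_h=\phi_h(T)$, where $\phi_h\in H^1((0,T);S_h)$ solves $((\phi_h)_t,\eta_h)_{L^2(\Omega)}+\nu(\nabla\phi_h,\nabla\eta_h)_{L^2(\Omega)^d}=0$ for all $\eta_h\in S_h$, $t>0$, with $\phi_h(0)=v_h$. $\kappa_1$ is the operator norm of $E_h(T)$ on $S_h$ equipped with the norm $\|\cdot\|_{H^1_0(\Omega)}$;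 $E_h(T)$ is a contraction, i.e. $\kappa_1<1$. *)

theory Defs
  imports "HOL-Analysis.Analysis"
begin

section \<open>The Hilbert space of square-integrable functions\<close>

definition sq_integrable :: "('a::euclidean_space \<Rightarrow> 'b::euclidean_space) \<Rightarrow> bool" where
  "sq_integrable f \<longleftrightarrow>
     f \<in> borel_measurable lebesgue \<and> integrable lebesgue (\<lambda>x. (norm (f x))\<^sup>2)"

lemma sq_integrable_measurable:
  "sq_integrable f \<Longrightarrow> f \<in> borel_measurable lebesgue"
  by (simp add: sq_integrable_def)

lemma sq_integrable_integrable:
  "sq_integrable f \<Longrightarrow> integrable lebesgue (\<lambda>x. (norm (f x))\<^sup>2)"
  by (simp add: sq_integrable_def)

lemma sq_integrable_zero: "sq_integrable (\<lambda>x. 0)"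
  by (simp add: sq_integrable_def)

lemma sq_integrable_add:
  assumes "sq_integrable f" "sq_integrable g"
  shows "sq_integrable (\<lambda>x. f x + g x)"
proof -
  have [measurable]: "f \<in> borel_measurable lebesgue" "g \<in> borel_measurable lebesgue"
    using assms by (auto simp: sq_integrable_def)
  have "integrable lebesgue (\<lambda>x. (norm (f x + g x))\<^sup>2)"
  proof (rule Bochner_Integration.integrable_bound)
    show "integrable lebesgue (\<lambda>x. 2 * (norm (f x))\<^sup>2 + 2 * (norm (g x))\<^sup>2)"
      using assms by (auto simp: sq_integrable_def)
    have "(norm (a + b))\<^sup>2 \<le> 2 * (norm a)\<^sup>2 + 2 * (norm b)\<^sup>2" for a b :: 'b
    proof -
      have "(norm (a + b))\<^sup>2 \<le> (norm a + norm b)\<^sup>2"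
        by (intro power_mono norm_triangle_ineq) auto
      also have "\<dots> \<le> 2 * (norm a)\<^sup>2 + 2 * (norm b)\<^sup>2"
        using sum_squares_bound[of "norm a" "norm b"] by (simp add: power2_sum)
      finally show ?thesis .
    qed
    then show "AE x in lebesgue. norm ((norm (f x + g x))\<^sup>2)
                 \<le> norm (2 * (norm (f x))\<^sup>2 + 2 * (norm (g x))\<^sup>2)"
      by (intro AE_I2) simp
  qed simp
  then show ?thesis by (simp add: sq_integrable_def)
qed

lemma sq_integrable_scaleR:
  assumes "sq_integrable f" shows "sq_integrable (\<lambda>x. c *\<^sub>R f x)"
  using assms by (auto simp: sq_integrable_def power_mult_distrib)

lemma sq_integrable_minus:
  assumes "sq_integrable f" shows "sq_integrable (\<lambda>x. - f x)"
  using assms by (auto simp: sq_integrable_def)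

lemma sq_integrable_diff:
  assumes "sq_integrable f" "sq_integrable g"
  shows "sq_integrable (\<lambda>x. f x - g x)"
  using sq_integrable_add[OF assms(1) sq_integrable_minus[OF assms(2)]] by simp

lemma sq_integrable_inner:
  assumes "sq_integrable f" "sq_integrable g"
  shows "integrable lebesgue (\<lambda>x. f x \<bullet> g x)"
proof (rule Bochner_Integration.integrable_bound)
  have [measurable]: "f \<in> borel_measurable lebesgue" "g \<in> borel_measurable lebesgue"
    using assms by (auto simp: sq_integrable_def)
  show "integrable lebesgue (\<lambda>x. (norm (f x))\<^sup>2 + (norm (g x))\<^sup>2)"
    using assms by (auto simp: sq_integrable_def)
  show "(\<lambda>x. f x \<bullet> g x) \<in> borel_measurable lebesgue"
    by measurable
  have "\<bar>a \<bullet> b\<bar> \<le> (norm a)\<^sup>2 + (norm b)\<^sup>2" for a b :: 'b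
  proof -
    have "\<bar>a \<bullet> b\<bar> \<le> norm a * norm b"
      by (rule Cauchy_Schwarz_ineq2)
    also have "\<dots> \<le> (norm a)\<^sup>2 + (norm b)\<^sup>2"
    proof -
      have "0 \<le> norm a * norm b" by simp
      then show ?thesis
        using sum_squares_bound[of "norm a" "norm b"] by linarith
    qed
    finally show ?thesis .
  qed
  then show "AE x in lebesgue. norm (f x \<bullet> g x) \<le> norm ((norm (f x))\<^sup>2 + (norm (g x))\<^sup>2)"
    by (intro AE_I2) simp
qed

text \<open>
  \<open>('a, 'b) l2\<close> is the Hilbert space of square-integrable \<open>'b\<close>-valued functions on the whole space \<open>'a\<close>,
  modulo equality almost everywhere. For open \<open>\<Omega>\<close>, the space \<open>L\<^sup>2(\<Omega>)\<close> is identified with its closed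
  subspace of functions vanishing almost everywhere outside \<open>\<Omega>\<close> (isometric extension by zero, see
  \<open>L2_on\<close> below), so that Bochner integration and the norms and inner products of the library apply.
\<close>

quotient_type (overloaded) ('a, 'b) l2 = "'a::euclidean_space \<Rightarrow> 'b::euclidean_space" / partial:
  "\<lambda>f g. sq_integrable f \<and> sq_integrable g \<and> (AE x in lebesgue. f x = g x)"
proof (rule part_equivpI)
  show "\<exists>f :: 'a \<Rightarrow> 'b. sq_integrable f \<and> sq_integrable f \<and> (AE x in lebesgue. f x = f x)"
    using sq_integrable_zero by auto
  show "symp (\<lambda>f g :: 'a \<Rightarrow> 'b. sq_integrable f \<and> sq_integrable g \<and> (AE x in lebesgue. f x = g x))"
    by (intro sympI conjI; elim conjE; simp add: eq_commute)
  show "transp (\<lambda>f g :: 'a \<Rightarrow> 'b. sq_integrable f \<and> sq_integrable g \<and> (AE x in lebesgue. f x = g x))"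
  proof (intro transpI conjI; elim conjE)
    fix f g h :: "'a \<Rightarrow> 'b"
    assume "AE x in lebesgue. f x = g x" "AE x in lebesgue. g x = h x"
    then show "AE x in lebesgue. f x = h x"
      by eventually_elim simp
  qed
qed

instantiation l2 :: (euclidean_space, euclidean_space) real_inner
begin

lift_definition zero_l2 :: "('a, 'b) l2" is "\<lambda>x. 0"
  by (simp add: sq_integrable_zero)

lift_definition plus_l2 :: "('a, 'b) l2 \<Rightarrow> ('a, 'b) l2 \<Rightarrow> ('a, 'b) l2"
  is "\<lambda>f g x. f x + g x"
  by (auto intro: sq_integrable_add)

lift_definition minus_l2 :: "('a, 'b) l2 \<Rightarrow> ('a, 'b) l2 \<Rightarrow> ('a, 'b) l2"
  is "\<lambda>f g x. f x - g x"
  by (auto intro: sq_integrable_diff)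

lift_definition uminus_l2 :: "('a, 'b) l2 \<Rightarrow> ('a, 'b) l2" is "\<lambda>f x. - f x"
  by (auto intro: sq_integrable_minus)

lift_definition scaleR_l2 :: "real \<Rightarrow> ('a, 'b) l2 \<Rightarrow> ('a, 'b) l2" is "\<lambda>c f x. c *\<^sub>R f x"
  by (auto intro: sq_integrable_scaleR)

lift_definition inner_l2 :: "('a, 'b) l2 \<Rightarrow> ('a, 'b) l2 \<Rightarrow> real"
  is "\<lambda>f g. integral\<^sup>L lebesgue (\<lambda>x. f x \<bullet> g x)"
  by (rule integral_cong_AE)
     (auto intro!: borel_measurable_inner dest: sq_integrable_measurable)

definition norm_l2 :: "('a, 'b) l2 \<Rightarrow> real" where "norm_l2 f = sqrt (inner f f)"
definition dist_l2 :: "('a, 'b) l2 \<Rightarrow> ('a, 'b) l2 \<Rightarrow> real" where "dist_l2 f g = norm (f - g)"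
definition sgn_l2 :: "('a, 'b) l2 \<Rightarrow> ('a, 'b) l2" where "sgn_l2 f = inverse (norm f) *\<^sub>R f"
definition uniformity_l2 :: "(('a, 'b) l2 \<times> ('a, 'b) l2) filter" where
  "uniformity_l2 = (INF e\<in>{0<..}. principal {(f, g). dist f g < e})"
definition open_l2 :: "('a, 'b) l2 set \<Rightarrow> bool" where
  "open_l2 U = (\<forall>f\<in>U. eventually (\<lambda>(f', g). f' = f \<longrightarrow> g \<in> U) uniformity)"

instance
proof
  fix f g h :: "('a, 'b) l2" and c d :: real
  show "f + g + h = f + (g + h)"
    by transfer (auto intro!: sq_integrable_add simp: add.assoc)
  show "f + g = g + f"
    by transfer (auto intro!: sq_integrable_add simp: add.commute)
  show "0 + f = f" by transfer auto
  show "- f + f = 0" by transfer (auto simp: sq_integrable_zero)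
  show "f - g = f + - g"
    by transfer (auto intro!: sq_integrable_diff sq_integrable_add sq_integrable_minus)
  show "c *\<^sub>R (f + g) = c *\<^sub>R f + c *\<^sub>R g"
    by transfer (auto intro!: sq_integrable_add sq_integrable_scaleR simp: scaleR_add_right)
  show "(c + d) *\<^sub>R f = c *\<^sub>R f + d *\<^sub>R f"
    by transfer (auto intro!: sq_integrable_add sq_integrable_scaleR simp: scaleR_add_left)
  show "c *\<^sub>R d *\<^sub>R f = (c * d) *\<^sub>R f"
    by transfer (auto intro!: sq_integrable_scaleR)
  show "1 *\<^sub>R f = f" by transfer auto
  show "dist f g = norm (f - g)" by (rule dist_l2_def)
  show "sgn f = inverse (norm f) *\<^sub>R f" by (rule sgn_l2_def)
  show "uniformity = (INF e\<in>{0<..}. principal {(f :: ('a, 'b) l2, g). dist f g < e})"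
    by (rule uniformity_l2_def)
  show "open U = (\<forall>f\<in>U. eventually (\<lambda>(f', g). f' = f \<longrightarrow> g \<in> U) uniformity)"
    for U :: "('a, 'b) l2 set"
    by (rule open_l2_def)
  show "inner f g = inner g f"
    by transfer (simp add: inner_commute)
  show "inner (f + g) h = inner f h + inner g h"
    by transfer (simp add: inner_add_left sq_integrable_inner)
  show "inner (c *\<^sub>R f) g = c * inner f g"
    by transfer simp
  show "0 \<le> inner f f"
    by transfer simp
  show "inner f f = 0 \<longleftrightarrow> f = 0"
  proof transfer
    fix f :: "'a \<Rightarrow> 'b"
    assume "sq_integrable f \<and> sq_integrable f \<and> (AE x in lebesgue. f x = f x)"
    then have f: "sq_integrable f" by blast
    have "(\<integral>x. f x \<bullet> f x \<partial>lebesgue) = 0 \<longleftrightarrow> (AE x in lebesgue. f x \<bullet> f x = 0)"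
      by (rule integral_nonneg_eq_0_iff_AE) (use f sq_integrable_inner in auto)
    then show "(\<integral>x. f x \<bullet> f x \<partial>lebesgue) = 0 \<longleftrightarrow>
                 sq_integrable f \<and> sq_integrable (\<lambda>x. 0 :: 'b) \<and> (AE x in lebesgue. f x = 0)"
      using f sq_integrable_zero by auto
  qed
  show "norm f = sqrt (inner f f)" by (rule norm_l2_def)
qed

end

lemma norm_abs_l2:
  assumes "sq_integrable f"
  shows "(norm (abs_l2 f))\<^sup>2 = (\<integral>x. (norm (f x))\<^sup>2 \<partial>lebesgue)"
proof -
  have "inner (abs_l2 f) (abs_l2 f) = (\<integral>x. f x \<bullet> f x \<partial>lebesgue)"
    by (rule inner_l2.abs_eq) (use assms in auto)
  then show ?thesis by (simp add: power2_norm_eq_inner)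
qed

lemma diff_abs_l2:
  assumes "sq_integrable f" "sq_integrable g"
  shows "abs_l2 f - abs_l2 g = abs_l2 (\<lambda>x. f x - g x)"
  by (rule minus_l2.abs_eq) (use assms in auto)

lemma ex_abs_l2: "\<exists>f. sq_integrable f \<and> F = abs_l2 f"
proof (intro exI conjI)
  show "sq_integrable (rep_l2 F)"
    using Quotient_rep_reflp[OF Quotient_l2] by blast
  show "F = abs_l2 (rep_l2 F)"
    by (rule Quotient_abs_rep[OF Quotient_l2, symmetric])
qed

lemma tendsto_abs_l2:
  fixes f :: "'a::euclidean_space \<Rightarrow> 'b::euclidean_space"
  assumes F: "\<And>n. sq_integrable (F n)" and f: "sq_integrable f"
    and lim: "AE x in lebesgue. (\<lambda>n. F n x) \<longlonglongrightarrow> f x"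
    and bound: "\<And>n. AE x in lebesgue. norm (F n x) \<le> 2 * norm (f x)"
  shows "(\<lambda>n. abs_l2 (F n)) \<longlonglongrightarrow> abs_l2 f"
proof -
  have [measurable]: "F n \<in> borel_measurable lebesgue" "f \<in> borel_measurable lebesgue" for n
    using F f by (auto simp: sq_integrable_def)
  have "(\<lambda>n. \<integral>x. (norm (F n x - f x))\<^sup>2 \<partial>lebesgue) \<longlonglongrightarrow> integral\<^sup>L lebesgue (\<lambda>x :: 'a. 0)"
  proof (rule integral_dominated_convergence)
    show "integrable lebesgue (\<lambda>x. 9 * (norm (f x))\<^sup>2)"
      using f by (auto simp: sq_integrable_def)
    show "AE x in lebesgue. (\<lambda>n. (norm (F n x - f x))\<^sup>2) \<longlonglongrightarrow> 0"
      using lim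
    proof eventually_elim
      case (elim x)
      then have "(\<lambda>n. (norm (F n x - f x))\<^sup>2) \<longlonglongrightarrow> (norm (f x - f x))\<^sup>2"
        by (intro tendsto_intros)
      then show ?case by simp
    qed
    show "AE x in lebesgue. norm ((norm (F n x - f x))\<^sup>2) \<le> 9 * (norm (f x))\<^sup>2" for n
      using bound[of n]
    proof eventually_elim
      case (elim x)
      have "norm (F n x - f x) \<le> 3 * norm (f x)"
        using norm_triangle_ineq4[of "F n x" "f x"] elim by linarith
      then have "(norm (F n x - f x))\<^sup>2 \<le> (3 * norm (f x))\<^sup>2"
        by (intro power_mono) auto
      then show ?case by (simp add: power_mult_distrib)
    qed
  qed measurable
  then have "(\<lambda>n. (norm (abs_l2 (F n) - abs_l2 f))\<^sup>2) \<longlonglongrightarrow> 0"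
    using F f by (simp add: diff_abs_l2 norm_abs_l2 sq_integrable_diff)
  then have "(\<lambda>n. sqrt ((norm (abs_l2 (F n) - abs_l2 f))\<^sup>2)) \<longlonglongrightarrow> sqrt 0"
    by (intro tendsto_real_sqrt)
  then have "(\<lambda>n. norm (abs_l2 (F n) - abs_l2 f)) \<longlonglongrightarrow> 0"
    by simp
  then show ?thesis
    by (metis LIM_zero_iff tendsto_norm_zero_iff)
qed

lemma sq_integrable_nn:
  assumes [measurable]: "f \<in> borel_measurable lebesgue"
    and "(\<integral>\<^sup>+x. ennreal ((norm (f x))\<^sup>2) \<partial>lebesgue) \<le> ennreal c"
  shows "sq_integrable f" and "0 \<le> c \<Longrightarrow> (norm (abs_l2 f))\<^sup>2 \<le> c"
proof -
  have "(\<integral>\<^sup>+x. ennreal ((norm (f x))\<^sup>2) \<partial>lebesgue) < \<infinity>"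
    using assms(2) by (simp add: le_less_trans)
  then have int: "integrable lebesgue (\<lambda>x. (norm (f x))\<^sup>2)"
    by (intro integrableI_nonneg) auto
  then show sq: "sq_integrable f"
    by (simp add: sq_integrable_def)
  assume "0 \<le> c"
  then show "(norm (abs_l2 f))\<^sup>2 \<le> c"
    using assms(2) int by (simp add: norm_abs_l2[OF sq] nn_integral_eq_integral)
qed

instance l2 :: (euclidean_space, euclidean_space) banach
proof
  fix X :: "nat \<Rightarrow> ('a, 'b) l2"
  assume X: "Cauchy X"
  have "\<forall>k. \<exists>N. \<forall>m\<ge>N. \<forall>n\<ge>N. norm (X m - X n) < (1/4) ^ k"
    using X unfolding Cauchy_def dist_norm by simp
  then obtain N where N: "\<And>k m n. m \<ge> N k \<Longrightarrow> n \<ge> N k \<Longrightarrow> norm (X m - X n) < (1/4) ^ k"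
    by metis
  define r where "r k = k + (\<Sum>j\<le>k. N j)" for k
  have r_N: "r j \<ge> N k" if "j \<ge> k" for j k
  proof -
    have "N k \<le> (\<Sum>j\<le>j. N j)"
      by (rule member_le_sum) (use that in auto)
    then show ?thesis by (simp add: r_def)
  qed
  have r: "strict_mono r"
    unfolding strict_mono_Suc_iff r_def by simp
  have "\<forall>k. \<exists>g. sq_integrable g \<and> X (r k) = abs_l2 g"
    using ex_abs_l2 by blast
  then obtain G where G: "\<And>k. sq_integrable (G k)" and XG: "\<And>k. X (r k) = abs_l2 (G k)"
    by metis
  have [measurable]: "G k \<in> borel_measurable lebesgue" for k
    using G by (simp add: sq_integrable_def)
  have diff: "(\<integral>\<^sup>+x. ennreal ((norm (G j x - G k x))\<^sup>2) \<partial>lebesgue) \<le> ennreal ((1/16) ^ k)"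
    if "j \<ge> k" for j k
  proof -
    have "norm (X (r j) - X (r k)) < (1/4) ^ k"
      using N r_N that by blast
    then have "(norm (X (r j) - X (r k)))\<^sup>2 \<le> ((1/4) ^ k)\<^sup>2"
      by (intro power_mono) auto
    also have "((1/4) ^ k)\<^sup>2 = ((1/16) ^ k :: real)"
      by (simp add: power2_eq_square flip: power_mult_distrib)
    finally have "(\<integral>x. (norm (G j x - G k x))\<^sup>2 \<partial>lebesgue) \<le> (1/16) ^ k"
      by (simp add: XG diff_abs_l2 G norm_abs_l2 sq_integrable_diff)
    then show ?thesis
      by (subst nn_integral_eq_integral)
         (auto intro!: sq_integrable_integrable sq_integrable_diff G ennreal_leI)
  qed
  define d where "d k x = 4 ^ k * (norm (G (Suc k) x - G k x))\<^sup>2" for k x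
  have [measurable]: "d k \<in> borel_measurable lebesgue" for k
    unfolding d_def[abs_def] by measurable
  have d_nonneg: "0 \<le> d k x" for k x
    by (simp add: d_def)
  have d_int: "(\<integral>\<^sup>+x. ennreal (d k x) \<partial>lebesgue) \<le> ennreal ((1/4) ^ k)" for k
  proof -
    have "(\<integral>\<^sup>+x. ennreal (d k x) \<partial>lebesgue)
        = ennreal (4 ^ k) * (\<integral>\<^sup>+x. ennreal ((norm (G (Suc k) x - G k x))\<^sup>2) \<partial>lebesgue)"
      unfolding d_def by (subst nn_integral_cmult[symmetric]) (auto simp: ennreal_mult)
    also have "\<dots> \<le> ennreal (4 ^ k) * ennreal ((1/16) ^ k)"
      by (intro mult_left_mono diff) auto
    also have "\<dots> = ennreal ((1/4) ^ k)"
      by (simp add: ennreal_mult[symmetric] flip: power_mult_distrib)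
    finally show ?thesis .
  qed
  have "(\<integral>\<^sup>+x. (\<Sum>k. ennreal (d k x)) \<partial>lebesgue) = (\<Sum>k. \<integral>\<^sup>+x. ennreal (d k x) \<partial>lebesgue)"
    by (rule nn_integral_suminf) measurable
  also have "\<dots> \<le> (\<Sum>k. ennreal ((1/4) ^ k))"
    by (intro suminf_le d_int) auto
  also have "\<dots> = ennreal (\<Sum>k. (1/4) ^ k)"
    by (rule suminf_ennreal2) (auto intro: summable_geometric)
  finally have "(\<integral>\<^sup>+x. (\<Sum>k. ennreal (d k x)) \<partial>lebesgue) \<noteq> \<infinity>"
    by (auto simp: top_unique)
  then have "AE x in lebesgue. (\<Sum>k. ennreal (d k x)) \<noteq> \<infinity>"
    by (intro nn_integral_PInf_AE) measurable
  then have conv: "AE x in lebesgue. convergent (\<lambda>k. G k x)"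
  proof eventually_elim
    case (elim x)
    then have "summable (\<lambda>k. d k x)"
      by (intro summable_suminf_not_top d_nonneg) (simp add: top_ennreal_def)
    then have "Bseq (\<lambda>k. d k x)"
      using summable_LIMSEQ_zero convergentI convergent_imp_Bseq by blast
    then obtain B where B: "B > 0" "\<And>k. d k x \<le> B"
      by (metis BseqE abs_le_D1 real_norm_def)
    have "norm (G (Suc k) x - G k x) \<le> sqrt B * (1/2) ^ k" for k
    proof -
      have "(2 ^ k * norm (G (Suc k) x - G k x))\<^sup>2 = d k x"
        unfolding d_def power_mult_distrib
        by (simp add: power2_eq_square[of "2 ^ k"] flip: power_mult_distrib)
      then have "2 ^ k * norm (G (Suc k) x - G k x) \<le> sqrt B"
        using B(2)[of k] by (metis real_le_rsqrt)
      then show ?thesis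
        by (simp add: power_divide field_simps)
    qed
    note bnd = this
    have sm: "summable (\<lambda>k. sqrt B * (1/2) ^ k)"
      by (rule summable_mult) (simp add: summable_geometric)
    have "summable (\<lambda>k. G (Suc k) x - G k x)"
      by (rule summable_comparison_test'[OF sm, of 0]) (rule bnd)
    then have "convergent (\<lambda>n. \<Sum>k<n. G (Suc k) x - G k x)"
      by (simp add: summable_iff_convergent)
    then have "convergent (\<lambda>n. G n x - G 0 x)"
      using sum_lessThan_telescope[of "\<lambda>k. G k x"] by simp
    then show ?case
      by (simp add: convergent_diff_const_right_iff)
  qed
  define f where "f x = lim (\<lambda>k. G k x)" for x
  have f_meas [measurable]: "f \<in> borel_measurable lebesgue"
    unfolding f_def[abs_def] by (rule borel_measurable_lim_metric) measurable
  have lim: "AE x in lebesgue. (\<lambda>k. G k x) \<longlonglongrightarrow> f x"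
    using conv by eventually_elim (simp add: f_def convergent_LIMSEQ_iff)
  have fG: "(\<integral>\<^sup>+x. ennreal ((norm (f x - G k x))\<^sup>2) \<partial>lebesgue) \<le> ennreal ((1/16) ^ k)" for k
  proof -
    have "(\<integral>\<^sup>+x. ennreal ((norm (f x - G k x))\<^sup>2) \<partial>lebesgue)
        = (\<integral>\<^sup>+x. liminf (\<lambda>j. ennreal ((norm (G j x - G k x))\<^sup>2)) \<partial>lebesgue)"
    proof (rule nn_integral_cong_AE)
      show "AE x in lebesgue. ennreal ((norm (f x - G k x))\<^sup>2)
              = liminf (\<lambda>j. ennreal ((norm (G j x - G k x))\<^sup>2))"
        using lim
      proof eventually_elim
        case (elim x)
        then have "(\<lambda>j. ennreal ((norm (G j x - G k x))\<^sup>2)) \<longlonglongrightarrow> ennreal ((norm (f x - G k x))\<^sup>2)"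
          by (intro tendsto_intros tendsto_ennrealI)
        then show ?case
          by (metis lim_imp_Liminf sequentially_bot)
      qed
    qed
    also have "\<dots> \<le> liminf (\<lambda>j. \<integral>\<^sup>+x. ennreal ((norm (G j x - G k x))\<^sup>2) \<partial>lebesgue)"
      by (rule nn_integral_liminf) measurable
    also have "\<dots> \<le> liminf (\<lambda>j. ennreal ((1/16) ^ k))"
      by (rule Liminf_mono) (use diff in \<open>auto intro!: eventually_sequentiallyI[of k]\<close>)
    finally show ?thesis by (simp add: Liminf_const)
  qed
  have fG_sq: "sq_integrable (\<lambda>x. f x - G k x)"
    and fG_norm: "(norm (abs_l2 (\<lambda>x. f x - G k x)))\<^sup>2 \<le> (1/16) ^ k" for k
    using sq_integrable_nn[OF _ fG[of k]] by (auto intro!: borel_measurable_diff)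
  have f: "sq_integrable f"
    using sq_integrable_add[OF fG_sq[of 0] G[of 0]] by simp
  have "norm (X (r k) - abs_l2 f) \<le> (1/4) ^ k" for k
  proof (rule power2_le_imp_le)
    have "norm (X (r k) - abs_l2 f) = norm (abs_l2 f - X (r k))"
      by (rule norm_minus_commute)
    then show "(norm (X (r k) - abs_l2 f))\<^sup>2 \<le> ((1/4) ^ k)\<^sup>2"
      using fG_norm[of k]
      by (simp add: XG diff_abs_l2 f G power2_eq_square[of "(1/4) ^ k"] flip: power_mult_distrib)
  qed simp
  then have "(\<lambda>k. X (r k) - abs_l2 f) \<longlonglongrightarrow> 0"
    by (rule Lim_null_comparison[OF always_eventually[OF allI]]) (rule LIMSEQ_power_zero, simp)
  then have "(\<lambda>k. X (r k)) \<longlonglongrightarrow> abs_l2 f"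
    by (rule LIM_zero_cancel)
  then have "X \<longlonglongrightarrow> abs_l2 f"
    by (intro Cauchy_converges_subseq[OF X r]) (simp add: comp_def)
  then show "convergent X"
    by (rule convergentI)
qed

lemma closure_l2_lim:
  fixes X :: "nat \<Rightarrow> ('a::euclidean_space, 'b::euclidean_space) l2"
  assumes "\<And>n. X n \<in> closure D" "X \<longlonglongrightarrow> x"
  shows "x \<in> closure D"
  using closed_sequentially[OF closed_closure] assms by blast

lemma sq_integrable_indicator:
  assumes "A \<in> lmeasurable"
  shows "sq_integrable (\<lambda>x. indicator A x *\<^sub>R y)"
proof -
  have [measurable]: "A \<in> sets lebesgue"
    using assms by (simp add: fmeasurableD)
  have "integrable lebesgue (\<lambda>x. indicator A x * (norm y)\<^sup>2)"
    using assms by (intro integrable_mult_left integrable_real_indicator)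
                   (auto simp: fmeasurable_def)
  then have "integrable lebesgue (\<lambda>x. (norm (indicator A x *\<^sub>R y))\<^sup>2)"
    by (rule Bochner_Integration.integrable_cong[THEN iffD1, rotated -1])
       (auto simp: indicator_def)
  then show ?thesis
    unfolding sq_integrable_def by simp
qed

lemma countable_dense_l2:
  "\<exists>D :: ('a::euclidean_space, 'b::euclidean_space) l2 set. countable D \<and> closure D = UNIV"
proof -
  obtain \<B> :: "'a set set" where \<B>: "countable \<B>" "topological_basis \<B>"
    using ex_countable_basis by blast
  define \<U> where "\<U> = Union ` {\<F>. finite \<F> \<and> \<F> \<subseteq> \<B>} \<inter> lmeasurable"
  define ind where "ind A y = abs_l2 (\<lambda>x. indicator A x *\<^sub>R y)" for A :: "'a set" and y :: 'b
  define g where "g = from_nat_into (insert 0 ((\<lambda>(U, e). ind U e) ` (\<U> \<times> Basis)))"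
  have cnt: "countable (insert 0 ((\<lambda>(U, e). ind U e) ` (\<U> \<times> Basis)))"
    unfolding \<U>_def
    by (intro countable_insert countable_image countable_SIGMA countable_Int1
          countable_Collect_finite_subset \<B> countable_finite finite_Basis)
  have range_g: "range g = insert 0 ((\<lambda>(U, e). ind U e) ` (\<U> \<times> Basis))"
    unfolding g_def by (rule range_from_nat_into) (use cnt in auto)
  define F where "F l = (\<Sum>(q, i)\<leftarrow>l. of_rat q *\<^sub>R g i)" for l :: "(rat \<times> nat) list"
  define D where "D = range F"
  define W where "W = closure D"
  have cD: "countable D"
    by (simp add: D_def)
  have lim: "x \<in> W" if "\<And>n. X n \<in> W" "X \<longlonglongrightarrow> x" for X :: "nat \<Rightarrow> ('a, 'b) l2" and x
    using closure_l2_lim that unfolding W_def by blast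
  have F_app: "F (k @ l) = F k + F l" for k l
    by (simp add: F_def)
  have F_scale: "F (map (\<lambda>(q, i). (r * q, i)) l) = of_rat r *\<^sub>R F l" for r l
    unfolding F_def by (induction l) (auto simp: of_rat_mult scaleR_add_right)
  have DW: "d \<in> W" if "d \<in> D" for d
    using that closure_subset unfolding W_def by blast
  have seq: "\<exists>X. (\<forall>n. X n \<in> D) \<and> X \<longlonglongrightarrow> x" if "x \<in> W" for x
    using that unfolding W_def closure_sequential .
  have W_add: "x + y \<in> W" if "x \<in> W" "y \<in> W" for x y
  proof -
    obtain X Y where X: "\<And>n. X n \<in> D" "X \<longlonglongrightarrow> x" and Y: "\<And>n. Y n \<in> D" "Y \<longlonglongrightarrow> y"
      using seq[OF \<open>x \<in> W\<close>] seq[OF \<open>y \<in> W\<close>] by metis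
    have "X n + Y n \<in> D" for n
    proof -
      obtain k l where "X n = F k" "Y n = F l"
        using X(1)[of n] Y(1)[of n] by (auto simp: D_def)
      then show ?thesis
        unfolding D_def by (metis F_app rangeI)
    qed
    then show ?thesis
      using lim[of "\<lambda>n. X n + Y n"] DW tendsto_add[OF X(2) Y(2)] by blast
  qed
  have W_scale: "c *\<^sub>R x \<in> W" if "x \<in> W" for c x
  proof -
    obtain X where X: "\<And>n. X n \<in> D" "X \<longlonglongrightarrow> x"
      using seq[OF \<open>x \<in> W\<close>] by metis
    have "c \<in> closure \<rat>"
      unfolding closure_approachable
    proof safe
      fix e :: real assume "e > 0"
      then obtain q where "q \<in> \<rat>" "c < q" "q < c + e"
        using Rats_dense_in_real[of c "c + e"] by auto
      then show "\<exists>q\<in>\<rat>. dist q c < e"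
        by (intro bexI[of _ q]) (auto simp: dist_real_def)
    qed
    then obtain q where q: "\<And>n. q n \<in> \<rat>" "q \<longlonglongrightarrow> c"
      unfolding closure_sequential by blast
    have "q n *\<^sub>R X n \<in> D" for n
    proof -
      obtain r l where "q n = of_rat r" "X n = F l"
        using q(1)[of n] X(1)[of n] by (auto simp: D_def elim: Rats_cases)
      then show ?thesis
        unfolding D_def by (metis F_scale rangeI)
    qed
    then show ?thesis
      using lim[of "\<lambda>n. q n *\<^sub>R X n"] DW tendsto_scaleR[OF q(2) X(2)] by blast
  qed
  have W_0: "0 \<in> W"
  proof -
    have "F [] \<in> D" unfolding D_def by (rule rangeI)
    then show ?thesis using DW by (simp add: F_def)
  qed
  have W_g: "g i \<in> W" for i
  proof -
    have "F [(1, i)] \<in> D" unfolding D_def by (rule rangeI)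
    then show ?thesis using DW by (simp add: F_def)
  qed
  have ind_U: "ind U e \<in> W" if "U \<in> \<U>" "e \<in> Basis" for U e
  proof -
    have "ind U e \<in> range g"
      unfolding range_g using that by auto
    then show ?thesis using W_g by auto
  qed
  have ind_open: "ind U e \<in> W" if U: "open U" "U \<in> lmeasurable" and e: "e \<in> Basis" for U e
  proof -
    obtain \<C> where \<C>: "\<C> \<subseteq> \<B>" "\<Union>\<C> = U"
      using \<B>(2) U(1) unfolding topological_basis_def by blast
    have "countable \<C>"
      using \<B>(1) \<C>(1) countable_subset by blast
    then have c': "countable (insert {} \<C>)" by simp
    define c where "c = from_nat_into (insert {} \<C>)"
    have rc: "range c = insert {} \<C>"
      unfolding c_def by (rule range_from_nat_into) (use c' in auto)
    define V where "V n = (\<Union>i\<le>n. c i)" for n :: nat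
    have c_open: "open (c i)" for i
    proof -
      have "c i \<in> insert {} \<C>" using rc by blast
      then show ?thesis
        using \<C>(1) \<B>(2) topological_basis_open by auto
    qed
    have V_sub: "V n \<subseteq> U" for n
    proof -
      have "c i \<subseteq> U" for i
        using rc \<C>(2) by (metis Sup_upper UnionI empty_subsetI insertE rangeI subsetI)
      then show ?thesis by (auto simp: V_def)
    qed
    have V_meas: "V n \<in> lmeasurable" for n
    proof (rule fmeasurableI2[OF U(2) V_sub])
      have "open (V n)" unfolding V_def by (intro open_UN ballI c_open)
      then show "V n \<in> sets lebesgue" by auto
    qed
    have V_\<U>: "V n \<in> \<U>" for n
    proof -
      have "V n = \<Union>(c ` {..n} - {{}})" by (auto simp: V_def)
      moreover have "c ` {..n} - {{}} \<subseteq> \<B>"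
        using rc \<C>(1) by (metis Diff_subset_conv image_mono insert_is_Un subset_UNIV subset_trans Un_mono order_refl)
      ultimately show ?thesis
        using V_meas[of n] unfolding \<U>_def by blast
    qed
    have "(\<lambda>n. ind (V n) e) \<longlonglongrightarrow> ind U e"
      unfolding ind_def
    proof (rule tendsto_abs_l2)
      show "sq_integrable (\<lambda>x. indicator (V n) x *\<^sub>R e)" for n
        by (rule sq_integrable_indicator[OF V_meas])
      show "sq_integrable (\<lambda>x. indicator U x *\<^sub>R e)"
        by (rule sq_integrable_indicator[OF U(2)])
      have "(\<lambda>n. indicator (V n) x *\<^sub>R e) \<longlonglongrightarrow> indicator U x *\<^sub>R e" for x
      proof (cases "x \<in> U")
        case True
        then obtain C where "C \<in> \<C>" "x \<in> C" using \<C>(2) by blast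
        then obtain i where "x \<in> c i"
          using rc by (metis insertI2 rangeE)
        then have "x \<in> V n" if "n \<ge> i" for n
          using that by (auto simp: V_def)
        then have "eventually (\<lambda>n. indicator (V n) x *\<^sub>R e = indicator U x *\<^sub>R e) sequentially"
          using True by (intro eventually_sequentiallyI[of i]) auto
        then show ?thesis by (rule tendsto_eventually)
      next
        case False
        then have "x \<notin> V n" for n using V_sub by blast
        then show ?thesis using False by simp
      qed
      then show "AE x in lebesgue. (\<lambda>n. indicator (V n) x *\<^sub>R e) \<longlonglongrightarrow> indicator U x *\<^sub>R e"
        by (intro AE_I2)
      have "norm (indicator (V n) x *\<^sub>R e) \<le> 2 * norm (indicator U x *\<^sub>R e)" for n x
        using V_sub[of n] by (auto simp: indicator_def)
      then show "AE x in lebesgue. norm (indicator (V n) x *\<^sub>R e) \<le> 2 * norm (indicator U x *\<^sub>R e)" for n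
        by (intro AE_I2)
    qed
    moreover have "ind (V n) e \<in> W" for n
      by (rule ind_U[OF V_\<U> e])
    ultimately show ?thesis by (rule lim[rotated])
  qed
  have ind_basis: "ind A e \<in> W" if A: "A \<in> lmeasurable" and e: "e \<in> Basis" for A e
  proof -
    have "\<exists>T. open T \<and> A \<subseteq> T \<and> T \<in> lmeasurable \<and> measure lebesgue (T - A) \<le> (1/2) ^ n" for n :: nat
    proof -
      have "A \<in> sets lebesgue" using A by (rule fmeasurableD)
      then obtain T where T: "open T" "A \<subseteq> T" "T - A \<in> lmeasurable"
        "emeasure lebesgue (T - A) < ennreal ((1/2) ^ n)"
        by (rule sets_lebesgue_outer_open[where e = "(1/2) ^ n"]) auto
      have "T = A \<union> (T - A)" using T(2) by blast
      then have "T \<in> lmeasurable"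
        using fmeasurable.Un[OF A T(3)] by simp
      moreover have "measure lebesgue (T - A) \<le> (1/2) ^ n"
        using T(4) unfolding measure_def by (intro enn2real_leI) auto
      ultimately show ?thesis using T by blast
    qed
    then obtain T where T: "\<And>n. open (T n)" "\<And>n. A \<subseteq> T n" "\<And>n. T n \<in> lmeasurable"
      "\<And>n. measure lebesgue (T n - A) \<le> (1/2) ^ n" by metis
    have sqn: "(norm (ind (T n) e - ind A e))\<^sup>2 \<le> (1/2) ^ n" for n
    proof -
      have diff: "indicator (T n) x *\<^sub>R e - indicator A x *\<^sub>R e = indicator (T n - A) x *\<^sub>R e" for x
        using T(2)[of n] by (auto simp: indicator_def)
      have TA: "T n - A \<in> lmeasurable"
        by (rule fmeasurable.Diff[OF T(3) A])
      have "(norm (ind (T n) e - ind A e))\<^sup>2 = (norm (abs_l2 (\<lambda>x. indicator (T n - A) x *\<^sub>R e)))\<^sup>2"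
        unfolding ind_def
        by (simp only: diff_abs_l2[OF sq_integrable_indicator[OF T(3)] sq_integrable_indicator[OF A]] diff)
      also have "\<dots> = (\<integral>x. (norm (indicator (T n - A) x *\<^sub>R e))\<^sup>2 \<partial>lebesgue)"
        by (rule norm_abs_l2[OF sq_integrable_indicator[OF TA]])
      also have "\<dots> = (\<integral>x. indicator (T n - A) x \<partial>lebesgue)"
        by (rule Bochner_Integration.integral_cong) (use e in \<open>auto simp: indicator_def\<close>)
      also have "\<dots> = measure lebesgue (T n - A)"
        by simp
      finally show ?thesis using T(4) by simp
    qed
    have "(\<lambda>n. ind (T n) e) \<longlonglongrightarrow> ind A e"
    proof -
      have "(\<lambda>n. (norm (ind (T n) e - ind A e))\<^sup>2) \<longlonglongrightarrow> 0"
      proof (rule Lim_null_comparison[OF always_eventually[OF allI]])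
        show "norm ((norm (ind (T n) e - ind A e))\<^sup>2) \<le> (1/2) ^ n" for n
          using sqn[of n] by simp
        show "(\<lambda>n. (1/2) ^ n) \<longlonglongrightarrow> (0 :: real)"
          by (rule LIMSEQ_power_zero) simp
      qed
      then have "(\<lambda>n. sqrt ((norm (ind (T n) e - ind A e))\<^sup>2)) \<longlonglongrightarrow> sqrt 0"
        by (rule tendsto_real_sqrt)
      then have "(\<lambda>n. norm (ind (T n) e - ind A e)) \<longlonglongrightarrow> 0"
        by simp
      then have "(\<lambda>n. ind (T n) e - ind A e) \<longlonglongrightarrow> 0"
        by (rule tendsto_norm_zero_cancel)
      then show ?thesis
        by (rule LIM_zero_cancel)
    qed
    moreover have "ind (T n) e \<in> W" for n
      by (rule ind_open[OF T(1) T(3) e])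
    ultimately show ?thesis by (rule lim[rotated])
  qed
  have ind_add: "ind A (y + z) = ind A y + ind A z" if "A \<in> lmeasurable" for A y z
    unfolding ind_def
    by (subst plus_l2.abs_eq) (use sq_integrable_indicator[OF that] in \<open>auto simp: scaleR_add_right\<close>)
  have ind_scale: "ind A (c *\<^sub>R y) = c *\<^sub>R ind A y" if "A \<in> lmeasurable" for A c y
    unfolding ind_def
    by (subst scaleR_l2.abs_eq) (use sq_integrable_indicator[OF that] in \<open>auto simp: mult.commute\<close>)
  have ind_0: "ind A 0 = 0" for A
    unfolding ind_def by (simp add: zero_l2.abs_eq)
  have ind_all: "ind A y \<in> W" if A: "A \<in> lmeasurable" for A y
  proof -
    have "ind A (\<Sum>e\<in>S. (y \<bullet> e) *\<^sub>R e) \<in> W" if "finite S" "S \<subseteq> Basis" for S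
      using that
      by (induction S rule: finite_induct)
         (auto simp: ind_0 W_0 ind_add[OF A] ind_scale[OF A] intro!: W_add W_scale ind_basis[OF A])
    from this[of Basis] show ?thesis
      by (simp add: euclidean_representation)
  qed
  have simple: "abs_l2 s \<in> W" if s: "simple_function lebesgue s" "sq_integrable s" for s
  proof -
    have fin: "finite (range s)"
      using s(1) unfolding simple_function_def by simp
    have meas: "s -` {y} \<in> lmeasurable" if "y \<noteq> 0" for y
    proof -
      have sets: "s -` {y} \<in> sets lebesgue"
        using s(1) simple_functionD(2)[OF s(1), of "{y}"] by simp
      have "integrable lebesgue (indicator (s -` {y}) :: 'a \<Rightarrow> real)"
      proof (rule Bochner_Integration.integrable_bound)
        show "integrable lebesgue (\<lambda>x. (1 / (norm y)\<^sup>2) * (norm (s x))\<^sup>2)"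
          using s(2) by (intro integrable_mult_right sq_integrable_integrable)
        show "(indicator (s -` {y}) :: 'a \<Rightarrow> real) \<in> borel_measurable lebesgue"
          using sets by simp
        show "AE x in lebesgue. norm (indicator (s -` {y}) x :: real)
                \<le> norm ((1 / (norm y)\<^sup>2) * (norm (s x))\<^sup>2)"
          using that by (intro AE_I2) (auto simp: indicator_def)
      qed
      then show ?thesis
        using sets by (simp add: integrable_indicator_iff fmeasurable_def)
    qed
    have sum: "sq_integrable (\<lambda>x. \<Sum>y\<in>S. indicator (s -` {y}) x *\<^sub>R y) \<and>
          abs_l2 (\<lambda>x. \<Sum>y\<in>S. indicator (s -` {y}) x *\<^sub>R y) \<in> W"
      if "finite S" "0 \<notin> S" for S
      using that
    proof (induction S rule: finite_induct)
      case empty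
      then show ?case
        using W_0 by (simp add: sq_integrable_zero zero_l2.abs_eq[symmetric])
    next
      case (insert y S)
      then have IH: "sq_integrable (\<lambda>x. \<Sum>y\<in>S. indicator (s -` {y}) x *\<^sub>R y)"
        "abs_l2 (\<lambda>x. \<Sum>y\<in>S. indicator (s -` {y}) x *\<^sub>R y) \<in> W" by auto
      have m: "s -` {y} \<in> lmeasurable" using insert meas by auto
      have "ind (s -` {y}) y + abs_l2 (\<lambda>x. \<Sum>y\<in>S. indicator (s -` {y}) x *\<^sub>R y) \<in> W"
        using W_add[OF ind_all[OF m] IH(2)] .
      also have "ind (s -` {y}) y + abs_l2 (\<lambda>x. \<Sum>y\<in>S. indicator (s -` {y}) x *\<^sub>R y)
        = abs_l2 (\<lambda>x. indicator (s -` {y}) x *\<^sub>R y + (\<Sum>y\<in>S. indicator (s -` {y}) x *\<^sub>R y))"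
        unfolding ind_def
        by (rule plus_l2.abs_eq) (use sq_integrable_indicator[OF m] IH in auto)
      finally show ?case
        unfolding sum.insert[OF insert(1,2)]
        using sq_integrable_add[OF sq_integrable_indicator[OF m] IH(1)] by blast
    qed
    have "(\<Sum>y\<in>range s - {0}. indicator (s -` {y}) x *\<^sub>R y) = s x" for x
    proof -
      have "(\<Sum>y\<in>range s - {0}. indicator (s -` {y}) x *\<^sub>R y)
          = (\<Sum>y\<in>range s - {0}. if y = s x then s x else 0)"
        by (intro sum.cong) (auto simp: indicator_def)
      also have "\<dots> = s x"
        using fin by (simp add: sum.delta)
      finally show ?thesis .
    qed
    then show ?thesis
      using sum[of "range s - {0}"] fin by simp
  qed
  have "h \<in> W" for h
  proof -
    obtain f where f: "sq_integrable f" and h: "h = abs_l2 f"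
      using ex_abs_l2 by blast
    have fm: "f \<in> borel_measurable lebesgue"
      using f by (simp add: sq_integrable_def)
    obtain s where s: "\<And>i. simple_function lebesgue (s i)"
      and slim: "\<And>x. (\<lambda>i. s i x) \<longlonglongrightarrow> f x" and sb: "\<And>i x. norm (s i x) \<le> 2 * norm (f x)"
      using borel_measurable_implies_sequence_metric[OF fm, of 0] by (auto simp: dist_norm)
    have sq: "sq_integrable (s i)" for i
      unfolding sq_integrable_def
    proof
      show sm: "s i \<in> borel_measurable lebesgue"
        by (rule borel_measurable_simple_function[OF s])
      show "integrable lebesgue (\<lambda>x. (norm (s i x))\<^sup>2)"
      proof (rule Bochner_Integration.integrable_bound)
        show "integrable lebesgue (\<lambda>x. 4 * (norm (f x))\<^sup>2)"
          by (intro integrable_mult_right sq_integrable_integrable f)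
        show "(\<lambda>x. (norm (s i x))\<^sup>2) \<in> borel_measurable lebesgue"
          using sm by measurable
        have "(norm (s i x))\<^sup>2 \<le> (2 * norm (f x))\<^sup>2" for x
          by (rule power_mono[OF sb norm_ge_zero])
        then show "AE x in lebesgue. norm ((norm (s i x))\<^sup>2) \<le> norm (4 * (norm (f x))\<^sup>2)"
          by (intro AE_I2) (simp add: power_mult_distrib)
      qed
    qed
    have "(\<lambda>i. abs_l2 (s i)) \<longlonglongrightarrow> abs_l2 f"
      by (rule tendsto_abs_l2[OF sq f]) (use slim sb in auto)
    then show ?thesis
      unfolding h using lim[of "\<lambda>i. abs_l2 (s i)"] simple[OF s sq] by blast
  qed
  then show ?thesis
    using cD unfolding W_def by blast
qed

instance l2 :: (euclidean_space, euclidean_space) second_countable_topology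
proof
  obtain D :: "('a, 'b) l2 set" where D: "countable D" "closure D = UNIV"
    using countable_dense_l2 by blast
  define B where "B = (\<lambda>(d, n). ball d (1 / real (Suc n))) ` (D \<times> UNIV)"
  have "topological_basis B"
  proof (rule topological_basisI)
    show "open U" if "U \<in> B" for U
      using that by (auto simp: B_def)
    fix U :: "('a, 'b) l2 set" and x
    assume U: "open U" "x \<in> U"
    then obtain e where e: "e > 0" "ball x e \<subseteq> U"
      using openE by blast
    obtain n :: nat where n: "1 / real (Suc n) < e / 2"
      using e(1) by (metis half_gt_zero nat_approx_posE)
    have "x \<in> closure D" using D(2) by simp
    then obtain d where d: "d \<in> D" "dist d x < 1 / real (Suc n)"
      unfolding closure_approachable by (metis divide_pos_pos of_nat_0_less_iff zero_less_Suc zero_less_one)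
    have "ball d (1 / real (Suc n)) \<subseteq> ball x e"
    proof
      fix y assume "y \<in> ball d (1 / real (Suc n))"
      then have "dist d y < e / 2" using n by simp
      moreover have "dist x d < e / 2" using d n by (simp add: dist_commute)
      ultimately show "y \<in> ball x e"
        using dist_triangle[of x y d] by simp
    qed
    moreover have "ball d (1 / real (Suc n)) \<in> B" using d(1) by (auto simp: B_def)
    moreover have "x \<in> ball d (1 / real (Suc n))" using d(2) by simp
    ultimately show "\<exists>V\<in>B. x \<in> V \<and> V \<subseteq> U" using e(2) by blast
  qed
  moreover have "countable B"
    unfolding B_def using D(1) by (intro countable_image countable_SIGMA) auto
  ultimately show "\<exists>B :: ('a, 'b) l2 set set. countable B \<and> open = generate_topology B"
    using topological_basis_imp_subbasis by blast
qed

section \<open>Sobolev spaces on \<open>\<Omega>\<close>\<close>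

text \<open>\<open>Ck n \<phi>\<close> says that \<open>\<phi>\<close> is \<open>n\<close> times continuously differentiable; only the derivatives of
  order \<open>n\<close> need an explicit continuity condition, those of lower order are differentiable. Test
  functions and their derivatives are continuous with compact support, hence square-integrable,
  so that \<open>abs_l2\<close> may be applied to them.\<close>

primrec Ck :: "nat \<Rightarrow> ('a::euclidean_space \<Rightarrow> real) \<Rightarrow> bool" where
  "Ck 0 \<phi> \<longleftrightarrow> continuous_on UNIV \<phi>"
| "Ck (Suc n) \<phi> \<longleftrightarrow>
     (\<forall>x. \<phi> differentiable (at x)) \<and> (\<forall>i\<in>Basis. Ck n (\<lambda>x. frechet_derivative \<phi> (at x) i))"

definition test_functions :: "'a::euclidean_space set \<Rightarrow> ('a \<Rightarrow> real) set" where
  "test_functions \<Omega> =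
     {\<phi>. (\<forall>n. Ck n \<phi>) \<and> compact (closure {x. \<phi> x \<noteq> 0}) \<and> closure {x. \<phi> x \<noteq> 0} \<subseteq> \<Omega>}"

definition gradient :: "('a::euclidean_space \<Rightarrow> real) \<Rightarrow> 'a \<Rightarrow> 'a" where
  "gradient \<phi> x = (\<Sum>i\<in>Basis. frechet_derivative \<phi> (at x) i *\<^sub>R i)"

lift_definition vanishes_outside ::
  "'a::euclidean_space set \<Rightarrow> ('a, 'b::euclidean_space) l2 \<Rightarrow> bool"
  is "\<lambda>\<Omega> f. AE x in lebesgue. x \<notin> \<Omega> \<longrightarrow> f x = 0"
proof -
  fix \<Omega> :: "'a set" and f g :: "'a \<Rightarrow> 'b"
  assume "sq_integrable f \<and> sq_integrable g \<and> (AE x in lebesgue. f x = g x)"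
  then have eq: "AE x in lebesgue. f x = g x" by blast
  show "(AE x in lebesgue. x \<notin> \<Omega> \<longrightarrow> f x = 0) = (AE x in lebesgue. x \<notin> \<Omega> \<longrightarrow> g x = 0)"
  proof
    assume "AE x in lebesgue. x \<notin> \<Omega> \<longrightarrow> f x = 0"
    with eq show "AE x in lebesgue. x \<notin> \<Omega> \<longrightarrow> g x = 0" by eventually_elim simp
  next
    assume "AE x in lebesgue. x \<notin> \<Omega> \<longrightarrow> g x = 0"
    with eq show "AE x in lebesgue. x \<notin> \<Omega> \<longrightarrow> f x = 0" by eventually_elim simp
  qed
qed

definition L2_on :: "'a::euclidean_space set \<Rightarrow> ('a, 'b::euclidean_space) l2 set" where
  "L2_on \<Omega> = {f. vanishes_outside \<Omega> f}"

definition has_weak_gradient ::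
  "'a::euclidean_space set \<Rightarrow> ('a, real) l2 \<Rightarrow> ('a, 'a) l2 \<Rightarrow> bool" where
  "has_weak_gradient \<Omega> u g \<longleftrightarrow> g \<in> L2_on \<Omega> \<and>
     (\<forall>\<phi>\<in>test_functions \<Omega>. \<forall>i\<in>Basis.
        u \<bullet> abs_l2 (\<lambda>x. frechet_derivative \<phi> (at x) i) = - (g \<bullet> abs_l2 (\<lambda>x. \<phi> x *\<^sub>R i)))"

definition H1_on :: "'a::euclidean_space set \<Rightarrow> ('a, real) l2 set" where
  "H1_on \<Omega> = {u \<in> L2_on \<Omega>. \<exists>g. has_weak_gradient \<Omega> u g}"

definition weak_gradient :: "'a::euclidean_space set \<Rightarrow> ('a, real) l2 \<Rightarrow> ('a, 'a) l2" where
  "weak_gradient \<Omega> u = (THE g. has_weak_gradient \<Omega> u g)"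

text \<open>\<open>H\<^sup>1\<^sub>0(\<Omega>)\<close> is the closure of the test functions in \<open>H\<^sup>1(\<Omega>)\<close>. The norm of a pair
  \<open>(u, \<nabla>u)\<close> in the product space is the \<open>H\<^sup>1\<close>-norm of \<open>u\<close>.\<close>

definition H10 :: "'a::euclidean_space set \<Rightarrow> ('a, real) l2 set" where
  "H10 \<Omega> = {u \<in> H1_on \<Omega>. (u, weak_gradient \<Omega> u)
     \<in> closure ((\<lambda>\<phi>. (abs_l2 \<phi>, abs_l2 (gradient \<phi>))) ` test_functions \<Omega>)}"

definition H10_norm :: "'a::euclidean_space set \<Rightarrow> ('a, real) l2 \<Rightarrow> real" where
  "H10_norm \<Omega> u = norm (weak_gradient \<Omega> u)"

definition has_weak_laplacian ::
  "'a::euclidean_space set \<Rightarrow> ('a, real) l2 \<Rightarrow> ('a, real) l2 \<Rightarrow> bool" where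
  "has_weak_laplacian \<Omega> u g \<longleftrightarrow> g \<in> L2_on \<Omega> \<and>
     (\<forall>\<phi>\<in>test_functions \<Omega>. - (weak_gradient \<Omega> u \<bullet> abs_l2 (gradient \<phi>)) = g \<bullet> abs_l2 \<phi>)"

definition dirichlet_eigenvalue :: "'a::euclidean_space set \<Rightarrow> real \<Rightarrow> bool" where
  "dirichlet_eigenvalue \<Omega> l \<longleftrightarrow>
     (\<exists>\<phi>\<in>H10 \<Omega>. \<phi> \<noteq> 0 \<and> has_weak_laplacian \<Omega> \<phi> (- l *\<^sub>R \<phi>))"

definition first_eigenvalue :: "'a::euclidean_space set \<Rightarrow> real" where
  "first_eigenvalue \<Omega> = (LEAST l. dirichlet_eigenvalue \<Omega> l)"

definition convex_polytopal_domain :: "'a::euclidean_space set \<Rightarrow> bool" where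
  "convex_polytopal_domain \<Omega> \<longleftrightarrow> \<Omega> \<noteq> {} \<and> (\<exists>P. polytope P \<and> \<Omega> = interior P)"


section \<open>Function spaces in time\<close>

text \<open>\<open>L2_time T X\<close> is \<open>L\<^sup>2(J; X)\<close> with \<open>J = (0, T)\<close>, for a closed subspace \<open>X\<close> of a separable
  Banach space with the norm of that space. In a separable space Borel measurability is the same as
  strong (Bochner) measurability.\<close>

definition L2_time ::
  "real \<Rightarrow> 'b::{banach, second_countable_topology} set \<Rightarrow> (real \<Rightarrow> 'b) set" where
  "L2_time T X = {u. u \<in> borel_measurable (lebesgue_on {0<..<T}) \<and>
     (AE t in lebesgue_on {0<..<T}. u t \<in> X) \<and>
     integrable (lebesgue_on {0<..<T}) (\<lambda>t. (norm (u t))\<^sup>2)}"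

definition L2_time_norm :: "real \<Rightarrow> (real \<Rightarrow> 'b::real_normed_vector) \<Rightarrow> real" where
  "L2_time_norm T u = sqrt (\<integral>t. (norm (u t))\<^sup>2 \<partial>lebesgue_on {0<..<T})"

text \<open>The norm of \<open>L\<^sup>2(J; H\<^sup>1\<^sub>0(\<Omega>))\<close>.\<close>

definition L2_H10_norm ::
  "'a::euclidean_space set \<Rightarrow> real \<Rightarrow> (real \<Rightarrow> ('a, real) l2) \<Rightarrow> real" where
  "L2_H10_norm \<Omega> T u = sqrt (\<integral>t. (H10_norm \<Omega> (u t))\<^sup>2 \<partial>lebesgue_on {0<..<T})"

definition has_weak_time_derivative ::
  "real \<Rightarrow> (real \<Rightarrow> 'b::{banach, second_countable_topology}) \<Rightarrow> (real \<Rightarrow> 'b) \<Rightarrow> bool" where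
  "has_weak_time_derivative T u u' \<longleftrightarrow>
     (\<forall>\<phi>\<in>test_functions {0<..<T}.
        (\<integral>t. deriv \<phi> t *\<^sub>R u t \<partial>lebesgue_on {0<..<T}) =
        - (\<integral>t. \<phi> t *\<^sub>R u' t \<partial>lebesgue_on {0<..<T}))"

text \<open>\<open>H1_time T X\<close> is \<open>H\<^sup>1(J; X)\<close>. Its elements are represented by their continuous
  representatives on \<open>[0, T]\<close>, so that the point values \<open>u 0\<close>, \<open>u T\<close> and \<open>u (t i)\<close> are the usual ones.\<close>

definition H1_time ::
  "real \<Rightarrow> 'b::{banach, second_countable_topology} set \<Rightarrow> (real \<Rightarrow> 'b) set" where
  "H1_time T X = {u \<in> L2_time T X. continuous_on {0..T} u \<and>
     (\<exists>u'\<in>L2_time T X. has_weak_time_derivative T u u')}"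

text \<open>\<open>L\<^sup>2(J; H\<^sup>1\<^sub>0(\<Omega>))\<close>; square integrability in the graph norm of \<open>H\<^sup>1\<^sub>0(\<Omega>)\<close>.\<close>

definition L2_H10 :: "'a::euclidean_space set \<Rightarrow> real \<Rightarrow> (real \<Rightarrow> ('a, real) l2) set" where
  "L2_H10 \<Omega> T = {u \<in> L2_time T (L2_on \<Omega>).
     (AE t in lebesgue_on {0<..<T}. u t \<in> H10 \<Omega>) \<and>
     (\<lambda>t. weak_gradient \<Omega> (u t)) \<in> L2_time T (L2_on \<Omega>)}"


section \<open>The time-periodic heat problem\<close>

definition periodic_space :: "'a::euclidean_space set \<Rightarrow> real \<Rightarrow> (real \<Rightarrow> ('a, real) l2) set" where
  "periodic_space \<Omega> T = H1_time T (L2_on \<Omega>) \<inter> L2_H10 \<Omega> T \<inter> {u. u 0 \<in> H10 \<Omega> \<and> u 0 = u T}"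

definition periodic_heat_solution ::
  "'a::euclidean_space set \<Rightarrow> real \<Rightarrow> real \<Rightarrow> (real \<Rightarrow> ('a, real) l2) \<Rightarrow>
     (real \<Rightarrow> ('a, real) l2) \<Rightarrow> bool" where
  "periodic_heat_solution \<Omega> \<nu> T f u \<longleftrightarrow> u \<in> periodic_space \<Omega> T \<and>
     (\<exists>u'\<in>L2_time T (L2_on \<Omega>). has_weak_time_derivative T u u' \<and>
        (\<forall>w\<in>H10 \<Omega>. AE t in lebesgue_on {0<..<T}.
           u' t \<bullet> w + \<nu> * (weak_gradient \<Omega> (u t) \<bullet> weak_gradient \<Omega> w) = f t \<bullet> w))"


section \<open>Discretization\<close>

definition is_H10_projection ::
  "'a::euclidean_space set \<Rightarrow> ('a, real) l2 set \<Rightarrow> (('a, real) l2 \<Rightarrow> ('a, real) l2) \<Rightarrow> bool" where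
  "is_H10_projection \<Omega> S P \<longleftrightarrow>
     (\<forall>u\<in>H10 \<Omega>. P u \<in> S \<and>
        (\<forall>v\<in>S. weak_gradient \<Omega> (u - P u) \<bullet> weak_gradient \<Omega> v = 0))"

text \<open>\<open>is_semidiscrete_projection \<Omega> \<nu> T S u p\<close>: \<open>p\<close> is the projection \<open>P\<^sub>h u \<in> H\<^sup>1(J; S)\<close> of
  \<open>u\<close>. The subspace \<open>S\<close> will be finite-dimensional, so that its norm is immaterial here.\<close>

definition is_semidiscrete_projection ::
  "'a::euclidean_space set \<Rightarrow> real \<Rightarrow> real \<Rightarrow> ('a, real) l2 set \<Rightarrow>
     (real \<Rightarrow> ('a, real) l2) \<Rightarrow> (real \<Rightarrow> ('a, real) l2) \<Rightarrow> bool" where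
  "is_semidiscrete_projection \<Omega> \<nu> T S u p \<longleftrightarrow> p \<in> H1_time T S \<and> p 0 = p T \<and>
     (\<exists>d\<in>L2_time T (L2_on \<Omega>). has_weak_time_derivative T (\<lambda>t. u t - p t) d \<and>
        (\<forall>v\<in>S. AE t in lebesgue_on {0<..<T}.
           d t \<bullet> v + \<nu> * (weak_gradient \<Omega> (u t - p t) \<bullet> weak_gradient \<Omega> v) = 0))"

definition semidiscrete_flow ::
  "'a::euclidean_space set \<Rightarrow> real \<Rightarrow> real \<Rightarrow> ('a, real) l2 set \<Rightarrow> (real \<Rightarrow> ('a, real) l2) \<Rightarrow> bool" where
  "semidiscrete_flow \<Omega> \<nu> T S \<phi> \<longleftrightarrow> \<phi> \<in> H1_time T S \<and>
     (\<exists>\<phi>'\<in>L2_time T S. has_weak_time_derivative T \<phi> \<phi>' \<and>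
        (\<forall>\<eta>\<in>S. AE t in lebesgue_on {0<..<T}.
           \<phi>' t \<bullet> \<eta> + \<nu> * (weak_gradient \<Omega> (\<phi> t) \<bullet> weak_gradient \<Omega> \<eta>) = 0))"

definition semidiscrete_evolution ::
  "'a::euclidean_space set \<Rightarrow> real \<Rightarrow> real \<Rightarrow> ('a, real) l2 set \<Rightarrow> ('a, real) l2 \<Rightarrow> ('a, real) l2" where
  "semidiscrete_evolution \<Omega> \<nu> T S v =
     (THE w. \<exists>\<phi>. semidiscrete_flow \<Omega> \<nu> T S \<phi> \<and> \<phi> 0 = v \<and> \<phi> T = w)"

text \<open>The supremum over the closed unit ball, instead of the unit sphere, gives the value \<open>0\<close> also for \<open>S = {0}\<close>.\<close>

definition evolution_norm ::
  "'a::euclidean_space set \<Rightarrow> real \<Rightarrow> real \<Rightarrow> ('a, real) l2 set \<Rightarrow> real" where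
  "evolution_norm \<Omega> \<nu> T S =
     Sup {H10_norm \<Omega> (semidiscrete_evolution \<Omega> \<nu> T S v) | v. v \<in> S \<and> H10_norm \<Omega> v \<le> 1}"

definition is_mesh :: "real \<Rightarrow> nat \<Rightarrow> (nat \<Rightarrow> real) \<Rightarrow> bool" where
  "is_mesh T m t \<longleftrightarrow> t 0 = 0 \<and> t m = T \<and> (\<forall>i<m. t i < t (Suc i))"

definition periodic_H1 :: "real \<Rightarrow> (real \<Rightarrow> real) set" where
  "periodic_H1 T = {w \<in> H1_time T UNIV. w 0 = w T}"

text \<open>\<open>interpolant t w\<close> is the continuous piecewise linear interpolant of \<open>w\<close> on the mesh \<open>t\<close>: the index
  \<open>i\<close> picks the mesh interval \<open>[t i, t (Suc i)]\<close> that contains \<open>s\<close>.\<close>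

definition interpolant :: "(nat \<Rightarrow> real) \<Rightarrow> (real \<Rightarrow> 'b::real_vector) \<Rightarrow> real \<Rightarrow> 'b" where
  "interpolant t w s = (let i = (LEAST i. s \<le> t (Suc i)) in
     w (t i) + ((s - t i) / (t (Suc i) - t i)) *\<^sub>R (w (t (Suc i)) - w (t i)))"

lemma mesh_less:
  assumes "is_mesh T m t" "i < j" "j \<le> m"
  shows "t i < t j"
  using assms(2,3)
proof (induction j)
  case (Suc j)
  then have "t j < t (Suc j)" using assms(1) by (simp add: is_mesh_def)
  with Suc show ?case by (cases "i = j") auto
qed simp

lemma interpolant_affine:
  assumes mesh: "is_mesh T m t" and i: "i < m" and s: "t i \<le> s" "s \<le> t (Suc i)"
  shows "interpolant t w s =
     w (t i) + ((s - t i) / (t (Suc i) - t i)) *\<^sub>R (w (t (Suc i)) - w (t i))"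
proof -
  have less: "t j < t k" if "j < k" "k \<le> m" for j k
    using mesh_less[OF mesh that] .
  show ?thesis
  proof (cases "s = t i \<and> i > 0")
    case False
    have "(LEAST j. s \<le> t (Suc j)) = i"
    proof (rule Least_equality)
      fix j assume j: "s \<le> t (Suc j)"
      show "i \<le> j"
      proof (rule ccontr)
        assume "\<not> i \<le> j"
        then have "t (Suc j) \<le> t i"
          using less[of "Suc j" i] i by (cases "Suc j = i") auto
        then show False using False j s \<open>\<not> i \<le> j\<close> by auto
      qed
    qed (rule s)
    then show ?thesis by (simp add: interpolant_def)
  next
    case True
    then obtain k where k: "i = Suc k" by (cases i) auto
    have "(LEAST j. s \<le> t (Suc j)) = k"
    proof (rule Least_equality)
      fix j assume j: "s \<le> t (Suc j)"
      show "k \<le> j"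
      proof (rule ccontr)
        assume "\<not> k \<le> j"
        then have "t (Suc j) < t i"
          using less[of "Suc j" i] i k by auto
        then show False using True j by auto
      qed
    qed (use True k in simp)
    moreover have "t k < t i" using less[of k i] k i by auto
    ultimately show ?thesis using True k by (simp add: interpolant_def)
  qed
qed

lemma interpolant_node:
  assumes mesh: "is_mesh T m t" and "0 < m" "i \<le> m"
  shows "interpolant t w (t i) = w (t i)"
proof (cases "i < m")
  case True
  then have "t i < t (Suc i)" using mesh by (simp add: is_mesh_def)
  then show ?thesis using interpolant_affine[OF mesh True, of "t i" w] by simp
next
  case False
  then have i: "i = m" using assms(3) by simp
  obtain k where k: "m = Suc k" using \<open>0 < m\<close> by (cases m) auto
  have "t k < t (Suc k)" using mesh_less[OF mesh, of k "Suc k"] k by simp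
  then show ?thesis
    using interpolant_affine[OF mesh, of k "t (Suc k)" w] k i by simp
qed

definition K2 :: "real \<Rightarrow> real \<Rightarrow> real \<Rightarrow> real \<Rightarrow> real" where
  "K2 \<nu> lam T \<kappa> = 1 / \<nu> * sqrt (4 + 5 / (1 - exp (- \<nu> * lam * T))\<^sup>2
     + (1 + 1 / (1 - exp (- \<nu> * lam * T))\<^sup>2) * (1 / (1 - \<kappa>)\<^sup>2))"

end

theory Submission
  imports Defs "HOL-Computational_Algebra.Polynomial"
begin

text \<open>
  The two errors are estimated separately. By periodicity, testing the heat equation and its
  semidiscrete analogue with the time derivatives gives
  \<open>\<parallel>u\<^sub>t\<parallel>\<^sup>2 + \<parallel>\<nu> \<Delta> u\<parallel>\<^sup>2 = \<parallel>f\<parallel>\<^sup>2\<close> and \<open>\<parallel>(P\<^sub>h u)\<^sub>t\<parallel> \<le> \<parallel>f\<parallel>\<close>. Comparing \<open>P\<^sub>h u\<close> with the Ritz projection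
  \<open>P\<^sub>h\<^sup>1 u\<close> yields, for \<open>e = u - P\<^sub>h u\<close>,
  \<open>\<nu> \<parallel>\<nabla>e\<parallel>\<^sup>2 \<le> C\<^sub>\<Omega>\<^sup>2 (\<parallel>e\<^sub>t\<parallel> \<parallel>\<Delta>u\<parallel> + \<nu> \<parallel>\<Delta>u\<parallel>\<^sup>2)\<close>, because \<open>(e\<^sub>t, e)\<close> integrates to zero; hence
  \<open>\<parallel>\<nabla>e\<parallel> \<le> (2 / \<nu>) C\<^sub>\<Omega> \<parallel>f\<parallel>\<close>. The interpolation error is bounded by \<open>C\<^sub>i\<^sub>n\<^sub>v C\<^sub>J \<parallel>(P\<^sub>h u)\<^sub>t\<parallel>\<close>. The
  constants of the theorem dominate these two, since \<open>K\<^sub>2 \<ge> 2 / \<nu>\<close> and \<open>(2 - \<kappa>) / (1 - \<kappa>) \<ge> 1\<close> whatever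
  the values of \<open>\<lambda>\<^sub>1\<close> and \<open>\<kappa> < 1\<close>.

  A solution is not regular enough in time to use \<open>u\<^sub>t\<close> as a test function. All three integrals
  that vanish by periodicity have the form \<open>\<integral> (g, u\<^sub>t)\<close> with a symmetric kernel
  \<open>(g(t), u(r)) = (g(r), u(t))\<close>; then \<open>\<integral> (g(t), u(t + s)) dt\<close> is even in \<open>s\<close>, and the claim is that
  its derivative at \<open>0\<close> vanishes.
\<close>

section \<open>Smooth functions with compact support\<close>

text \<open>Evenness in \<open>s\<close> is exploited before any limit: the quotients
  \<open>(u(t + s) - u(t - s)) / (2 s)\<close> of the periodic extension pair with \<open>g\<close>
  to exactly zero. They are bounded in L2 and converge weakly to \<open>u_t\<close>, so
  \<open>g\<close> needs no regularity in time beyond square integrability. The bound must cross the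
  seam \<open>0 = T\<close>, where only \<open>u 0 = u T\<close> is available.

  The three kernels are \<open>f - u_t\<close> against \<open>u\<close> and
  \<open>f - (P_h u)_t\<close> against \<open>P_h u\<close>, both equal to \<nu> times an inner
  product of gradients at two times, and the trivially symmetric \<open>e\<close> against
  \<open>e\<close>. Symmetry for pairs of times needs each equation to hold for all test elements
  off a single null set, whereas a weak equation comes with one null set per test element;
  separability closes this gap.

  Weak derivatives are tested with smooth functions only. The explicit smooth steps approximate
  indicators of boxes, which gives uniqueness of weak gradients on \<Omega> and turns weak time
  derivatives into increments. Since \<open>e_t\<close> is split into \<open>u_t\<close> and
  \<open>(P_h u)_t\<close>, both energy bounds suffice and \<open>e_t\<close> itself need not be
  small.\<close>

lemma frechet_derivative_eqI:
  "(f has_derivative f') (at x) \<Longrightarrow> frechet_derivative f (at x) = f'"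
  using frechet_derivative_at by metis

section \<open>Calculus of \<open>Ck\<close> and a smooth function that is flat at the
  origin\<close>

lemma Ck_cong: "Ck n f \<Longrightarrow> (\<And>x. f x = g x) \<Longrightarrow> Ck n g"
  by (metis ext)

lemma Ck_SucI:
  assumes "\<And>x. (f has_derivative f' x) (at x)" "\<And>i. i \<in> Basis \<Longrightarrow> Ck n (\<lambda>x. f' x i)"
  shows "Ck (Suc n) f"
proof -
  have "frechet_derivative f (at x) = f' x" for x
    by (rule frechet_derivative_eqI[OF assms(1)])
  then show ?thesis
    using assms by (auto simp: differentiable_def)
qed

lemma Ck_Suc_has_derivative:
  "Ck (Suc n) f \<Longrightarrow> (f has_derivative frechet_derivative f (at x)) (at x)"
  using frechet_derivative_works by auto

lemma Ck_SucD: "Ck (Suc n) f \<Longrightarrow> Ck n f"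
proof (induction n arbitrary: f)
  case 0
  then show ?case
    by (auto intro!: differentiable_imp_continuous_on simp: differentiable_on_def)
next
  case (Suc n)
  then show ?case by (metis Ck.simps(2))
qed

lemma Ck_const: "Ck n (\<lambda>x. c)"
  by (induction n arbitrary: c) (auto intro!: Ck_SucI derivative_eq_intros)

lemma Ck_add: "Ck n f \<Longrightarrow> Ck n g \<Longrightarrow> Ck n (\<lambda>x. f x + g x)"
proof (induction n arbitrary: f g)
  case (Suc n)
  note fg = Ck_Suc_has_derivative[OF Suc.prems(1)] Ck_Suc_has_derivative[OF Suc.prems(2)]
  show ?case
    by (rule Ck_SucI[OF has_derivative_add[OF fg]]) (use Suc in auto)
qed (auto intro: continuous_intros)

lemma Ck_mult: "Ck n f \<Longrightarrow> Ck n g \<Longrightarrow> Ck n (\<lambda>x. f x * g x)"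
proof (induction n arbitrary: f g)
  case (Suc n)
  note fg = Ck_Suc_has_derivative[OF Suc.prems(1)] Ck_Suc_has_derivative[OF Suc.prems(2)]
  show ?case
    by (rule Ck_SucI[OF has_derivative_mult[OF fg]])
       (use Suc Ck_SucD[OF Suc.prems(1)] Ck_SucD[OF Suc.prems(2)] in \<open>auto intro!: Ck_add\<close>)
qed (auto intro: continuous_intros)

lemma Ck_prod: "finite A \<Longrightarrow> (\<And>i. i \<in> A \<Longrightarrow> Ck n (f i)) \<Longrightarrow> Ck n (\<lambda>x. \<Prod>i\<in>A. f i x)"
  by (induction A rule: finite_induct) (auto intro: Ck_const Ck_mult)

lemma Ck_all_derivative:
  "(\<And>n. Ck n f) \<Longrightarrow> i \<in> Basis \<Longrightarrow> Ck n (\<lambda>x. frechet_derivative f (at x) i)"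
  by (metis Ck.simps(2))

text \<open>The family \<open>flat p\<close> is closed under differentiation, which gives smoothness by induction.\<close>

definition flat :: "real poly \<Rightarrow> real \<Rightarrow> real" where
  "flat p x = (if x > 0 then poly p (1 / x) * exp (- (1 / x)) else 0)"

lemma tendsto_poly_exp_minus: "((\<lambda>x. poly p x * exp (- x)) \<longlongrightarrow> 0) (at_top :: real filter)"
proof -
  have "(\<lambda>x. poly p x * exp (- x)) = (\<lambda>x. \<Sum>i\<le>degree p. coeff p i * (x ^ i / exp x))"
    by (simp add: poly_altdef sum_distrib_right exp_minus divide_inverse mult.assoc)
  moreover have "((\<lambda>x. \<Sum>i\<le>degree p. coeff p i * (x ^ i / exp x)) \<longlongrightarrow> (\<Sum>i\<le>degree p. coeff p i * 0)) at_top"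
    by (intro tendsto_sum tendsto_mult tendsto_const tendsto_power_div_exp_0)
  ultimately show ?thesis by simp
qed

text \<open>With \<open>y = 1 / x\<close> the limit from the right is that of a polynomial in
  \<open>y\<close> against \<open>exp (- y)\<close> at infinity: exponential decay beats a pole of
  any order.\<close>

lemma tendsto_flat_0: "(flat p \<longlongrightarrow> 0) (at 0)"
proof -
  have "((\<lambda>x. poly p (inverse x) * exp (- inverse x)) \<longlongrightarrow> 0) (at_right 0)"
    by (rule filterlim_compose[OF tendsto_poly_exp_minus filterlim_inverse_at_top_right])
  then have r: "(flat p \<longlongrightarrow> 0) (at_right 0)"
    by (rule Lim_transform_eventually)
       (auto simp: flat_def eventually_at_filter inverse_eq_divide)
  have "(flat p \<longlongrightarrow> 0) (at_left 0)"
    by (rule Lim_transform_eventually[OF tendsto_const])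
       (auto simp: flat_def eventually_at_filter)
  with r show ?thesis using filterlim_split_at by blast
qed

text \<open>The factor \<open>[:0, 0, 1:]\<close> is the square of the polynomial variable; it comes
  from the inner derivative \<open>- 1 / x^2\<close> of \<open>1 / x\<close>, whose sign turns
  \<open>pderiv p - p\<close> into \<open>p - pderiv p\<close>.\<close>

lemma flat_has_derivative: 
  "(flat p has_real_derivative flat ([:0, 0, 1:] * (p - pderiv p)) x) (at x)"
proof (cases x "0 :: real" rule: linorder_cases)
  case less
  have "((\<lambda>x. 0) has_real_derivative 0) (at x)" by simp
  then have "(flat p has_real_derivative 0) (at x)"
    by (rule DERIV_cong_ev[THEN iffD1, rotated -1])
       (use less eventually_nhds_in_open[of "{..<0}" x] in \<open>auto simp: flat_def elim!: eventually_mono\<close>)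
  then show ?thesis using less by (simp add: flat_def)
next
  case greater
  have "((\<lambda>x. poly p (1 / x) * exp (- (1 / x))) has_real_derivative 
     flat ([:0, 0, 1:] * (p - pderiv p)) x) (at x)"
    using greater by (auto intro!: derivative_eq_intros DERIV_chain'[of "\<lambda>x. 1 / x", OF _ poly_DERIV]
      simp: flat_def field_simps power2_eq_square)
  then show ?thesis
    by (rule DERIV_cong_ev[THEN iffD1, rotated -1])
       (use greater eventually_nhds_in_open[of "{0<..}" x] in \<open>auto simp: flat_def elim!: eventually_mono\<close>)
next
  case equal
  \<comment> \<open>Division by \<open>y\<close> amounts to multiplying \<open>p\<close> by the
    polynomial variable, so the difference quotient at 0 is again a member of the family.\<close>
  have "((\<lambda>y. flat p y / y) \<longlongrightarrow> 0) (at 0)"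
    by (rule Lim_transform_eventually[OF tendsto_flat_0[of "[:0, 1:] * p"]])
       (auto simp: flat_def eventually_at_filter)
  then show ?thesis
    using equal by (simp add: has_field_derivative_iff flat_def)
qed

text \<open>A partial derivative of such a function is a constant times the function of the same
  shape with index \<open>d p\<close>. The induction on the order therefore has to run over all
  indices simultaneously.\<close>

lemma Ck_affine:
  fixes h :: "'i \<Rightarrow> real \<Rightarrow> real" and b :: "'a::euclidean_space"
  assumes "\<And>p x. (h p has_real_derivative h (d p) x) (at x)"
  shows "Ck n (\<lambda>x. h p (\<alpha> * (x \<bullet> b) + \<beta>))"
proof (induction n arbitrary: p)
  case 0
  have "continuous_on UNIV (h p)"
    using assms by (meson DERIV_continuous continuous_at_imp_continuous_on)
  then show ?case
    by (auto intro!: continuous_intros continuous_on_compose2[of UNIV "h p"])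
next
  case (Suc n)
  have "((\<lambda>x. h p (\<alpha> * (x \<bullet> b) + \<beta>)) has_derivative
      (\<lambda>v. \<alpha> * (v \<bullet> b) * h (d p) (\<alpha> * (x \<bullet> b) + \<beta>))) (at x)" for x
    by (rule has_derivative_eq_rhs[OF has_derivative_compose[OF _
          assms[of p, unfolded has_field_derivative_def]]])
       (auto intro!: derivative_eq_intros simp: mult_ac)
  then show ?case
    by (rule Ck_SucI) (auto intro!: Ck_mult Ck_const Suc)
qed

lemmas Ck_flat_affine = Ck_affine[of flat "\<lambda>p. [:0, 0, 1:] * (p - pderiv p)", OF flat_has_derivative]

section \<open>Smooth bumps and smooth steps on the line\<close>

definition bump :: "real \<Rightarrow> real" where
  "bump x = flat 1 x * flat 1 (1 - x)"

lemma Ck_bump_affine: "Ck n (\<lambda>x :: 'a::euclidean_space. bump (\<alpha> * (x \<bullet> b) + \<beta>))"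
proof -
  have "Ck n (\<lambda>x :: 'a. flat 1 ((- \<alpha>) * (x \<bullet> b) + (1 - \<beta>)))"
    by (rule Ck_flat_affine)
  then have "Ck n (\<lambda>x :: 'a. flat 1 (1 - (\<alpha> * (x \<bullet> b) + \<beta>)))"
    by (rule Ck_cong) (simp add: algebra_simps)
  then show ?thesis
    unfolding bump_def by (intro Ck_mult Ck_flat_affine)
qed

lemma bump_nonneg: "0 \<le> bump x"
  by (simp add: bump_def flat_def)

lemma bump_eq_0: "x \<notin> {0<..<1} \<Longrightarrow> bump x = 0"
  by (auto simp: bump_def flat_def)

lemma continuous_bump: "continuous_on A bump"
proof -
  have "continuous_on UNIV (flat 1)"
    using flat_has_derivative by (meson DERIV_continuous continuous_at_imp_continuous_on)
  then show ?thesis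
    unfolding bump_def by (auto intro!: continuous_intros intro: continuous_on_compose2[of UNIV])
qed

definition bump_mass :: real where
  "bump_mass = integral {0..1} bump"

lemma bump_mass_pos: "0 < bump_mass"
proof -
  have "integral {0..1} bump \<noteq> 0"
  proof
    assume "integral {0..1} bump = 0"
    then have "bump (1/2) = 0"
      by (subst (asm) integral_eq_0_iff) (auto intro: continuous_bump bump_nonneg)
    then show False by (simp add: bump_def flat_def)
  qed
  moreover have "0 \<le> integral {0..1} bump"
    by (intro Henstock_Kurzweil_Integration.integral_nonneg integrable_continuous_real continuous_bump bump_nonneg)
  ultimately show ?thesis by (simp add: bump_mass_def)
qed

text \<open>The normalised primitive of \<open>bump\<close>, a smooth transition from 0 to 1 across
  the unit interval. For negative \<open>x\<close> the interval \<open>{0..x}\<close> is empty, so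
  its integral has the desired value 0.\<close>

definition step :: "real \<Rightarrow> real" where
  "step x = integral {0..x} bump / bump_mass"

lemma step_eq_0: "x \<le> 0 \<Longrightarrow> step x = 0"
  by (cases "x = 0") (auto simp: step_def)

lemma bump_integrable: "bump integrable_on {a..b}"
  by (intro integrable_continuous_real continuous_bump)

lemma step_eq_1: 
  assumes "x \<ge> 1" shows "step x = 1"
proof -
  have "integral {0..x} bump = integral {0..1} bump + integral {1..x} bump"
    using assms bump_integrable by (simp add: Henstock_Kurzweil_Integration.integral_combine)
  also have "integral {1..x} bump = integral {1..x} (\<lambda>x. 0)"
    by (intro Henstock_Kurzweil_Integration.integral_cong) (auto intro: bump_eq_0)
  finally show ?thesis using bump_mass_pos by (simp add: step_def bump_mass_def)
qed

lemma step_has_derivative: "(step has_real_derivative bump x / bump_mass) (at x)"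
proof -
  \<comment> \<open>The lower limit is moved to \<open>-1 - \<bar>x\<bar>\<close>, which makes
    \<open>x\<close> an interior point and yields a two-sided derivative also for negative
    \<open>x\<close>.\<close>
  have "integral {0..y} bump = integral {-1 - \<bar>x\<bar>..y} bump" if "y > -1 - \<bar>x\<bar>" for y
  proof (cases "y \<ge> 0")
    case True
    have "integral {-1 - \<bar>x\<bar>..y} bump = integral {-1 - \<bar>x\<bar>..0} bump + integral {0..y} bump"
      using that True bump_integrable by (simp add: Henstock_Kurzweil_Integration.integral_combine)
    also have "integral {-1 - \<bar>x\<bar>..0} bump = integral {-1 - \<bar>x\<bar>..0} (\<lambda>x. 0)"
      by (intro Henstock_Kurzweil_Integration.integral_cong) (auto intro: bump_eq_0)
    finally show ?thesis by simp
  next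
    case False
    have "integral {-1 - \<bar>x\<bar>..y} bump = integral {-1 - \<bar>x\<bar>..y} (\<lambda>x. 0)"
      using False by (intro Henstock_Kurzweil_Integration.integral_cong) (auto intro: bump_eq_0)
    then show ?thesis using False by simp
  qed
  then have ev: "\<forall>\<^sub>F y in nhds x. step y = integral {-1 - \<bar>x\<bar>..y} bump / bump_mass"
    by (intro eventually_mono[OF eventually_nhds_in_open[of "{-1 - \<bar>x\<bar><..}" x]])
       (auto simp: step_def)
  have "((\<lambda>y. integral {-1 - \<bar>x\<bar>..y} bump) has_real_derivative bump x) (at x within {-1 - \<bar>x\<bar>..x+1})"
    by (rule integral_has_real_derivative) (auto intro: continuous_bump)
  then have "((\<lambda>y. integral {-1 - \<bar>x\<bar>..y} bump) has_real_derivative bump x) (at x)"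
    by (subst (asm) at_within_Icc_at) auto
  then have "((\<lambda>y. integral {-1 - \<bar>x\<bar>..y} bump / bump_mass) has_real_derivative bump x / bump_mass) (at x)"
    by (rule DERIV_cdivide)
  then show ?thesis
    by (rule DERIV_cong_ev[THEN iffD1, rotated -1]) (use ev in \<open>auto elim!: eventually_mono\<close>)
qed

lemma step_bounds: "0 \<le> step x" "step x \<le> 1"
proof -
  have mono: "step x \<le> step y" if "x \<le> y" for x y
    using that by (rule DERIV_nonneg_imp_nondecreasing)
      (auto intro!: exI step_has_derivative divide_nonneg_pos bump_nonneg bump_mass_pos)
  show "0 \<le> step x" using mono[of 0 x] step_eq_0[of x] step_eq_0[of 0] by linarith
  show "step x \<le> 1" using mono[of x 1] step_eq_1[of x] step_eq_1[of 1] by linarith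
qed

text \<open>The gradient consists of rescaled bumps, which are smooth. Proving order
  \<open>Suc n\<close> and descending covers order 0 without a separate case.\<close>

lemma Ck_step_affine: "Ck n (\<lambda>x :: 'a::euclidean_space. step (\<alpha> * (x \<bullet> b) + \<beta>))"
proof (rule Ck_SucD, rule Ck_SucI)
  show "((\<lambda>x. step (\<alpha> * (x \<bullet> b) + \<beta>)) has_derivative
      (\<lambda>v. \<alpha> * (v \<bullet> b) * (bump (\<alpha> * (x \<bullet> b) + \<beta>) / bump_mass))) (at x)" for x
    by (rule has_derivative_eq_rhs[OF has_derivative_compose[OF _
          step_has_derivative[unfolded has_field_derivative_def]]])
       (auto intro!: derivative_eq_intros simp: mult_ac)
  show "Ck n (\<lambda>x. \<alpha> * (i \<bullet> b) * (bump (\<alpha> * (x \<bullet> b) + \<beta>) / bump_mass))" for i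
    using Ck_mult[OF Ck_const[of n "\<alpha> * (i \<bullet> b) / bump_mass"] Ck_bump_affine[of n \<alpha> b \<beta>]]
    by (simp add: mult_ac)
qed

section \<open>Square-integrable functions with values in a Hilbert space\<close>

text \<open>The counterpart of \<open>sq_integrable\<close> for arbitrary measures and normed target
  spaces; it serves curves in time with values in \<open>l2\<close>.\<close>

definition square_integrable :: "'a measure \<Rightarrow> ('a \<Rightarrow> 'b::real_normed_vector) \<Rightarrow> bool" where
  "square_integrable M f \<longleftrightarrow> f \<in> borel_measurable M \<and> integrable M (\<lambda>x. (norm (f x))\<^sup>2)"

lemma square_integrable_measurable [measurable_dest]:
  "square_integrable M f \<Longrightarrow> f \<in> borel_measurable M"
  by (simp add: square_integrable_def)

lemma square_integrable_norm_sq: "square_integrable M f \<Longrightarrow> integrable M (\<lambda>x. (norm (f x))\<^sup>2)"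
  by (simp add: square_integrable_def)

lemma norm_sum_sq_le: "(norm (a + b))\<^sup>2 \<le> 2 * (norm a)\<^sup>2 + 2 * (norm (b :: 'b::real_normed_vector))\<^sup>2"
proof -
  have "(norm (a + b))\<^sup>2 \<le> (norm a + norm b)\<^sup>2"
    by (intro power_mono norm_triangle_ineq) auto
  also have "\<dots> \<le> 2 * (norm a)\<^sup>2 + 2 * (norm b)\<^sup>2"
    using sum_squares_bound[of "norm a" "norm b"] by (simp add: power2_sum)
  finally show ?thesis .
qed

lemma square_integrable_bound:
  fixes f :: "'a \<Rightarrow> 'b::real_normed_vector" and g :: "'a \<Rightarrow> 'c::real_normed_vector"
  assumes "square_integrable M f" "g \<in> borel_measurable M" "AE x in M. norm (g x) \<le> c * norm (f x)"
  shows "square_integrable M g"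
  unfolding square_integrable_def
proof
  show "integrable M (\<lambda>x. (norm (g x))\<^sup>2)"
  proof (rule Bochner_Integration.integrable_bound)
    show "integrable M (\<lambda>x. c\<^sup>2 * (norm (f x))\<^sup>2)"
      using assms(1) by (simp add: square_integrable_def)
    show "AE x in M. norm ((norm (g x))\<^sup>2) \<le> norm (c\<^sup>2 * (norm (f x))\<^sup>2)"
      using assms(3)
    proof eventually_elim
      case (elim x)
      from power_mono[OF this norm_ge_zero, of 2] show ?case by (simp add: power_mult_distrib)
    qed
  qed (use assms in measurable)
qed (use assms in auto)

lemma square_integrable_add:
  fixes f g :: "'a \<Rightarrow> 'b::{second_countable_topology, real_normed_vector}"
  assumes "square_integrable M f" "square_integrable M g"
  shows "square_integrable M (\<lambda>x. f x + g x)"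
  unfolding square_integrable_def
proof
  note [measurable] = assms[THEN square_integrable_measurable]
  show "(\<lambda>x. f x + g x) \<in> borel_measurable M" by measurable
  show "integrable M (\<lambda>x. (norm (f x + g x))\<^sup>2)"
  proof (rule Bochner_Integration.integrable_bound)
    show "integrable M (\<lambda>x. 2 * (norm (f x))\<^sup>2 + 2 * (norm (g x))\<^sup>2)"
      using assms by (auto simp: square_integrable_def)
    show "AE x in M. norm ((norm (f x + g x))\<^sup>2) \<le> norm (2 * (norm (f x))\<^sup>2 + 2 * (norm (g x))\<^sup>2)"
      by (intro AE_I2) (simp add: norm_sum_sq_le)
  qed measurable
qed

lemma square_integrable_scaleR:
  fixes f :: "'a \<Rightarrow> 'b::{second_countable_topology, real_normed_vector}"
  assumes "square_integrable M f"
  shows "square_integrable M (\<lambda>x. c *\<^sub>R f x)"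
  using assms by (auto simp: square_integrable_def power_mult_distrib)

lemma square_integrable_diff:
  fixes f g :: "'a \<Rightarrow> 'b::{second_countable_topology, real_normed_vector}"
  assumes "square_integrable M f" "square_integrable M g"
  shows "square_integrable M (\<lambda>x. f x - g x)"
  using square_integrable_add[OF assms(1) square_integrable_scaleR[OF assms(2), of "-1"]] by simp

lemma square_integrable_norm:
  fixes f :: "'a \<Rightarrow> 'b::{second_countable_topology, real_normed_vector}"
  assumes "square_integrable M f"
  shows "square_integrable M (\<lambda>x. norm (f x))"
  using assms by (auto simp: square_integrable_def)

lemma square_integrable_inner:
  fixes f g :: "'a \<Rightarrow> 'b::{second_countable_topology, real_inner}"
  assumes "square_integrable M f" "square_integrable M g"
  shows "integrable M (\<lambda>x. f x \<bullet> g x)"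
proof (rule Bochner_Integration.integrable_bound)
  note [measurable] = assms[THEN square_integrable_measurable]
  show "integrable M (\<lambda>x. (norm (f x))\<^sup>2 + (norm (g x))\<^sup>2)"
    using assms by (auto simp: square_integrable_def)
  show "(\<lambda>x. f x \<bullet> g x) \<in> borel_measurable M" by measurable
  have "\<bar>a \<bullet> b\<bar> \<le> (norm a)\<^sup>2 + (norm b)\<^sup>2" for a b :: 'b
  proof -
    have "0 \<le> norm a * norm b" by simp
    then show ?thesis
      using Cauchy_Schwarz_ineq2[of a b] sum_squares_bound[of "norm a" "norm b"] by linarith
  qed
  then show "AE x in M. norm (f x \<bullet> g x) \<le> norm ((norm (f x))\<^sup>2 + (norm (g x))\<^sup>2)"
    by (intro AE_I2) simp
qed

lemma square_integrable_inner_const: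
  fixes f :: "'a \<Rightarrow> 'b::{second_countable_topology, real_inner}"
  assumes "square_integrable M f"
  shows "square_integrable M (\<lambda>x. f x \<bullet> y)"
proof (rule square_integrable_bound[OF assms])
  show "(\<lambda>x. f x \<bullet> y) \<in> borel_measurable M"
    using assms square_integrable_measurable by measurable
  show "AE x in M. norm (f x \<bullet> y) \<le> norm y * norm (f x)"
    by (intro AE_I2) (metis Cauchy_Schwarz_ineq2 mult.commute real_norm_def)
qed

lemma (in finite_measure) square_integrable_const: "square_integrable M (\<lambda>x. c)"
  by (simp add: square_integrable_def)

lemma (in finite_measure) square_integrable_integrable:
  fixes f :: "'a \<Rightarrow> 'b::{second_countable_topology, banach}"
  assumes "square_integrable M f" shows "integrable M f"
proof -
  have "integrable M (\<lambda>x. norm (f x))"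
    using assms unfolding square_integrable_def
    by - (rule square_integrable_imp_integrable, auto)
  then show ?thesis
    using integrable_norm_iff[of f M] assms by (simp add: square_integrable_def)
qed

text \<open>The integral of the squared norm of \<open>f + c g\<close> is a nonnegative quadratic
  polynomial in \<open>c\<close>. Its minimiser \<open>- B / C\<close> gives the claim; for
  \<open>C = 0\<close> and \<open>B \<noteq> 0\<close> the choice \<open>- (A + 1) / (2 * B)\<close>
  would give the value -1.\<close>

lemma integral_inner_Cauchy_Schwarz:
  fixes f g :: "'a \<Rightarrow> 'b::{second_countable_topology, real_inner}"
  assumes f: "square_integrable M f" and g: "square_integrable M g"
  shows "(\<integral>x. f x \<bullet> g x \<partial>M)\<^sup>2 \<le> (\<integral>x. (norm (f x))\<^sup>2 \<partial>M) * (\<integral>x. (norm (g x))\<^sup>2 \<partial>M)"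
proof -
  define A B C where "A = (\<integral>x. (norm (f x))\<^sup>2 \<partial>M)" and "B = (\<integral>x. f x \<bullet> g x \<partial>M)"
    and "C = (\<integral>x. (norm (g x))\<^sup>2 \<partial>M)"
  have quad: "0 \<le> A + 2 * c * B + c\<^sup>2 * C" for c
  proof -
    have "0 \<le> (\<integral>x. (norm (f x + c *\<^sub>R g x))\<^sup>2 \<partial>M)" by simp
    also have "(\<lambda>x. (norm (f x + c *\<^sub>R g x))\<^sup>2) =
        (\<lambda>x. (norm (f x))\<^sup>2 + 2 * c * (f x \<bullet> g x) + c\<^sup>2 * (norm (g x))\<^sup>2)"
      by (simp add: power2_norm_eq_inner inner_add_left inner_add_right inner_commute
          algebra_simps power2_eq_square[of c])
    also have "integral\<^sup>L M \<dots> = A + 2 * c * B + c\<^sup>2 * C"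
      unfolding A_def B_def C_def using f g
      by (simp add: square_integrable_inner square_integrable_norm_sq)
    finally show ?thesis .
  qed
  have "A \<ge> 0" "C \<ge> 0" by (simp_all add: A_def C_def)
  have "B\<^sup>2 \<le> A * C"
  proof (cases "C = 0")
    case True
    have "B = 0"
    proof (rule ccontr)
      assume "B \<noteq> 0"
      then show False using quad[of "- (A + 1) / (2 * B)"] True by (simp add: field_simps)
    qed
    then show ?thesis using True by simp
  next
    case False
    then show ?thesis
      using quad[of "- B / C"] \<open>C \<ge> 0\<close> by (simp add: field_simps power2_eq_square)
  qed
  then show ?thesis by (simp add: A_def B_def C_def)
qed

text \<open>Against an L2-bounded sequence \<open>z\<close>, the set of \<open>g\<close> whose
  pairings tend to 0 is closed in L2. Pointwise convergence with the bound
  \<open>2 * norm (g' x)\<close>, the form in which simple approximations are supplied, gives L2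
  convergence by dominated convergence with factor \<open>9 = (1 + 2)^2\<close>.\<close>

lemma tendsto_integral_inner_closed:
  fixes z :: "nat \<Rightarrow> 'a \<Rightarrow> 'b::{second_countable_topology, real_inner, banach}"
  assumes z: "\<And>n. square_integrable M (z n)" "\<And>n. (\<integral>x. (norm (z n x))\<^sup>2 \<partial>M) \<le> B"
    and g: "\<And>k. square_integrable M (g k)" and g': "square_integrable M g'"
    and conv: "\<And>k. (\<lambda>n. \<integral>x. g k x \<bullet> z n x \<partial>M) \<longlonglongrightarrow> 0"
    and lim: "\<And>x. x \<in> space M \<Longrightarrow> (\<lambda>k. g k x) \<longlonglongrightarrow> g' x"
    and bound: "\<And>k x. x \<in> space M \<Longrightarrow> norm (g k x) \<le> 2 * norm (g' x)"
  shows "(\<lambda>n. \<integral>x. g' x \<bullet> z n x \<partial>M) \<longlonglongrightarrow> 0"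
proof -
  note [measurable] = square_integrable_measurable[OF z(1)] square_integrable_measurable[OF g]
    square_integrable_measurable[OF g']
  have "(\<lambda>k. \<integral>x. (norm (g' x - g k x))\<^sup>2 \<partial>M) \<longlonglongrightarrow> (\<integral>x. 0 \<partial>M)"
  proof (rule integral_dominated_convergence)
    show "integrable M (\<lambda>x. 9 * (norm (g' x))\<^sup>2)"
      using g' by (simp add: square_integrable_norm_sq)
    have "(\<lambda>k. (norm (g' x - g k x))\<^sup>2) \<longlonglongrightarrow> 0" if "x \<in> space M" for x
    proof -
      have "(\<lambda>k. (norm (g' x - g k x))\<^sup>2) \<longlonglongrightarrow> (norm (g' x - g' x))\<^sup>2"
        using lim[OF that] by (intro tendsto_intros)
      then show ?thesis by simp
    qed
    then show "AE x in M. (\<lambda>k. (norm (g' x - g k x))\<^sup>2) \<longlonglongrightarrow> 0" by (intro AE_I2)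
    have "(norm (g' x - g k x))\<^sup>2 \<le> 9 * (norm (g' x))\<^sup>2" if "x \<in> space M" for x k
    proof -
      have "norm (g' x - g k x) \<le> 3 * norm (g' x)"
        using norm_triangle_ineq4[of "g' x" "g k x"] bound[OF that, of k] by linarith
      from power_mono[OF this, of 2] show ?thesis by (simp add: power_mult_distrib)
    qed
    then show "AE x in M. norm ((norm (g' x - g k x))\<^sup>2) \<le> 9 * (norm (g' x))\<^sup>2" for k
      by (intro AE_I2) simp
  qed measurable
  then have d: "(\<lambda>k. \<integral>x. (norm (g' x - g k x))\<^sup>2 \<partial>M) \<longlonglongrightarrow> 0" by simp
  have B: "B \<ge> 0" using z(2)[of 0] by (meson Bochner_Integration.integral_nonneg order_trans zero_le_power2)
  show ?thesis
  proof (rule LIMSEQ_I)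
    fix r :: real assume r: "0 < r"
    \<comment> \<open>Chosen such that \<open>e * B \<le> (r / 2)^2\<close>; adding 1 to
      \<open>B\<close> keeps the denominator positive.\<close>
    define e where "e = (r / 2)\<^sup>2 / (B + 1)"
    have e: "e > 0" using r B by (simp add: e_def)
    obtain k where k: "(\<integral>x. (norm (g' x - g k x))\<^sup>2 \<partial>M) < e"
      using LIMSEQ_D[OF d e] by auto
    obtain N where N: "\<And>n. n \<ge> N \<Longrightarrow> \<bar>\<integral>x. g k x \<bullet> z n x \<partial>M\<bar> < r / 2"
      using LIMSEQ_D[OF conv[of k], of "r / 2"] r by auto
    have "\<bar>\<integral>x. g' x \<bullet> z n x \<partial>M\<bar> < r" if "n \<ge> N" for n
    proof -
      have "(\<integral>x. (g' x - g k x) \<bullet> z n x \<partial>M)\<^sup>2 \<le> (\<integral>x. (norm (g' x - g k x))\<^sup>2 \<partial>M) * (\<integral>x. (norm (z n x))\<^sup>2 \<partial>M)"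
        by (rule integral_inner_Cauchy_Schwarz[OF square_integrable_diff[OF g' g] z(1)])
      also have "\<dots> \<le> e * B"
        using k z(2) e by (intro mult_mono) auto
      also have "\<dots> \<le> (r / 2)\<^sup>2" using B by (simp add: e_def field_simps)
      finally have "\<bar>\<integral>x. (g' x - g k x) \<bullet> z n x \<partial>M\<bar> \<le> r / 2"
        using r by (metis abs_le_square_iff abs_of_nonneg half_gt_zero less_eq_real_def)
      moreover have "(\<integral>x. g' x \<bullet> z n x \<partial>M) = (\<integral>x. (g' x - g k x) \<bullet> z n x \<partial>M) + (\<integral>x. g k x \<bullet> z n x \<partial>M)"
        using g g' z(1)
        by (subst Bochner_Integration.integral_add[symmetric])
           (auto intro!: square_integrable_inner square_integrable_diff simp: inner_diff_left)
      ultimately show ?thesis using N[OF that] by linarith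
    qed
    then show "\<exists>no. \<forall>n\<ge>no. norm ((\<integral>x. g' x \<bullet> z n x \<partial>M) - 0) < r" by auto
  qed
qed

text \<open>Boxes form an intersection-stable generator, so within one fixed box the usual Dynkin
  argument applies to the traces of Borel sets. Countably many boxes, made disjoint, then exhaust
  \<Omega>. Closed boxes are required to lie in \<Omega> because the smooth functions that
  approximate the indicator of a box must have their support in \<Omega>.\<close>

lemma box_Dynkin_induct [consumes 3, case_names box empty diff union]:
  fixes \<Omega> :: "'a::euclidean_space set"
  assumes "open \<Omega>" "A \<in> sets borel" "A \<subseteq> \<Omega>"
    and box: "\<And>a b. cbox a b \<subseteq> \<Omega> \<Longrightarrow> Q (box a b)"
    and empty: "Q {}"
    and diff: "\<And>A B. A \<in> sets borel \<Longrightarrow> B \<in> sets borel \<Longrightarrow> A \<subseteq> B \<Longrightarrow> B \<subseteq> \<Omega> \<Longrightarrow> Q A \<Longrightarrow> Q B \<Longrightarrow> Q (B - A)"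
    and union: "\<And>F :: nat \<Rightarrow> 'a set. disjoint_family F \<Longrightarrow> (\<And>i. F i \<in> sets borel) \<Longrightarrow>
      (\<And>i. F i \<subseteq> \<Omega>) \<Longrightarrow> (\<And>i. Q (F i)) \<Longrightarrow> Q (\<Union>i. F i)"
  shows "Q A"
proof -
  have inside: "Q (A \<inter> box a b)" if "cbox a b \<subseteq> \<Omega>" "A \<in> sets borel" for A and a b :: 'a
  proof -
    have bs: "box a b \<subseteq> \<Omega>" using that(1) box_subset_cbox by blast
    have "Int_stable (range (\<lambda>(a, b). box a b :: 'a set))"
      by (auto simp: Int_stable_def box_Int_box)
    moreover have "range (\<lambda>(a, b). box a b) \<subseteq> Pow (UNIV :: 'a set)" by auto
    moreover have "A \<in> sigma_sets UNIV (range (\<lambda>(a, b). box a b))"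
       using that(2) unfolding borel_eq_box by simp
    ultimately show ?thesis
    proof (induction rule: sigma_sets_induct_disjoint)
      case (basic B)
      then obtain c d where B: "B = box c d" by auto
      \<comment> \<open>The closed box belonging to the intersection stays inside
        \<open>cbox a b\<close>, hence inside \<Omega>.\<close>
      have "cbox (\<Sum>i\<in>Basis. max (c \<bullet> i) (a \<bullet> i) *\<^sub>R i) (\<Sum>i\<in>Basis. min (d \<bullet> i) (b \<bullet> i) *\<^sub>R i) \<subseteq> cbox a b"
        by (auto simp: mem_box)
      then show ?case using that(1) unfolding B box_Int_box by (intro box) auto
    next
      case empty
      then show ?case using assms(5) by simp
    next
      case (compl B)
      then have "B \<in> sets borel" by (simp add: borel_eq_box)
      then have "Q (box a b - B \<inter> box a b)"
        using compl bs box[OF that(1)] by (intro diff) auto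
      moreover have "box a b - B \<inter> box a b = (UNIV - B) \<inter> box a b" by auto
      ultimately show ?case by simp
    next
      case (union F)
      then have m: "\<And>i. F i \<in> sets borel" by (simp add: borel_eq_box subset_eq)
      have "Q (\<Union>i. F i \<inter> box a b)"
        by (rule assms(7)) (use union m bs in \<open>auto simp: disjoint_family_on_def\<close>)
      then show ?case by simp
    qed
  qed
  define \<F> where "\<F> = {box a b :: 'a set | a b. cbox a b \<subseteq> \<Omega>}"
  have "\<Union>\<F> = \<Omega>"
  proof (intro equalityI subsetI)
    fix x assume "x \<in> \<Omega>"
    then obtain e where e: "e > 0" "cball x e \<subseteq> \<Omega>" using \<open>open \<Omega>\<close> open_contains_cball by blast
    obtain a b where ab: "x \<in> box a b" "box a b \<subseteq> ball x e"
      using rational_boxes[OF e(1), of x] by metis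
    have "cbox a b \<subseteq> cball x e"
      using ab closure_mono[OF ab(2)] e(1) by (metis closure_ball closure_box empty_iff)
    then have "box a b \<in> \<F>" using e(2) by (auto simp: \<F>_def)
    then show "x \<in> \<Union>\<F>" using ab(1) by blast
  next
    fix x assume "x \<in> \<Union>\<F>"
    then show "x \<in> \<Omega>" unfolding \<F>_def using box_subset_cbox by blast
  qed
  moreover obtain \<G> where \<G>: "\<G> \<subseteq> \<F>" "countable \<G>" "\<Union>\<G> = \<Union>\<F>"
    using Lindelof[of \<F>] by (auto simp: \<F>_def)
  ultimately have "\<Union>\<G> = \<Omega>" by simp
  show ?thesis
  proof (cases "\<G> = {}")
    case True
    then show ?thesis using \<open>\<Union>\<G> = \<Omega>\<close> assms(3) empty by simp
  next
    case False
    define K where "K = from_nat_into \<G>"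
    have K: "range K = \<G>" using False \<G>(2) by (simp add: K_def)
    have Kb: "\<exists>a b. K n = box a b \<and> cbox a b \<subseteq> \<Omega>" for n
      using K \<G>(1) unfolding \<F>_def by blast
    have Ko: "K n \<in> sets borel" for n using Kb[of n] by auto
    have dis: "disjointed K n \<in> sets borel" for n
      using Ko by (auto simp: disjointed_def)
    have "Q (\<Union>n. A \<inter> disjointed K n)"
    proof (rule union)
      show "disjoint_family (\<lambda>n. A \<inter> disjointed K n)"
        using disjoint_family_disjointed[of K] by (auto simp: disjoint_family_on_def)
      show "A \<inter> disjointed K n \<in> sets borel" for n using assms(2) dis by auto
      show "A \<inter> disjointed K n \<subseteq> \<Omega>" for n using assms(3) by auto
      show "Q (A \<inter> disjointed K n)" for n
      proof -
        \<comment> \<open>Each disjoint piece lies in a single admissible box, where the local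
          statement is available.\<close>
        obtain a b where ab: "K n = box a b" "cbox a b \<subseteq> \<Omega>" using Kb by blast
        have "A \<inter> disjointed K n = (A \<inter> disjointed K n) \<inter> box a b"
          using ab(1) by (auto simp: disjointed_def)
        then show ?thesis using inside[OF ab(2), of "A \<inter> disjointed K n"] assms(2) dis by auto
      qed
    qed
    moreover have "(\<Union>n. A \<inter> disjointed K n) = A \<inter> \<Omega>"
      using UN_disjointed_eq[of K] K \<open>\<Union>\<G> = \<Omega>\<close> by auto
    ultimately show ?thesis using assms(3) by (simp add: Int_absorb2)
  qed
qed

text \<open>Indicators of boxes span a dense subspace. For a constant sequence \<open>z\<close> and \<open>g = z\<close> this is the
  fundamental lemma of the calculus of variations.\<close>

lemma weakly_null:
  fixes z :: "nat \<Rightarrow> 'a::euclidean_space \<Rightarrow> 'b::{second_countable_topology, real_inner, banach}"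
  assumes \<Omega>: "open \<Omega>" "\<Omega> \<in> lmeasurable"
    and z: "\<And>n. square_integrable (lebesgue_on \<Omega>) (z n)"
      "\<And>n. (\<integral>x. (norm (z n x))\<^sup>2 \<partial>lebesgue_on \<Omega>) \<le> B"
    and box: "\<And>a b y. cbox a b \<subseteq> \<Omega> \<Longrightarrow>
      (\<lambda>n. \<integral>x. indicator (box a b) x *\<^sub>R y \<bullet> z n x \<partial>lebesgue_on \<Omega>) \<longlonglongrightarrow> 0"
    and g: "square_integrable (lebesgue_on \<Omega>) g"
  shows "(\<lambda>n. \<integral>x. g x \<bullet> z n x \<partial>lebesgue_on \<Omega>) \<longlonglongrightarrow> 0"
proof -
  let ?M = "lebesgue_on \<Omega>"
  let ?conv = "\<lambda>g. (\<lambda>n. \<integral>x. g x \<bullet> z n x \<partial>?M) \<longlonglongrightarrow> 0"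
  interpret finite_measure ?M
    using \<Omega>(2) by (rule finite_measure_lebesgue_on)
  note [measurable] = square_integrable_measurable[OF z(1)]
  have sets: "A \<in> sets ?M" if "A \<in> sets borel" "A \<subseteq> \<Omega>" for A
    using that \<Omega>(2) by (auto simp: sets_restrict_space_iff)
  have sq: "square_integrable ?M (\<lambda>x. indicator A x *\<^sub>R y)" if "A \<in> sets ?M" for A and y :: 'b
  proof (rule square_integrable_bound[OF square_integrable_const[of y], of _ 1])
    show "AE x in ?M. norm (indicator A x *\<^sub>R y) \<le> 1 * norm y"
      by (intro AE_I2) (auto simp: indicator_def)
  qed (use that in measurable)
  note int = square_integrable_inner[OF sq z(1)]
  have borel: "?conv (\<lambda>x. indicator A x *\<^sub>R y)" if "A \<in> sets borel" "A \<subseteq> \<Omega>" for A y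
    using \<Omega>(1) that
  proof (induction rule: box_Dynkin_induct)
    case (box a b)
    then show ?case using assms(5) by simp
  next
    case empty
    then show ?case by simp
  next
    case (diff A B)
    have eq: "(indicator (B - A) x *\<^sub>R y) \<bullet> w = (indicator B x *\<^sub>R y) \<bullet> w - (indicator A x *\<^sub>R y) \<bullet> w" for x w
      using \<open>A \<subseteq> B\<close> by (auto simp: indicator_def)
    have "A \<in> sets ?M" "B \<in> sets ?M" using diff(1-4) by (auto intro!: sets)
    then have "(\<integral>x. (indicator (B - A) x *\<^sub>R y) \<bullet> z n x \<partial>?M) =
       (\<integral>x. (indicator B x *\<^sub>R y) \<bullet> z n x \<partial>?M) - (\<integral>x. (indicator A x *\<^sub>R y) \<bullet> z n x \<partial>?M)" for n
      unfolding eq by (intro Bochner_Integration.integral_diff int)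
    then show ?case using tendsto_diff[OF diff(6,5)] by simp
  next
    case (union F)
    have sF: "F i \<in> sets ?M" for i using union sets by auto
    then have sU: "(\<Union>i. F i) \<in> sets ?M" by auto
    \<comment> \<open>Finite disjoint unions are handled by linearity; the countable union is then
      reached as a limit of its finite partial unions through
      \<open>tendsto_integral_inner_closed\<close>.\<close>
    have one: "indicator (\<Union>i<k. F i) x = (\<Sum>i<k. indicator (F i) x :: real)" for k x
      using union(1) by (intro indicator_UN_disjoint) (auto simp: disjoint_family_on_def)
    show ?case
    proof (rule tendsto_integral_inner_closed[OF z, where g = "\<lambda>k x. indicator (\<Union>i<k. F i) x *\<^sub>R y"])
      show "square_integrable ?M (\<lambda>x. indicator (\<Union>i<k. F i) x *\<^sub>R y)" for k
        using sF by (intro sq) auto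
      show "square_integrable ?M (\<lambda>x. indicator (\<Union>i. F i) x *\<^sub>R y)" by (rule sq[OF sU])
      have "(\<integral>x. (indicator (\<Union>i<k. F i) x *\<^sub>R y) \<bullet> z n x \<partial>?M) =
          (\<Sum>i<k. \<integral>x. (indicator (F i) x *\<^sub>R y) \<bullet> z n x \<partial>?M)" for n k
        unfolding one scaleR_sum_left inner_sum_left
        by (rule Bochner_Integration.integral_sum) (rule int[OF sF])
      moreover have "(\<lambda>n. \<Sum>i<k. \<integral>x. (indicator (F i) x *\<^sub>R y) \<bullet> z n x \<partial>?M) \<longlonglongrightarrow> (\<Sum>i<k. 0)" for k
        by (intro tendsto_sum union)
      ultimately show "?conv (\<lambda>x. indicator (\<Union>i<k. F i) x *\<^sub>R y)" for k by simp
      show "(\<lambda>k. indicator (\<Union>i<k. F i) x *\<^sub>R y) \<longlonglongrightarrow> indicator (\<Union>i. F i) x *\<^sub>R y" for x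
      proof -
        have "(\<lambda>k. indicator (\<Union>i<k. F i) x :: real) \<longlonglongrightarrow> indicator (\<Union>i. F i) x"
          by (rule LIMSEQ_indicator_UN)
        then show ?thesis by (intro tendsto_intros)
      qed
      show "norm (indicator (\<Union>i<k. F i) x *\<^sub>R y) \<le> 2 * norm (indicator (\<Union>i. F i) x *\<^sub>R y)" for k x
        by (auto simp: indicator_def)
    qed
  qed
  have meas: "?conv (\<lambda>x. indicator A x *\<^sub>R y)" if A: "A \<in> sets ?M" for A y
  proof -
    have "A \<in> sets lebesgue" "A \<subseteq> \<Omega>" using A \<Omega>(2) by (auto simp: sets_restrict_space_iff)
    \<comment> \<open>A Lebesgue set is a Borel set up to a null set, which the integral does not
      see.\<close>
    then obtain C N N' where C: "A = C \<union> N" "N \<subseteq> N'" "N' \<in> null_sets lborel" "C \<in> sets lborel"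
      by (auto elim!: sets_completionE)
    have "?conv (\<lambda>x. indicator C x *\<^sub>R y)" using C \<open>A \<subseteq> \<Omega>\<close> by (intro borel) auto
    moreover have "(\<integral>x. (indicator A x *\<^sub>R y) \<bullet> z n x \<partial>?M) = (\<integral>x. (indicator C x *\<^sub>R y) \<bullet> z n x \<partial>?M)" for n
    proof (rule integral_cong_AE)
      have [measurable]: "A \<in> sets ?M" "C \<in> sets ?M" using A sets C \<open>A \<subseteq> \<Omega>\<close> by auto
      show "(\<lambda>x. (indicator A x *\<^sub>R y) \<bullet> z n x) \<in> borel_measurable ?M"
        "(\<lambda>x. (indicator C x *\<^sub>R y) \<bullet> z n x) \<in> borel_measurable ?M" by measurable
      have "AE x in lebesgue. x \<notin> N'"
        using C(3) by (intro AE_not_in null_sets_completionI)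
      then have "AE x in lebesgue. x \<in> \<Omega> \<longrightarrow> (indicator A x *\<^sub>R y) \<bullet> z n x = (indicator C x *\<^sub>R y) \<bullet> z n x"
        by eventually_elim (use C in \<open>auto simp: indicator_def\<close>)
      then show "AE x in ?M. (indicator A x *\<^sub>R y) \<bullet> z n x = (indicator C x *\<^sub>R y) \<bullet> z n x"
        using \<Omega>(2) by (subst AE_restrict_space_iff) auto
    qed
    ultimately show ?thesis by simp
  qed
  obtain s where s: "\<And>i. simple_function ?M (s i)" "\<And>x. x \<in> space ?M \<Longrightarrow> (\<lambda>i. s i x) \<longlonglongrightarrow> g x"
    "\<And>i x. x \<in> space ?M \<Longrightarrow> norm (s i x) \<le> 2 * norm (g x)"
    using borel_measurable_implies_sequence_metric[OF square_integrable_measurable[OF g], of 0]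
    unfolding norm_conv_dist by metis
  have "?conv (s i)" for i
  proof -
    note si = simple_functionD[OF s(1)[of i]]
    define V where "V y = s i -` {y} \<inter> space ?M" for y
    have V: "V y \<in> sets ?M" for y unfolding V_def by (rule si(2))
    have rep: "s i x = (\<Sum>y\<in>s i ` space ?M. indicator (V y) x *\<^sub>R y)" if "x \<in> space ?M" for x
    proof -
      have "(\<Sum>y\<in>s i ` space ?M. indicator (V y) x *\<^sub>R y) = (\<Sum>y\<in>s i ` space ?M. if y = s i x then y else 0)"
        using that by (intro sum.cong) (auto simp: V_def indicator_def)
      then show ?thesis using si(1) that by simp
    qed
    have "(\<integral>x. s i x \<bullet> z n x \<partial>?M) = (\<Sum>y\<in>s i ` space ?M. \<integral>x. (indicator (V y) x *\<^sub>R y) \<bullet> z n x \<partial>?M)" for n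
    proof -
      have "(\<integral>x. s i x \<bullet> z n x \<partial>?M) = (\<integral>x. (\<Sum>y\<in>s i ` space ?M. (indicator (V y) x *\<^sub>R y) \<bullet> z n x) \<partial>?M)"
        by (rule Bochner_Integration.integral_cong) (simp_all only: rep inner_sum_left)
      also have "\<dots> = (\<Sum>y\<in>s i ` space ?M. \<integral>x. (indicator (V y) x *\<^sub>R y) \<bullet> z n x \<partial>?M)"
        by (rule Bochner_Integration.integral_sum) (rule int[OF V])
      finally show ?thesis .
    qed
    moreover have "(\<lambda>n. \<Sum>y\<in>s i ` space ?M. \<integral>x. (indicator (V y) x *\<^sub>R y) \<bullet> z n x \<partial>?M) \<longlonglongrightarrow> (\<Sum>y\<in>s i ` space ?M. 0)"
      by (intro tendsto_sum meas V)
    ultimately show ?thesis by simp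
  qed
  moreover have "square_integrable ?M (s i)" for i
  proof (rule square_integrable_bound[OF g, of _ 2])
    show "s i \<in> borel_measurable ?M" by (rule borel_measurable_simple_function[OF s(1)])
    show "AE x in ?M. norm (s i x) \<le> 2 * norm (g x)" by (intro AE_I2 s(3))
  qed
  ultimately show ?thesis
    by (intro tendsto_integral_inner_closed[OF z _ g _ s(2,3)])
qed

section \<open>Test functions and weak gradients\<close>

lemma test_functions_support:
  "\<phi> \<in> test_functions \<Omega> \<Longrightarrow> x \<notin> closure {x. \<phi> x \<noteq> 0} \<Longrightarrow> \<phi> x = 0"
  using closure_subset[of "{x. \<phi> x \<noteq> 0}"] by blast

lemma test_functions_has_derivative:
  "\<phi> \<in> test_functions \<Omega> \<Longrightarrow> (\<phi> has_derivative frechet_derivative \<phi> (at x)) (at x)"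
  by (rule Ck_Suc_has_derivative[of 0]) (simp add: test_functions_def del: Ck.simps)

lemma test_functions_continuous:
  assumes "\<phi> \<in> test_functions \<Omega>"
  shows "continuous_on UNIV \<phi>"
    and "i \<in> Basis \<Longrightarrow> continuous_on UNIV (\<lambda>x. frechet_derivative \<phi> (at x) i)"
proof -
  have Ck: "Ck n \<phi>" for n using assms by (simp add: test_functions_def)
  show "continuous_on UNIV \<phi>" using Ck[of 0] by simp
  show "i \<in> Basis \<Longrightarrow> continuous_on UNIV (\<lambda>x. frechet_derivative \<phi> (at x) i)"
    using Ck_all_derivative[OF Ck, of i 0] by simp
qed

lemma test_functions_derivative_support:
  assumes "\<phi> \<in> test_functions \<Omega>" "x \<notin> closure {x. \<phi> x \<noteq> 0}"
  shows "frechet_derivative \<phi> (at x) = (\<lambda>_. 0)"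
proof (rule frechet_derivative_eqI)
  show "(\<phi> has_derivative (\<lambda>_. 0)) (at x)"
    by (rule has_derivative_transform_within_open[where f = "\<lambda>_. 0"
          and s = "- closure {x. \<phi> x \<noteq> 0}"])
       (use assms test_functions_support in \<open>auto simp: open_Compl\<close>)
qed

lemma compactly_supported_integrable:
  fixes c :: "'a::euclidean_space \<Rightarrow> 'b::euclidean_space"
  assumes "continuous_on UNIV c" "compact K" "\<And>x. x \<notin> K \<Longrightarrow> c x = 0"
  shows "integrable lborel c" "sq_integrable c"
proof -
  have *: "integrable lborel f" if "continuous_on UNIV f" "\<And>x. x \<notin> K \<Longrightarrow> f x = 0"
    for f :: "'a \<Rightarrow> 'c::euclidean_space"
  proof -
    have "integrable lborel (\<lambda>x. indicator K x *\<^sub>R f x)"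
      by (rule borel_integrable_compact[OF assms(2) continuous_on_subset[OF that(1)]]) simp
    moreover have "(\<lambda>x. indicator K x *\<^sub>R f x) = f" using that(2) by (auto simp: indicator_def)
    ultimately show ?thesis by simp
  qed
  show "integrable lborel c" by (rule *) (use assms in auto)
  have m: "c \<in> borel_measurable borel" using assms(1) by (rule borel_measurable_continuous_onI)
  have "integrable lborel (\<lambda>x. (norm (c x))\<^sup>2)"
    by (rule *) (use assms in \<open>auto intro!: continuous_intros\<close>)
  then show "sq_integrable c"
    unfolding sq_integrable_def using m by (simp add: integrable_completion measurable_completion)
qed

lemma sq_integrable_test_functions:
  assumes "\<phi> \<in> test_functions \<Omega>"
  shows "sq_integrable \<phi>" "sq_integrable (gradient \<phi>)"
    "i \<in> Basis \<Longrightarrow> sq_integrable (\<lambda>x. frechet_derivative \<phi> (at x) i)"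
    "sq_integrable (\<lambda>x. \<phi> x *\<^sub>R y)"
proof -
  note c = test_functions_continuous[OF assms]
  have K: "compact (closure {x. \<phi> x \<noteq> 0})" using assms by (simp add: test_functions_def)
  note sup = test_functions_support[OF assms] test_functions_derivative_support[OF assms]
  show "sq_integrable \<phi>"
    by (rule compactly_supported_integrable(2)[OF c(1) K]) (rule sup(1))
  show "sq_integrable (\<lambda>x. frechet_derivative \<phi> (at x) i)" if "i \<in> Basis" for i
    by (rule compactly_supported_integrable(2)[OF c(2)[OF that] K]) (metis sup(2))
  show "sq_integrable (\<lambda>x. \<phi> x *\<^sub>R y)"
    by (rule compactly_supported_integrable(2)[OF _ K]) (auto intro!: continuous_intros c dest: sup)
  show "sq_integrable (gradient \<phi>)"
    unfolding gradient_def
    by (rule compactly_supported_integrable(2)[OF _ K]) (auto intro!: continuous_intros c dest: sup)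
qed

text \<open>By translation invariance of Lebesgue measure every difference quotient of \<phi> has
  integral 0; dominated convergence passes this to the derivative, without iterated
  integrals.\<close>

lemma integral_partial_derivative_eq_0:
  fixes \<phi> :: "'a::euclidean_space \<Rightarrow> real"
  assumes \<phi>: "\<phi> \<in> test_functions \<Omega>" and i: "i \<in> Basis"
  shows "(\<integral>x. frechet_derivative \<phi> (at x) i \<partial>lborel) = 0"
proof -
  let ?D = "\<lambda>x. frechet_derivative \<phi> (at x) i" and ?K = "closure {x. \<phi> x \<noteq> 0}"
  define h where "h n = inverse (real (Suc n))" for n
  have h: "0 < h n" "h n \<le> 1" "h \<longlonglongrightarrow> 0" for n
    unfolding h_def[abs_def] by (auto intro: LIMSEQ_inverse_real_of_nat simp: inverse_le_1_iff simp del: of_nat_Suc)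
  note c = test_functions_continuous[OF \<phi>]
  have K: "compact ?K" using \<phi> by (simp add: test_functions_def)
  note sup = test_functions_support[OF \<phi>] test_functions_derivative_support[OF \<phi>]
  have [measurable]: "\<phi> \<in> borel_measurable borel" "?D \<in> borel_measurable borel"
    using c(1) c(2)[OF i] by (auto intro: borel_measurable_continuous_onI)
  have int: "integrable lborel \<phi>"
    by (rule compactly_supported_integrable(1)[OF c(1) K]) (rule sup(1))
  obtain R where R: "\<And>x. x \<in> ?K \<Longrightarrow> norm x \<le> R"
    using compact_imp_bounded[OF K] by (auto simp: bounded_iff)
  obtain M where M: "\<And>x. \<bar>?D x\<bar> \<le> M"
  proof -
    have "compact (?D ` ?K)"
      by (rule compact_continuous_image[OF continuous_on_subset[OF c(2)[OF i]] K]) simp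
    then obtain M where "\<And>x. x \<in> ?K \<Longrightarrow> \<bar>?D x\<bar> \<le> M"
      using compact_imp_bounded by (fastforce simp: bounded_iff)
    then have "\<bar>?D x\<bar> \<le> max M 0" for x
      using sup(2) by (cases "x \<in> ?K") (auto simp: le_max_iff_disj)
    then show ?thesis by (rule that)
  qed
  have M0: "0 \<le> M" using M[of 0] by linarith
  have line: "((\<lambda>s. \<phi> (x + s *\<^sub>R i)) has_real_derivative ?D (x + s *\<^sub>R i)) (at s)" for x s
  proof -
    have "((\<lambda>s. x + s *\<^sub>R i) has_derivative (\<lambda>s. s *\<^sub>R i)) (at s)"
      by (auto intro!: derivative_eq_intros)
    from has_derivative_compose[OF this test_functions_has_derivative[OF \<phi>]]
    have "((\<lambda>s. \<phi> (x + s *\<^sub>R i)) has_derivative (\<lambda>t. frechet_derivative \<phi> (at (x + s *\<^sub>R i)) (t *\<^sub>R i))) (at s)" .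
    moreover have "frechet_derivative \<phi> (at y) (t *\<^sub>R i) = ?D y * t" for y t
      using linear_scale[OF has_derivative_linear[OF test_functions_has_derivative[OF \<phi>]]] by simp
    ultimately show ?thesis by (simp add: has_field_derivative_def)
  qed
  have "(\<lambda>n. \<integral>x. (\<phi> (h n *\<^sub>R i + x) - \<phi> x) / h n \<partial>lborel) \<longlonglongrightarrow> (\<integral>x. ?D x \<partial>lborel)"
  proof (rule integral_dominated_convergence)
    \<comment> \<open>The mean value theorem bounds the quotients by \<open>M\<close>. As
      \<open>h n \<le> 1\<close>, both \<phi> and its translate vanish outside the ball of radius
      \<open>R + 1\<close>.\<close>
    show "integrable lborel (\<lambda>x. indicator (cball 0 (R + 1)) x *\<^sub>R M :: real)"
      by (rule borel_integrable_compact) (auto simp: compact_cball)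
    show "AE x in lborel. (\<lambda>n. (\<phi> (h n *\<^sub>R i + x) - \<phi> x) / h n) \<longlonglongrightarrow> ?D x"
    proof (rule AE_I2)
      fix x
      have "((\<lambda>s. (\<phi> (x + s *\<^sub>R i) - \<phi> x) / s) \<longlongrightarrow> ?D x) (at 0)"
        using line[of x 0] by (simp add: has_field_derivative_iff)
      moreover have "filterlim h (at 0) sequentially"
        unfolding filterlim_at using h by (auto simp: less_imp_neq[symmetric])
      ultimately show "(\<lambda>n. (\<phi> (h n *\<^sub>R i + x) - \<phi> x) / h n) \<longlonglongrightarrow> ?D x"
        using filterlim_compose by (auto simp: add.commute)
    qed
    show "AE x in lborel. norm ((\<phi> (h n *\<^sub>R i + x) - \<phi> x) / h n) \<le> indicator (cball 0 (R + 1)) x *\<^sub>R M" for n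
    proof (rule AE_I2)
      fix x
      obtain s where "\<phi> (x + h n *\<^sub>R i) - \<phi> (x + 0 *\<^sub>R i) = (h n - 0) * ?D (x + s *\<^sub>R i)"
        using MVT2[of 0 "h n" "\<lambda>s. \<phi> (x + s *\<^sub>R i)" "\<lambda>s. ?D (x + s *\<^sub>R i)"] h(1)[of n] line by blast
      then have b: "\<bar>(\<phi> (h n *\<^sub>R i + x) - \<phi> x) / h n\<bar> \<le> M"
        using M h(1)[of n] by (simp add: add.commute)
      show "norm ((\<phi> (h n *\<^sub>R i + x) - \<phi> x) / h n) \<le> indicator (cball 0 (R + 1)) x *\<^sub>R M"
      proof (cases "norm x \<le> R + 1")
        case False
        have "norm x \<le> norm (h n *\<^sub>R i + x) + norm (h n *\<^sub>R i)"
          using norm_triangle_ineq4[of "h n *\<^sub>R i + x" "h n *\<^sub>R i"] by simp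
        also have "norm (h n *\<^sub>R i) \<le> 1" using h(1,2)[of n] i by simp
        finally have "x \<notin> ?K" "h n *\<^sub>R i + x \<notin> ?K" using False R by (smt (verit))+
        then have "\<phi> x = 0" "\<phi> (h n *\<^sub>R i + x) = 0" by (auto intro: sup)
        then show ?thesis using M0 by simp
      qed (use b in simp)
    qed
  qed measurable
  moreover have "(\<integral>x. (\<phi> (h n *\<^sub>R i + x) - \<phi> x) / h n \<partial>lborel) = 0" for n
  proof -
    have "integrable lborel (\<lambda>x. \<phi> (h n *\<^sub>R i + x))" "(\<integral>x. \<phi> (h n *\<^sub>R i + x) \<partial>lborel) = (\<integral>x. \<phi> x \<partial>lborel)"
      using int integrable_distr_eq[of "(+) (h n *\<^sub>R i)" lborel borel \<phi>]
        integral_distr[of "(+) (h n *\<^sub>R i)" lborel borel \<phi>] lborel_distr_plus[of "h n *\<^sub>R i"]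
      by auto
    then show ?thesis using int by simp
  qed
  ultimately have "(\<lambda>n::nat. 0) \<longlonglongrightarrow> (\<integral>x. ?D x \<partial>lborel)" by (simp only:)
  then show ?thesis by (simp add: LIMSEQ_const_iff)
qed

lemma test_functions_mult:
  assumes "\<phi> \<in> test_functions \<Omega>" "\<psi> \<in> test_functions \<Omega>"
  shows "(\<lambda>x. \<phi> x * \<psi> x) \<in> test_functions \<Omega>"
proof -
  let ?A = "closure {x. \<phi> x * \<psi> x \<noteq> 0}" and ?B = "closure {x. \<phi> x \<noteq> 0}"
  have sub: "?A \<subseteq> ?B" by (rule closure_mono) auto
  have "compact ?B" "?B \<subseteq> \<Omega>" using assms by (simp_all add: test_functions_def)
  moreover have "compact (?B \<inter> ?A)" using \<open>compact ?B\<close> by (rule compact_Int_closed) simp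
  moreover have "Ck n (\<lambda>x. \<phi> x * \<psi> x)" for n
    by (rule Ck_mult) (use assms in \<open>simp_all add: test_functions_def\<close>)
  ultimately show ?thesis
    unfolding test_functions_def using sub by (simp add: Int_absorb1 subset_trans[of ?A ?B])
qed

lemma L2_on_abs_l2: "sq_integrable f \<Longrightarrow> abs_l2 f \<in> L2_on \<Omega> \<longleftrightarrow> (AE x in lebesgue. x \<notin> \<Omega> \<longrightarrow> f x = 0)"
  unfolding L2_on_def by (simp add: vanishes_outside.abs_eq)

text \<open>Integration by parts: the product of two test functions is a test function, so its
  partial derivatives integrate to 0 and the product rule gives the identity.\<close>

lemma test_function_has_weak_gradient:
  assumes \<phi>: "\<phi> \<in> test_functions \<Omega>"
  shows "abs_l2 \<phi> \<in> L2_on \<Omega>" "has_weak_gradient \<Omega> (abs_l2 \<phi>) (abs_l2 (gradient \<phi>))"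
proof -
  note sq = sq_integrable_test_functions
  note sup = test_functions_support[OF \<phi>] test_functions_derivative_support[OF \<phi>]
  have sub: "closure {x. \<phi> x \<noteq> 0} \<subseteq> \<Omega>" using \<phi> by (simp add: test_functions_def)
  have "gradient \<phi> x = 0" if "x \<notin> \<Omega>" for x
    using sub that by (subst gradient_def, subst sup(2)) auto
  then have g: "abs_l2 (gradient \<phi>) \<in> L2_on \<Omega>"
    by (simp add: L2_on_abs_l2 sq[OF \<phi>])
  show "abs_l2 \<phi> \<in> L2_on \<Omega>" 
    unfolding L2_on_abs_l2[OF sq(1)[OF \<phi>]] using sub by (intro AE_I2 impI sup) blast
  have "abs_l2 \<phi> \<bullet> abs_l2 (\<lambda>x. frechet_derivative \<psi> (at x) i)
     = - (abs_l2 (gradient \<phi>) \<bullet> abs_l2 (\<lambda>x. \<psi> x *\<^sub>R i))" if \<psi>: "\<psi> \<in> test_functions \<Omega>" and i: "i \<in> Basis" for \<psi> i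
  proof -
    let ?D = "\<lambda>\<phi> x. frechet_derivative \<phi> (at x) i"
    have gi: "gradient \<phi> x \<bullet> (\<psi> x *\<^sub>R i) = ?D \<phi> x * \<psi> x" for x
      using i by (simp add: gradient_def inner_sum_left inner_Basis if_distrib cong: if_cong)
    have "?D (\<lambda>x. \<phi> x * \<psi> x) x = \<phi> x * ?D \<psi> x + ?D \<phi> x * \<psi> x" for x
      by (subst frechet_derivative_eqI[OF has_derivative_mult[OF test_functions_has_derivative[OF \<phi>]
        test_functions_has_derivative[OF \<psi>]]]) simp
    with integral_partial_derivative_eq_0[OF test_functions_mult[OF \<phi> \<psi>] i]
    have "(\<integral>x. \<phi> x * ?D \<psi> x + ?D \<phi> x * \<psi> x \<partial>lborel) = 0" by simp
    moreover have "(\<lambda>x. \<phi> x * ?D \<psi> x + ?D \<phi> x * \<psi> x) \<in> borel_measurable lborel"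
      using test_functions_continuous[OF \<phi>] test_functions_continuous[OF \<psi>] i
      by (auto intro!: borel_measurable_continuous_onI continuous_intros)
    ultimately have "(\<integral>x. \<phi> x * ?D \<psi> x + ?D \<phi> x * \<psi> x \<partial>lebesgue) = 0"
      by (simp add: integral_completion)
    moreover have "integrable lebesgue (\<lambda>x. \<phi> x * ?D \<psi> x)" "integrable lebesgue (\<lambda>x. ?D \<phi> x * \<psi> x)"
      using sq_integrable_inner[OF sq(1)[OF \<phi>] sq(3)[OF \<psi> i]] sq_integrable_inner[OF sq(3)[OF \<phi> i] sq(1)[OF \<psi>]]
      by simp_all
    ultimately have "(\<integral>x. \<phi> x * ?D \<psi> x \<partial>lebesgue) = - (\<integral>x. ?D \<phi> x * \<psi> x \<partial>lebesgue)" by simp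
    then show ?thesis
      by (simp add: inner_l2.abs_eq sq[OF \<phi>] sq[OF \<psi>] sq(3)[OF \<psi> i] gi del: inner_scaleR_right)
  qed
  with g show "has_weak_gradient \<Omega> (abs_l2 \<phi>) (abs_l2 (gradient \<phi>))"
    by (simp add: has_weak_gradient_def)
qed

text \<open>A smooth cut-off that increases from 0 to 1 in layers of width \<open>1 / Suc n\<close>
  along the inner side of the faces. It vanishes off the open box, so it approximates the indicator
  from inside.\<close>

definition box_bump :: "'a \<Rightarrow> 'a \<Rightarrow> nat \<Rightarrow> 'a::euclidean_space \<Rightarrow> real" where
  "box_bump a b n x =
     (\<Prod>i\<in>Basis. step (real (Suc n) * (x \<bullet> i - a \<bullet> i)) * step (real (Suc n) * (b \<bullet> i - x \<bullet> i)))"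

lemma box_bump_bounds: "0 \<le> box_bump a b n x" "box_bump a b n x \<le> 1"
  unfolding box_bump_def
  by (auto intro!: prod_nonneg prod_le_1 mult_nonneg_nonneg mult_le_one step_bounds)

lemma box_bump_eq_0:
  assumes "x \<notin> box a b" shows "box_bump a b n x = 0"
proof -
  obtain i where "i \<in> Basis" "x \<bullet> i \<le> a \<bullet> i \<or> b \<bullet> i \<le> x \<bullet> i"
    using assms by (auto simp: mem_box not_less)
  moreover from this have "step (real (Suc n) * (x \<bullet> i - a \<bullet> i)) * step (real (Suc n) * (b \<bullet> i - x \<bullet> i)) = 0"
    using step_eq_0[of "real (Suc n) * (x \<bullet> i - a \<bullet> i)"] step_eq_0[of "real (Suc n) * (b \<bullet> i - x \<bullet> i)"]
    by (auto simp: mult_nonneg_nonpos simp del: of_nat_Suc)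
  ultimately show ?thesis by (auto simp: box_bump_def)
qed

lemma box_bump_tendsto: "(\<lambda>n. box_bump a b n x) \<longlonglongrightarrow> indicator (box a b) x"
proof (cases "x \<in> box a b")
  case True
  have ev: "\<forall>\<^sub>F n in sequentially. step (real (Suc n) * d) = 1" if "d > 0" for d
  proof -
    have "\<forall>\<^sub>F n in sequentially. 1 / d \<le> real n" by (rule eventually_ge_at_top[THEN filterlim_real_sequentially[unfolded filterlim_iff, rule_format]])
    then show ?thesis
      by eventually_elim (use that in \<open>auto intro!: step_eq_1 simp: field_simps\<close>)
  qed
  have "\<forall>\<^sub>F n in sequentially. \<forall>i\<in>Basis. step (real (Suc n) * (x \<bullet> i - a \<bullet> i)) = 1 \<and> step (real (Suc n) * (b \<bullet> i - x \<bullet> i)) = 1"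
    using True by (intro eventually_ball_finite ballI eventually_conj ev) (auto simp: mem_box)
  then have "\<forall>\<^sub>F n in sequentially. box_bump a b n x = indicator (box a b) x"
    by eventually_elim (use True in \<open>simp add: box_bump_def\<close>)
  then show ?thesis by (rule tendsto_eventually)
qed (simp add: box_bump_eq_0)

lemma box_bump_test_function:
  assumes "cbox a b \<subseteq> \<Omega>" shows "box_bump a b n \<in> test_functions \<Omega>"
proof -
  have "Ck k (box_bump a b n)" for k
  proof -
    have "Ck k (\<lambda>x. step (real (Suc n) * (x \<bullet> i) + - (real (Suc n) * (a \<bullet> i))) *
        step (- real (Suc n) * (x \<bullet> i) + real (Suc n) * (b \<bullet> i)))" for i
      by (intro Ck_mult Ck_step_affine)
    then have "Ck k (\<lambda>x. \<Prod>i\<in>Basis. step (real (Suc n) * (x \<bullet> i) + - (real (Suc n) * (a \<bullet> i))) *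
        step (- real (Suc n) * (x \<bullet> i) + real (Suc n) * (b \<bullet> i)))"
      by (intro Ck_prod) auto
    then show ?thesis
      by (rule Ck_cong) (simp add: box_bump_def algebra_simps)
  qed
  moreover have sub: "closure {x. box_bump a b n x \<noteq> 0} \<subseteq> cbox a b"
    using box_bump_eq_0[of _ a b n] box_subset_cbox[of a b] by (intro closure_minimal) (auto simp: subset_eq)
  moreover have "compact (closure {x. box_bump a b n x \<noteq> 0})"
    using bounded_subset[OF bounded_cbox sub] by (simp add: compact_eq_bounded_closed)
  ultimately show ?thesis using assms by (auto simp: test_functions_def)
qed

text \<open>The fundamental lemma: orthogonality passes from the cut-offs \<open>box_bump\<close> to
  indicators of boxes, and \<open>weakly_null\<close> with the constant sequence \<open>H\<close>,
  tested with \<open>H\<close> itself, gives that the square of the norm of \<open>H\<close>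
  integrates to 0 over \<Omega>. Outside \<Omega> the function vanishes by membership in
  \<open>L2_on\<close>.\<close>

lemma l2_eq_0I:
  fixes G :: "('a::euclidean_space, 'b::euclidean_space) l2"
  assumes \<Omega>: "open \<Omega>" "\<Omega> \<in> lmeasurable" and G: "G \<in> L2_on \<Omega>"
    and orth: "\<And>\<phi> i. \<phi> \<in> test_functions \<Omega> \<Longrightarrow> i \<in> Basis \<Longrightarrow> G \<bullet> abs_l2 (\<lambda>x. \<phi> x *\<^sub>R i) = 0"
  shows "G = 0"
proof -
  obtain H where H: "sq_integrable H" "G = abs_l2 H" using ex_abs_l2 by blast
  let ?M = "lebesgue_on \<Omega>"
  have Hm: "H \<in> borel_measurable lebesgue" using H by (simp add: sq_integrable_def)
  have sq: "square_integrable ?M H"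
    using H(1) \<Omega>(2) unfolding square_integrable_def sq_integrable_def
    using integrable_mult_indicator[of \<Omega> lebesgue "\<lambda>x. (norm (H x))\<^sup>2"]
    by (auto intro: measurable_restrict_space1 simp: integrable_restrict_space)
  have "(\<lambda>n::nat. \<integral>x. H x \<bullet> H x \<partial>?M) \<longlonglongrightarrow> 0"
  proof (rule weakly_null[OF \<Omega> sq order_refl _ sq])
    fix a b :: 'a and y :: 'b assume ab: "cbox a b \<subseteq> \<Omega>"
    \<comment> \<open>The hypothesis only concerns test functions times basis vectors; a general
      direction \<open>y\<close> is assembled from its coordinates afterwards.\<close>
    have i: "(\<integral>x. indicator (box a b) x * (i \<bullet> H x) \<partial>lebesgue) = 0" if "i \<in> Basis" for i
    proof -
      have "(\<lambda>n. \<integral>x. box_bump a b n x * (i \<bullet> H x) \<partial>lebesgue) \<longlonglongrightarrow> (\<integral>x. indicator (box a b) x * (i \<bullet> H x) \<partial>lebesgue)"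
      proof (rule integral_dominated_convergence)
        show "integrable lebesgue (\<lambda>x. indicator (cbox a b) x * \<bar>i \<bullet> H x\<bar>)"
        proof -
          have "integrable lebesgue (\<lambda>x. (indicator (cbox a b) x *\<^sub>R i) \<bullet> H x)"
            by (intro sq_integrable_inner sq_integrable_indicator H) auto
          from integrable_abs[OF this] show ?thesis by (simp add: abs_mult)
        qed
        show "AE x in lebesgue. (\<lambda>n. box_bump a b n x * (i \<bullet> H x)) \<longlonglongrightarrow> indicator (box a b) x * (i \<bullet> H x)"
          by (intro AE_I2 tendsto_intros box_bump_tendsto)
        show "AE x in lebesgue. norm (box_bump a b n x * (i \<bullet> H x)) \<le> indicator (cbox a b) x * \<bar>i \<bullet> H x\<bar>" for n
        proof (rule AE_I2)
          show "norm (box_bump a b n x * (i \<bullet> H x)) \<le> indicator (cbox a b) x * \<bar>i \<bullet> H x\<bar>" for x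
            using box_bump_bounds[of a b n x] box_bump_eq_0[of x a b n] box_subset_cbox[of a b, THEN subsetD, of x]
            by (cases "x \<in> box a b") (auto simp: abs_mult indicator_def intro!: mult_left_le_one_le)
        qed
        show "(\<lambda>x. box_bump a b n x * (i \<bullet> H x)) \<in> borel_measurable lebesgue" for n
          using sq_integrable_measurable[OF sq_integrable_test_functions(1)[OF box_bump_test_function[OF ab]]]
          by (intro borel_measurable_times borel_measurable_inner Hm) auto
        show "(\<lambda>x. indicator (box a b) x * (i \<bullet> H x)) \<in> borel_measurable lebesgue"
          by (intro borel_measurable_times borel_measurable_inner borel_measurable_indicator
              fmeasurableD[OF lmeasurable_box] Hm) auto
      qed
      moreover have "(\<integral>x. box_bump a b n x * (i \<bullet> H x) \<partial>lebesgue) = 0" for n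
      proof -
        note \<phi> = box_bump_test_function[OF ab, of n]
        have "G \<bullet> abs_l2 (\<lambda>x. box_bump a b n x *\<^sub>R i) = (\<integral>x. H x \<bullet> (box_bump a b n x *\<^sub>R i) \<partial>lebesgue)"
          unfolding H(2) by (rule inner_l2.abs_eq) (use H sq_integrable_test_functions[OF \<phi>] in auto)
        then show ?thesis using orth[OF \<phi> that] by (simp add: inner_commute)
      qed
      ultimately show ?thesis by (simp add: LIMSEQ_const_iff)
    qed
    have "(\<integral>x. indicator (box a b) x *\<^sub>R y \<bullet> H x \<partial>?M) = (\<integral>x. indicator (box a b) x *\<^sub>R y \<bullet> H x \<partial>lebesgue)"
      using \<Omega>(2) subset_trans[OF box_subset_cbox ab]
      by (subst integral_restrict_space) (auto intro!: Bochner_Integration.integral_cong simp: indicator_def)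
    also have "\<dots> = (\<integral>x. (\<Sum>i\<in>Basis. (y \<bullet> i) * (indicator (box a b) x * (i \<bullet> H x))) \<partial>lebesgue)"
      by (subst euclidean_inner) (simp add: sum_distrib_left inner_commute mult_ac)
    also have "\<dots> = (\<Sum>i\<in>Basis. (y \<bullet> i) * (\<integral>x. indicator (box a b) x * (i \<bullet> H x) \<partial>lebesgue))"
    proof -
      have "integrable lebesgue (\<lambda>x. indicator (box a b) x * (i \<bullet> H x))" for i
        using sq_integrable_inner[OF sq_integrable_indicator H(1), of "box a b" i] by simp
      then show ?thesis by (subst Bochner_Integration.integral_sum) auto
    qed
    also have "\<dots> = 0" using i by simp
    finally show "(\<lambda>n::nat. \<integral>x. indicator (box a b) x *\<^sub>R y \<bullet> H x \<partial>?M) \<longlonglongrightarrow> 0" by simp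
  qed
  then have "(\<integral>x. H x \<bullet> H x \<partial>?M) = 0" by (simp add: LIMSEQ_const_iff)
  then have "AE x in ?M. H x = 0"
    using integral_nonneg_eq_0_iff_AE[OF square_integrable_inner[OF sq sq]] by simp
  then have "AE x in lebesgue. x \<in> \<Omega> \<longrightarrow> H x = 0"
    using \<Omega>(2) by (simp add: AE_restrict_space_iff)
  moreover have "AE x in lebesgue. x \<notin> \<Omega> \<longrightarrow> H x = 0"
    using G H by (simp add: L2_on_abs_l2)
  ultimately have "AE x in lebesgue. (norm (H x))\<^sup>2 = 0" by eventually_elim auto
  then have "(norm G)\<^sup>2 = 0"
    unfolding H(2) norm_abs_l2[OF H(1)] by (rule integral_eq_zero_AE)
  then show ?thesis by simp
qed

lemma L2_on_subspace: "subspace (L2_on \<Omega>)"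
proof -
  have "f + g \<in> L2_on \<Omega>" if "f \<in> L2_on \<Omega>" "g \<in> L2_on \<Omega>" for f g :: "('a, 'b) l2"
    using that unfolding L2_on_def mem_Collect_eq by transfer auto
  moreover have "c *\<^sub>R f \<in> L2_on \<Omega>" if "f \<in> L2_on \<Omega>" for c and f :: "('a, 'b) l2"
    using that unfolding L2_on_def mem_Collect_eq by transfer auto
  moreover have "0 \<in> L2_on \<Omega>"
    unfolding L2_on_def mem_Collect_eq by transfer auto
  ultimately show ?thesis by (auto simp: subspace_def)
qed

section \<open>The weak gradient as a linear operator\<close>

lemma has_weak_gradient_add:
  "has_weak_gradient \<Omega> u g \<Longrightarrow> has_weak_gradient \<Omega> v h \<Longrightarrow> has_weak_gradient \<Omega> (u + v) (g + h)"
  by (auto simp: has_weak_gradient_def inner_add_left subspace_add[OF L2_on_subspace])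

lemma has_weak_gradient_scaleR:
  "has_weak_gradient \<Omega> u g \<Longrightarrow> has_weak_gradient \<Omega> (c *\<^sub>R u) (c *\<^sub>R g)"
  by (auto simp: has_weak_gradient_def subspace_scale[OF L2_on_subspace])

lemma has_weak_gradient_0: "has_weak_gradient \<Omega> 0 0"
  by (simp add: has_weak_gradient_def subspace_0[OF L2_on_subspace])

locale bounded_domain =
  fixes \<Omega> :: "'a::euclidean_space set"
  assumes open_domain: "open \<Omega>" and lmeasurable_domain: "\<Omega> \<in> lmeasurable"
begin

text \<open>Two weak gradients differ by an element of \<open>L2_on\<close> orthogonal to all test
  fields, hence by 0. This uniqueness is what makes the definite description in
  \<open>weak_gradient\<close> usable.\<close>

lemma weak_gradient_eqI:
  assumes "has_weak_gradient \<Omega> u g" shows "weak_gradient \<Omega> u = g"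
  unfolding weak_gradient_def
proof (rule the_equality)
  show "has_weak_gradient \<Omega> u g" by (rule assms)
  fix h assume h: "has_weak_gradient \<Omega> u h"
  have "h - g = 0"
  proof (rule l2_eq_0I[OF open_domain lmeasurable_domain])
    show "h - g \<in> L2_on \<Omega>"
      using assms h by (auto simp: has_weak_gradient_def intro: subspace_diff[OF L2_on_subspace])
    show "(h - g) \<bullet> abs_l2 (\<lambda>x. \<phi> x *\<^sub>R i) = 0" if "\<phi> \<in> test_functions \<Omega>" "i \<in> Basis" for \<phi> i
      using assms h that by (auto simp: has_weak_gradient_def inner_diff_left)
  qed
  then show "h = g" by simp
qed

lemma weak_gradient: "u \<in> H1_on \<Omega> \<Longrightarrow> has_weak_gradient \<Omega> u (weak_gradient \<Omega> u)"
  unfolding H1_on_def using weak_gradient_eqI by auto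

lemma H1_on_subspace: "subspace (H1_on \<Omega>)"
  unfolding subspace_def H1_on_def
  using has_weak_gradient_add has_weak_gradient_scaleR has_weak_gradient_0
  by (auto intro: subspace_add[OF L2_on_subspace] subspace_scale[OF L2_on_subspace] subspace_0[OF L2_on_subspace]) blast+

lemma weak_gradient_add:
  "u \<in> H1_on \<Omega> \<Longrightarrow> v \<in> H1_on \<Omega> \<Longrightarrow> weak_gradient \<Omega> (u + v) = weak_gradient \<Omega> u + weak_gradient \<Omega> v"
  by (intro weak_gradient_eqI has_weak_gradient_add weak_gradient)

lemma weak_gradient_scaleR:
  "u \<in> H1_on \<Omega> \<Longrightarrow> weak_gradient \<Omega> (c *\<^sub>R u) = c *\<^sub>R weak_gradient \<Omega> u"
  by (intro weak_gradient_eqI has_weak_gradient_scaleR weak_gradient)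

lemma weak_gradient_0: "weak_gradient \<Omega> 0 = 0"
  by (intro weak_gradient_eqI has_weak_gradient_0)

lemma weak_gradient_diff:
  assumes "u \<in> H1_on \<Omega>" "v \<in> H1_on \<Omega>"
  shows "weak_gradient \<Omega> (u - v) = weak_gradient \<Omega> u - weak_gradient \<Omega> v"
  using weak_gradient_add[OF assms(1) subspace_scale[OF H1_on_subspace assms(2)], of "-1"]
    weak_gradient_scaleR[OF assms(2), of "-1"] by simp

text \<open>Allows test functions to be inserted into the weak heat equation, from which the weak
  Laplacian of the solution is read off later.\<close>

lemma test_function_H10:
  assumes "\<phi> \<in> test_functions \<Omega>"
  shows "abs_l2 \<phi> \<in> H10 \<Omega>" "weak_gradient \<Omega> (abs_l2 \<phi>) = abs_l2 (gradient \<phi>)"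
proof -
  note g = test_function_has_weak_gradient[OF assms]
  show eq: "weak_gradient \<Omega> (abs_l2 \<phi>) = abs_l2 (gradient \<phi>)" by (rule weak_gradient_eqI[OF g(2)])
  have "abs_l2 \<phi> \<in> H1_on \<Omega>" using g by (auto simp: H1_on_def)
  moreover have "(abs_l2 \<phi>, weak_gradient \<Omega> (abs_l2 \<phi>)) \<in>
      closure ((\<lambda>\<phi>. (abs_l2 \<phi>, abs_l2 (gradient \<phi>))) ` test_functions \<Omega>)"
    unfolding eq using assms by (intro closure_subset[THEN subsetD]) auto
  ultimately show "abs_l2 \<phi> \<in> H10 \<Omega>" by (simp add: H10_def)
qed

end

section \<open>Weak derivatives in time\<close>

abbreviation time_measure :: "real \<Rightarrow> real measure" where
  "time_measure T \<equiv> lebesgue_on {0<..<T}"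

lemma finite_measure_time: "finite_measure (time_measure T)"
  by (rule finite_measure_lebesgue_on) simp

text \<open>Passes from the Lebesgue integral over the open time interval to gauge integrals over
  closed subintervals, where splitting, translation and the fundamental theorem of calculus are at
  hand. End points are negligible.\<close>

lemma has_integral_time_measure:
  fixes f :: "real \<Rightarrow> real"
  assumes f: "integrable (time_measure T) f" and ab: "0 \<le> a" "b \<le> T"
  shows "(f has_integral (\<integral>t. indicator {a<..<b} t * f t \<partial>time_measure T)) {a..b}"
proof -
  have "integrable (time_measure T) (\<lambda>t. indicator {a<..<b} t *\<^sub>R f t)"
  proof (rule integrable_mult_indicator[OF _ f])
    show "{a<..<b} \<in> sets (time_measure T)" using ab by (auto simp: sets_restrict_space_iff)
  qed
  then have "((\<lambda>t. indicator {a<..<b} t * f t) has_integral (\<integral>t. indicator {a<..<b} t * f t \<partial>time_measure T)) {0<..<T}"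
    using has_integral_integral_lebesgue_on by (fastforce)
  moreover have "(\<lambda>t. indicator {a<..<b} t * f t) = (\<lambda>t. if t \<in> {a<..<b} then f t else 0)"
    by (auto simp: indicator_def)
  ultimately have "((\<lambda>t. if t \<in> {a<..<b} then f t else 0) has_integral
      (\<integral>t. indicator {a<..<b} t * f t \<partial>time_measure T)) {0<..<T}" by simp
  then have "(f has_integral (\<integral>t. indicator {a<..<b} t * f t \<partial>time_measure T)) {a<..<b}"
    by (subst (asm) has_integral_restrict) (use ab in auto)
  then show ?thesis by (simp add: has_integral_Icc_iff_Ioo)
qed

lemma has_integral_time_measure_full:
  fixes f :: "real \<Rightarrow> real"
  assumes "integrable (time_measure T) f"
  shows "(f has_integral (\<integral>t. f t \<partial>time_measure T)) {0..T}"
  using has_integral_integral_lebesgue_on[OF assms] by (simp add: has_integral_Icc_iff_Ioo)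

lemma continuous_measurable_time:
  fixes u :: "real \<Rightarrow> 'b::real_normed_vector"
  assumes "continuous_on {0..T} u" shows "u \<in> borel_measurable (time_measure T)"
proof -
  have "continuous_on {0<..<T} u" by (rule continuous_on_subset[OF assms]) auto
  then have "(\<lambda>t. indicator {0<..<T} t *\<^sub>R u t) \<in> borel_measurable borel"
    by (intro borel_measurable_continuous_on_indicator) auto
  then show ?thesis
    by (simp add: borel_measurable_restrict_space_iff measurable_completion)
qed

lemma square_integrable_mult_continuous:
  fixes f :: "real \<Rightarrow> 'b::{second_countable_topology, real_normed_vector}"
  assumes c: "continuous_on {0..T} c" and f: "square_integrable (time_measure T) f"
  shows "square_integrable (time_measure T) (\<lambda>t. c t *\<^sub>R f t)"
proof -
  have "bounded (c ` {0..T})" by (intro compact_imp_bounded compact_continuous_image c) simp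
  then obtain M where M: "\<And>t. t \<in> {0..T} \<Longrightarrow> \<bar>c t\<bar> \<le> M"
    unfolding bounded_iff by (metis imageI real_norm_def)
  show ?thesis
  proof (rule square_integrable_bound[OF f])
    show "(\<lambda>t. c t *\<^sub>R f t) \<in> borel_measurable (time_measure T)"
      by (intro borel_measurable_scaleR continuous_measurable_time c square_integrable_measurable f)
    show "AE t in time_measure T. norm (c t *\<^sub>R f t) \<le> M * norm (f t)"
      by (intro AE_I2) (auto intro!: mult_right_mono M)
  qed
qed

lemma continuous_square_integrable_time:
  fixes u :: "real \<Rightarrow> 'b::real_normed_vector"
  assumes "continuous_on {0..T} u" shows "square_integrable (time_measure T) u"
proof -
  have "bounded (u ` {0..T})" by (intro compact_imp_bounded compact_continuous_image assms) simp
  then obtain M where M: "\<And>t. t \<in> {0..T} \<Longrightarrow> norm (u t) \<le> M"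
    unfolding bounded_iff by (metis imageI)
  interpret finite_measure "time_measure T" by (rule finite_measure_time)
  show ?thesis
    by (rule square_integrable_bound[OF square_integrable_const[of "1 :: real"], of _ M])
       (auto intro!: AE_I2 M continuous_measurable_time assms)
qed

text \<open>The mass is 1 only eventually: for small \<open>n\<close> the end of
  \<open>{0..T}\<close> may cut off part of the kernel.\<close>

lemma approximate_identity:
  fixes k :: "nat \<Rightarrow> real \<Rightarrow> real"
  assumes U: "continuous_on {0..T} U" and c: "c \<in> {0..T}"
    and k: "\<And>n. continuous_on {0..T} (k n)" "\<And>n t. 0 \<le> k n t"
    and mass: "\<forall>\<^sub>F n in sequentially. integral {0..T} (k n) = 1"
    and conc: "\<And>n t. t \<in> {0..T} \<Longrightarrow> k n t \<noteq> 0 \<Longrightarrow> \<bar>t - c\<bar> < 1 / real (Suc n)"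
  shows "(\<lambda>n. integral {0..T} (\<lambda>t. k n t * U t)) \<longlonglongrightarrow> U c"
proof (rule tendstoI)
  fix e :: real assume e: "e > 0"
  obtain d where d: "d > 0" "\<And>t. t \<in> {0..T} \<Longrightarrow> \<bar>t - c\<bar> < d \<Longrightarrow> \<bar>U t - U c\<bar> < e / 2"
    using U c e unfolding continuous_on_iff dist_real_def by (metis half_gt_zero)
  obtain N :: nat where "1 / real (Suc N) < d" using nat_approx_posE[OF d(1)] .
  then have "\<forall>\<^sub>F n in sequentially. 1 / real (Suc n) < d"
    by (intro eventually_sequentiallyI[of N]) (auto intro: order_le_less_trans[rotated] simp: frac_le)
  with mass show "\<forall>\<^sub>F n in sequentially. dist (integral {0..T} (\<lambda>t. k n t * U t)) (U c) < e"
  proof eventually_elim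
    case (elim n)
    have i: "(\<lambda>t. k n t * U t) integrable_on {0..T}" "(k n) integrable_on {0..T}"
      "(\<lambda>t. k n t * (U t - U c)) integrable_on {0..T}"
      by (intro integrable_continuous_real continuous_intros k U)+
    have "integral {0..T} (\<lambda>t. k n t * (U t - U c)) = integral {0..T} (\<lambda>t. k n t * U t) - integral {0..T} (\<lambda>t. k n t * U c)"
      using i integrable_on_mult_left[OF i(2)]
      by (subst Henstock_Kurzweil_Integration.integral_diff[symmetric]) (auto simp: right_diff_distrib)
    also have "integral {0..T} (\<lambda>t. k n t * U c) = U c" using elim(1) by simp
    finally have "\<bar>integral {0..T} (\<lambda>t. k n t * U t) - U c\<bar> = norm (integral {0..T} (\<lambda>t. k n t * (U t - U c)))"
      by simp
    also have "\<dots> \<le> integral {0..T} (\<lambda>t. k n t * (e / 2))"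
    proof (rule integral_norm_bound_integral[OF i(3)])
      show "(\<lambda>t. k n t * (e / 2)) integrable_on {0..T}" using i(2) by (rule integrable_on_mult_left)
      show "norm (k n t * (U t - U c)) \<le> k n t * (e / 2)" if "t \<in> {0..T}" for t
      proof (cases "k n t = 0")
        case False
        then have "\<bar>U t - U c\<bar> \<le> e / 2" using d(2)[OF that] conc[OF that] elim(2) by fastforce
        then show ?thesis using k(2)[of n t] using mult_left_mono[of "\<bar>U t - U c\<bar>" "e / 2" "k n t"] by (simp add: abs_mult)
      qed simp
    qed
    also have "\<dots> < e" using elim(1) e by simp
    finally show ?case by (simp add: dist_real_def)
  qed
qed

lemma box_bump_real:
  "box_bump a b n t = step (real (Suc n) * (t - a)) * step (real (Suc n) * (b - t))" for t :: real
  by (simp add: box_bump_def)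

lemma step_affine_has_derivative:
  "((\<lambda>t. step (\<alpha> * (t - c))) has_real_derivative \<alpha> * (bump (\<alpha> * (t - c)) / bump_mass)) (at t within S)"
  by (rule DERIV_chain'[where f = "\<lambda>t. \<alpha> * (t - c)", OF _ has_field_derivative_at_within[OF step_has_derivative], THEN DERIV_cong])
     (auto intro!: derivative_eq_intros)

text \<open>The weak derivative is tested with the cut-off of \<open>{a..b}\<close>. For large
  \<open>n\<close> the derivative of the cut-off is a kernel concentrating at \<open>a\<close> minus
  one concentrating at \<open>b\<close>, so the left-hand side tends to \<open>U a - U b\<close>,
  while the right-hand side tends to minus the integral of \<open>V\<close> over the
  interval.\<close>

lemma primitive_real_interior:
  fixes U V :: "real \<Rightarrow> real"
  assumes U: "continuous_on {0..T} U" and V: "integrable (time_measure T) V"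
    and weak: "has_weak_time_derivative T U V" and ab: "0 < a" "a < b" "b < T"
  shows "(V has_integral (U b - U a)) {a..b}"
proof -
  let ?N = "\<lambda>n. real (Suc n)"
  let ?k = "\<lambda>c n t. ?N n * (bump (?N n * (t - c)) / bump_mass)"
  let ?l = "\<lambda>c n t. ?N n * (bump (?N n * (c - t)) / bump_mass)"
  let ?\<phi> = "box_bump a b"
  \<comment> \<open>Three thresholds for \<open>n\<close>: the kernel right of \<open>a\<close> must
    fit below \<open>T\<close>, the kernel left of \<open>b\<close> must fit above 0, and the two
    transition layers must be disjoint, for which each may occupy at most half of
    \<open>b - a\<close>.\<close>
  have Ta: "0 < T - a" and b0: "0 < b" and ba: "0 < (b - a) / 2" using ab by auto
  have large: "\<forall>\<^sub>F n in sequentially. 1 \<le> ?N n * d" if "d > 0" for d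
  proof -
    obtain N :: nat where "1 / real (Suc N) < d" using nat_approx_posE[OF \<open>d > 0\<close>] .
    then have "1 \<le> real (Suc N) * d" by (simp add: field_simps)
    moreover have "real (Suc N) * d \<le> ?N n * d" if "n \<ge> N" for n
      using that \<open>d > 0\<close> by simp
    ultimately show ?thesis by (intro eventually_sequentiallyI[of N]) (meson order_trans)
  qed
  have D1: "((\<lambda>t. step (?N n * (t - c))) has_real_derivative ?k c n t) (at t within S)" for n c t S
    by (rule step_affine_has_derivative)
  have D2: "((\<lambda>t. step (?N n * (c - t))) has_real_derivative - ?l c n t) (at t within S)" for n c t S
    using step_affine_has_derivative[of "- ?N n" c t S]
    by (simp only: minus_mult_minus minus_mult_left[symmetric] minus_mult_right minus_diff_eq)
  have limk: "(\<lambda>n. integral {0..T} (\<lambda>t. ?k a n t * U t)) \<longlonglongrightarrow> U a"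
  proof (rule approximate_identity[OF U])
    show "a \<in> {0..T}" using ab by auto
    show "continuous_on {0..T} (?k a n)" for n
      using bump_mass_pos by (auto intro!: continuous_intros continuous_on_compose2[OF continuous_bump[of UNIV]])
    show "0 \<le> ?k a n t" for n t by (simp add: bump_nonneg bump_mass_pos less_imp_le)
    show "\<bar>t - a\<bar> < 1 / ?N n" if "?k a n t \<noteq> 0" for n t
    proof -
      have "?N n * (t - a) \<in> {0<..<1}" using that bump_eq_0 by force
      then have "0 < t - a" "t - a < 1 / ?N n" by (auto simp: zero_less_mult_iff field_simps simp del: of_nat_Suc)
      then show ?thesis by simp
    qed
    show "\<forall>\<^sub>F n in sequentially. integral {0..T} (?k a n) = 1"
      using large[OF Ta]
    proof eventually_elim
      case (elim n)
      have "(?k a n has_integral step (?N n * (T - a)) - step (?N n * (0 - a))) {0..T}"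
        using ab D1 by (intro fundamental_theorem_of_calculus)
          (auto simp: has_real_derivative_iff_has_vector_derivative[symmetric])
      moreover have "step (?N n * (T - a)) = 1" using elim by (intro step_eq_1) (use ab in auto)
      moreover have "step (?N n * (0 - a)) = 0" using ab by (intro step_eq_0) (simp add: mult_nonneg_nonpos)
      ultimately have "(?k a n has_integral 1) {0..T}" by (simp only: diff_zero)
      then show ?case by (rule integral_unique)
    qed
  qed
  have liml: "(\<lambda>n. integral {0..T} (\<lambda>t. ?l b n t * U t)) \<longlonglongrightarrow> U b"
  proof (rule approximate_identity[OF U])
    show "b \<in> {0..T}" using ab by auto
    show "continuous_on {0..T} (?l b n)" for n
      using bump_mass_pos by (auto intro!: continuous_intros continuous_on_compose2[OF continuous_bump[of UNIV]])
    show "0 \<le> ?l b n t" for n t by (simp add: bump_nonneg bump_mass_pos less_imp_le)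
    show "\<bar>t - b\<bar> < 1 / ?N n" if "?l b n t \<noteq> 0" for n t
    proof -
      have "?N n * (b - t) \<in> {0<..<1}" using that bump_eq_0 by force
      then have "0 < b - t" "b - t < 1 / ?N n" by (auto simp: zero_less_mult_iff field_simps simp del: of_nat_Suc)
      then show ?thesis by simp
    qed
    show "\<forall>\<^sub>F n in sequentially. integral {0..T} (?l b n) = 1"
      using large[OF b0]
    proof eventually_elim
      case (elim n)
      have "(?l b n has_integral - step (?N n * (b - T)) - - step (?N n * (b - 0))) {0..T}"
        using ab DERIV_minus[OF D2] by (intro fundamental_theorem_of_calculus)
          (auto simp: has_real_derivative_iff_has_vector_derivative[symmetric])
      moreover have "step (?N n * (b - 0)) = 1" using elim by (intro step_eq_1) (use ab in auto)
      moreover have "step (?N n * (b - T)) = 0" using ab by (intro step_eq_0) (simp add: mult_nonneg_nonpos)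
      ultimately have "(?l b n has_integral 1) {0..T}" by (simp only: minus_zero diff_0 minus_minus)
      then show ?case by (rule integral_unique)
    qed
  qed
  have "\<forall>\<^sub>F n in sequentially. integral {0..T} (\<lambda>t. ?k a n t * U t) - integral {0..T} (\<lambda>t. ?l b n t * U t)
      = - (\<integral>t. ?\<phi> n t * V t \<partial>time_measure T)"
    using large[OF ba]
  proof eventually_elim
    case (elim n)
    have big: "2 \<le> ?N n * (b - a)" using elim by (simp add: field_simps)
    have split: "?N n * (b - t) = ?N n * (b - a) - ?N n * (t - a)" for t by (simp add: algebra_simps)
    have deriv: "deriv (?\<phi> n) t = ?k a n t - ?l b n t" for t
    proof -
      have "(?\<phi> n has_real_derivative ?k a n t * step (?N n * (b - t)) - ?l b n t * step (?N n * (t - a))) (at t)"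
        unfolding box_bump_real[abs_def]
        by (rule DERIV_cong[OF DERIV_mult[OF D1 D2]]) simp
      \<comment> \<open>Where one factor of the cut-off varies, the other is already 1.\<close>
      moreover have "?k a n t * step (?N n * (b - t)) = ?k a n t"
      proof (cases "?N n * (t - a) \<in> {0<..<1}")
        case True
        then have "step (?N n * (b - t)) = 1" using big split[of t]
          unfolding greaterThanLessThan_iff by (intro step_eq_1) linarith
        then show ?thesis by simp
      qed (simp add: bump_eq_0)
      moreover have "?l b n t * step (?N n * (t - a)) = ?l b n t"
      proof (cases "?N n * (b - t) \<in> {0<..<1}")
        case True
        then have "step (?N n * (t - a)) = 1" using big split[of t]
          unfolding greaterThanLessThan_iff by (intro step_eq_1) linarith
        then show ?thesis by simp
      qed (simp add: bump_eq_0)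
      ultimately have "(?\<phi> n has_real_derivative ?k a n t - ?l b n t) (at t)" by (simp only:)
      then show ?thesis by (rule DERIV_imp_deriv)
    qed
    have c: "continuous_on {0..T} (\<lambda>t. ?k a n t * U t)" "continuous_on {0..T} (\<lambda>t. ?l b n t * U t)"
      using bump_mass_pos by (auto intro!: continuous_intros U continuous_on_compose2[OF continuous_bump[of UNIV]])
    interpret finite_measure "time_measure T" by (rule finite_measure_time)
    note i = c[THEN continuous_square_integrable_time, THEN square_integrable_integrable]
    have "?\<phi> n \<in> test_functions {0<..<T}"
      by (rule box_bump_test_function) (use ab in auto)
    with weak have "(\<integral>t. deriv (?\<phi> n) t *\<^sub>R U t \<partial>time_measure T) = - (\<integral>t. ?\<phi> n t *\<^sub>R V t \<partial>time_measure T)"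
      unfolding has_weak_time_derivative_def by blast
    moreover have "(\<integral>t. deriv (?\<phi> n) t *\<^sub>R U t \<partial>time_measure T) =
        (\<integral>t. ?k a n t * U t \<partial>time_measure T) - (\<integral>t. ?l b n t * U t \<partial>time_measure T)"
      unfolding deriv using i by (simp add: left_diff_distrib del: of_nat_Suc)
    ultimately show ?case
      by (simp only: real_scaleR_def has_integral_time_measure_full[OF i(1), THEN integral_unique]
          has_integral_time_measure_full[OF i(2), THEN integral_unique])
  qed
  moreover have "(\<lambda>n. \<integral>t. ?\<phi> n t * V t \<partial>time_measure T) \<longlonglongrightarrow> (\<integral>t. indicator {a<..<b} t * V t \<partial>time_measure T)"
  proof (rule integral_dominated_convergence)
    show "integrable (time_measure T) (\<lambda>t. \<bar>V t\<bar>)" using V by simp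
    show "AE t in time_measure T. (\<lambda>n. ?\<phi> n t * V t) \<longlonglongrightarrow> indicator {a<..<b} t * V t"
      using box_bump_tendsto[of a b] by (intro AE_I2 tendsto_intros) (simp add: box_real)
    show "AE t in time_measure T. norm (?\<phi> n t * V t) \<le> \<bar>V t\<bar>" for n
      using box_bump_bounds[of a b n] by (intro AE_I2) (auto simp: abs_mult intro!: mult_left_le_one_le)
    have "?\<phi> n \<in> borel_measurable (time_measure T)" for n
      using test_functions_continuous(1)[OF box_bump_test_function[of a b UNIV n]]
      by (intro continuous_measurable_time) (auto intro: continuous_on_subset)
    then show "(\<lambda>t. ?\<phi> n t * V t) \<in> borel_measurable (time_measure T)" for n
      using borel_measurable_integrable[OF V] by (intro borel_measurable_times)
    have "{a<..<b} \<in> sets (time_measure T)" using ab by (auto simp: sets_restrict_space_iff)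
    then show "(\<lambda>t. indicator {a<..<b} t * V t) \<in> borel_measurable (time_measure T)"
      using borel_measurable_integrable[OF V] by (intro borel_measurable_times borel_measurable_indicator)
  qed
  ultimately have "(\<lambda>n. integral {0..T} (\<lambda>t. ?k a n t * U t) - integral {0..T} (\<lambda>t. ?l b n t * U t))
      \<longlonglongrightarrow> - (\<integral>t. indicator {a<..<b} t * V t \<partial>time_measure T)"
    by (intro Lim_transform_eventually[OF tendsto_minus]) (auto elim!: eventually_mono)
  with tendsto_diff[OF limk liml] have "U a - U b = - (\<integral>t. indicator {a<..<b} t * V t \<partial>time_measure T)"
    by (rule LIMSEQ_unique)
  then have "(\<integral>t. indicator {a<..<b} t * V t \<partial>time_measure T) = U b - U a" by simp
  then show ?thesis
    using has_integral_time_measure[OF V, of a b] ab by simp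
qed

text \<open>\<open>U - G\<close> is constant on the open interval by the interior case; both
  functions are continuous up to the end points, which extends the identity to \<open>a = 0\<close>
  and \<open>b = T\<close>.\<close>

lemma primitive_real:
  fixes U V :: "real \<Rightarrow> real"
  assumes U: "continuous_on {0..T} U" and V: "integrable (time_measure T) V"
    and weak: "has_weak_time_derivative T U V" and ab: "0 \<le> a" "a \<le> b" "b \<le> T" and T: "0 < T"
  shows "(V has_integral (U b - U a)) {a..b}"
proof -
  have int: "V integrable_on {0..T}" using has_integral_time_measure_full[OF V] by auto
  define G where "G t = integral {0..t} V" for t
  have G: "(V has_integral (G y - G x)) {x..y}" if "0 \<le> x" "x \<le> y" "y \<le> T" for x y
  proof -
    have "V integrable_on {0..y}" "V integrable_on {x..y}"
      using int that by (auto intro: integrable_on_subinterval)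
    have "integral {0..x} V + integral {x..y} V = integral {0..y} V"
      by (rule Henstock_Kurzweil_Integration.integral_combine) (use that \<open>V integrable_on {0..y}\<close> in auto)
    then have "G y - G x = integral {x..y} V" by (simp add: G_def)
    with \<open>V integrable_on {x..y}\<close> show ?thesis by (simp add: integrable_integral)
  qed
  have key: "U y - U x = G y - G x" if "0 < x" "x < y" "y < T" for x y
    using primitive_real_interior[OF U V weak that] G[of x y] that by (intro has_integral_unique) auto
  have "U x - G x = U (T / 2) - G (T / 2)" if "x \<in> closure {0<..<T}" for x
  proof (rule continuous_constant_on_closure[OF _ _ that])
    show "continuous_on (closure {0<..<T}) (\<lambda>x. U x - G x)"
      unfolding G_def using T int by (auto intro!: continuous_intros U indefinite_integral_continuous_1)
    fix x assume "x \<in> {0<..<T}"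
    then consider "x = T / 2" | "x < T / 2" "0 < x" | "T / 2 < x" "x < T" by fastforce
    then show "U x - G x = U (T / 2) - G (T / 2)"
    proof cases
      case 1
      then show ?thesis by (simp only:)
    next
      case 2
      then show ?thesis using key[of x "T / 2"] T by simp
    next
      case 3
      then show ?thesis using key[of "T / 2" x] T by simp
    qed
  qed
  from this[of a] this[of b] have "U b - U a = G b - G a" using ab T by simp
  then show ?thesis using G[OF ab] by (simp only:)
qed

text \<open>An inner product with a fixed vector commutes with the Bochner integral. This reduces
  Hilbert-valued curves to real functions.\<close>

lemma has_weak_time_derivative_inner:
  fixes u v :: "real \<Rightarrow> 'b::{second_countable_topology, real_inner, banach}"
  assumes u: "square_integrable (time_measure T) u" and v: "square_integrable (time_measure T) v"
    and weak: "has_weak_time_derivative T u v"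
  shows "has_weak_time_derivative T (\<lambda>t. u t \<bullet> y) (\<lambda>t. v t \<bullet> y)"
  unfolding has_weak_time_derivative_def
proof
  fix \<phi> :: "real \<Rightarrow> real" assume \<phi>: "\<phi> \<in> test_functions {0<..<T}"
  interpret finite_measure "time_measure T" by (rule finite_measure_time)
  have "deriv \<phi> = (\<lambda>t. frechet_derivative \<phi> (at t) 1)"
  proof
    fix t
    have "(\<phi> has_derivative frechet_derivative \<phi> (at t)) (at t)" by (rule test_functions_has_derivative[OF \<phi>])
    moreover have "frechet_derivative \<phi> (at t) = (*) (frechet_derivative \<phi> (at t) 1)"
    proof
      fix r :: real
      have "frechet_derivative \<phi> (at t) (r *\<^sub>R 1) = r *\<^sub>R frechet_derivative \<phi> (at t) 1"
        by (rule linear_cmul[OF has_derivative_linear[OF test_functions_has_derivative[OF \<phi>]]])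
      then show "frechet_derivative \<phi> (at t) r = frechet_derivative \<phi> (at t) 1 * r"
        by (simp add: mult.commute)
    qed
    ultimately show "deriv \<phi> t = frechet_derivative \<phi> (at t) 1"
      by (metis DERIV_imp_deriv has_field_derivative_def)
  qed
  then have c: "continuous_on {0..T} \<phi>" "continuous_on {0..T} (deriv \<phi>)"
    using test_functions_continuous[OF \<phi>] by (auto intro: continuous_on_subset)
  note i = square_integrable_integrable[OF square_integrable_mult_continuous[OF c(1) v]]
    square_integrable_integrable[OF square_integrable_mult_continuous[OF c(2) u]]
  have "(\<integral>t. deriv \<phi> t *\<^sub>R (u t \<bullet> y) \<partial>time_measure T) = (\<integral>t. deriv \<phi> t *\<^sub>R u t \<partial>time_measure T) \<bullet> y"
    by (subst integral_inner_left[symmetric]) (use i in simp_all)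
  also have "\<dots> = - (\<integral>t. \<phi> t *\<^sub>R v t \<partial>time_measure T) \<bullet> y"
    using weak \<phi> by (simp add: has_weak_time_derivative_def)
  also have "\<dots> = - (\<integral>t. \<phi> t *\<^sub>R (v t \<bullet> y) \<partial>time_measure T)"
    by (simp, subst integral_inner_left[symmetric]) (use i in simp_all)
  finally show "(\<integral>t. deriv \<phi> t *\<^sub>R (u t \<bullet> y) \<partial>time_measure T) = - (\<integral>t. \<phi> t *\<^sub>R (v t \<bullet> y) \<partial>time_measure T)" .
qed

text \<open>The relation \<open>u b - u a = \<integral> v\<close>, tested with every
  \<open>y\<close> so that only real integrals occur.\<close>

definition is_primitive :: "real \<Rightarrow> (real \<Rightarrow> 'b::real_inner) \<Rightarrow> (real \<Rightarrow> 'b) \<Rightarrow> bool" where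
  "is_primitive T u v \<longleftrightarrow>
     (\<forall>y a b. 0 \<le> a \<longrightarrow> a \<le> b \<longrightarrow> b \<le> T \<longrightarrow> ((\<lambda>t. v t \<bullet> y) has_integral ((u b - u a) \<bullet> y)) {a..b})"

lemma is_primitive_weak_derivative:
  fixes u v :: "real \<Rightarrow> 'b::{second_countable_topology, real_inner, banach}"
  assumes T: "0 < T" and u: "continuous_on {0..T} u" and v: "square_integrable (time_measure T) v"
    and weak: "has_weak_time_derivative T u v"
  shows "is_primitive T u v"
  unfolding is_primitive_def inner_diff_left
proof (intro allI impI)
  interpret finite_measure "time_measure T" by (rule finite_measure_time)
  fix y a b assume "0 \<le> a" "a \<le> b" "b \<le> T"
  then show "((\<lambda>t. v t \<bullet> y) has_integral (u b \<bullet> y - u a \<bullet> y)) {a..b}"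
    using T by (intro primitive_real[of T "\<lambda>t. u t \<bullet> y"]
        has_weak_time_derivative_inner continuous_square_integrable_time u v weak
        square_integrable_integrable square_integrable_inner_const) (auto intro!: continuous_intros u)
qed

lemma is_primitive_diff:
  "is_primitive T u v \<Longrightarrow> is_primitive T u' v' \<Longrightarrow> is_primitive T (\<lambda>t. u t - u' t) (\<lambda>t. v t - v' t)"
  unfolding is_primitive_def inner_diff_left
proof (intro allI impI)
  fix y a b assume "0 \<le> a" "a \<le> b" "b \<le> T"
    and u: "\<forall>y a b. 0 \<le> a \<longrightarrow> a \<le> b \<longrightarrow> b \<le> T \<longrightarrow> ((\<lambda>t. v t \<bullet> y) has_integral u b \<bullet> y - u a \<bullet> y) {a..b}"
    "\<forall>y a b. 0 \<le> a \<longrightarrow> a \<le> b \<longrightarrow> b \<le> T \<longrightarrow> ((\<lambda>t. v' t \<bullet> y) has_integral u' b \<bullet> y - u' a \<bullet> y) {a..b}"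
  then have "((\<lambda>t. v t \<bullet> y - v' t \<bullet> y) has_integral (u b \<bullet> y - u a \<bullet> y) - (u' b \<bullet> y - u' a \<bullet> y)) {a..b}"
    by (intro has_integral_diff) auto
  then show "((\<lambda>t. v t \<bullet> y - v' t \<bullet> y) has_integral u b \<bullet> y - u' b \<bullet> y - (u a \<bullet> y - u' a \<bullet> y)) {a..b}"
    by (simp add: algebra_simps)
qed

text \<open>The difference of two derivatives has integral 0 over every interval in every direction,
  so it is orthogonal to all indicators and \<open>weakly_null\<close> applies with the difference
  as its own test function.\<close>

lemma is_primitive_unique:
  fixes v w :: "real \<Rightarrow> 'b::{second_countable_topology, real_inner, banach}"
  assumes "is_primitive T u v" "is_primitive T u w"
    and v: "square_integrable (time_measure T) v" and w: "square_integrable (time_measure T) w"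
  shows "AE t in time_measure T. v t = w t"
proof -
  interpret finite_measure "time_measure T" by (rule finite_measure_time)
  note vw = square_integrable_diff[OF v w]
  have "(\<lambda>n::nat. \<integral>t. (v t - w t) \<bullet> (v t - w t) \<partial>time_measure T) \<longlonglongrightarrow> 0"
  proof (rule weakly_null[OF _ _ vw order_refl _ vw])
    fix a b :: real and y :: 'b assume "cbox a b \<subseteq> {0<..<T}"
    show "(\<lambda>n::nat. \<integral>t. indicator (box a b) t *\<^sub>R y \<bullet> (v t - w t) \<partial>time_measure T) \<longlonglongrightarrow> 0"
    proof (cases "a \<le> b")
      case True
      then have ab: "0 \<le> a" "b \<le> T" using \<open>cbox a b \<subseteq> {0<..<T}\<close> by auto
      have i: "integrable (time_measure T) (\<lambda>t. (v t - w t) \<bullet> y)"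
        by (rule square_integrable_integrable[OF square_integrable_inner_const[OF vw]])
      have "((\<lambda>t. (v t - w t) \<bullet> y) has_integral ((u b - u a) - (u b - u a)) \<bullet> y) {a..b}"
        using assms(1,2) True ab unfolding is_primitive_def inner_diff_left
        by (intro has_integral_diff) auto
      then have "(\<integral>t. indicator {a<..<b} t * ((v t - w t) \<bullet> y) \<partial>time_measure T) = 0"
        using has_integral_unique[OF has_integral_time_measure[OF i ab]] by simp
      then show ?thesis by (simp add: box_real inner_commute)
    qed (simp add: box_real)
  qed auto
  then have "(\<integral>t. (v t - w t) \<bullet> (v t - w t) \<partial>time_measure T) = 0" by (simp add: LIMSEQ_const_iff)
  then show ?thesis
    using integral_nonneg_eq_0_iff_AE[OF square_integrable_inner[OF vw vw]] by simp
qed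

section \<open>Symmetric kernels on periodic curves\<close>

text \<open>Cauchy-Schwarz on \<open>{a..b}\<close> in Young form with \<open>y = u b - u a\<close>
  and weight \<open>d = b - a\<close>: integration leaves half of \<open>(norm y)^2\<close> on the
  right-hand side, which is absorbed on the left.\<close>

lemma norm_sq_primitive_le:
  fixes u v :: "real \<Rightarrow> 'b::{second_countable_topology, real_inner}"
  assumes prim: "is_primitive T u v" and v: "square_integrable (time_measure T) v"
    and ab: "0 \<le> a" "a \<le> b" "b \<le> T"
  shows "(norm (u b - u a))\<^sup>2 \<le> (b - a) * integral {a..b} (\<lambda>t. (norm (v t))\<^sup>2)"
proof (cases "a = b")
  case False
  define y where "y = u b - u a"
  define d where "d = b - a"
  have d: "d > 0" using False ab by (simp add: d_def)
  have "(\<lambda>t. (norm (v t))\<^sup>2) integrable_on {0..T}"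
    using has_integral_time_measure_full[OF square_integrable_norm_sq[OF v]] by auto
  then have int: "(\<lambda>t. (norm (v t))\<^sup>2) integrable_on {a..b}"
    using ab by (auto intro: integrable_on_subinterval)
  have "((\<lambda>t. v t \<bullet> y) has_integral (norm y)\<^sup>2) {a..b}"
    using prim ab unfolding is_primitive_def y_def power2_norm_eq_inner by blast
  moreover have "((\<lambda>t. d / 2 * (norm (v t))\<^sup>2 + (norm y)\<^sup>2 / (2 * d)) has_integral
      d / 2 * integral {a..b} (\<lambda>t. (norm (v t))\<^sup>2) + (b - a) *\<^sub>R ((norm y)\<^sup>2 / (2 * d))) {a..b}"
    using int ab by (intro has_integral_add has_integral_mult_right integrable_integral has_integral_const_real[where c = "(norm y)\<^sup>2 / (2 * d)", THEN has_integral_eq_rhs]) auto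
  moreover have "v t \<bullet> y \<le> d / 2 * (norm (v t))\<^sup>2 + (norm y)\<^sup>2 / (2 * d)" for t
  proof -
    have "2 * d * (v t \<bullet> y) \<le> (d * norm (v t))\<^sup>2 + (norm y)\<^sup>2"
    proof -
      have "2 * d * (v t \<bullet> y) \<le> 2 * d * (norm (v t) * norm y)"
        using d by (intro mult_left_mono norm_cauchy_schwarz) auto
      also have "\<dots> \<le> (d * norm (v t))\<^sup>2 + (norm y)\<^sup>2"
        using sum_squares_bound[of "d * norm (v t)" "norm y"] by (simp add: mult.assoc)
      finally show ?thesis .
    qed
    then show ?thesis using d by (simp add: field_simps power2_eq_square)
  qed
  ultimately have "(norm y)\<^sup>2 \<le> d / 2 * integral {a..b} (\<lambda>t. (norm (v t))\<^sup>2) + (b - a) *\<^sub>R ((norm y)\<^sup>2 / (2 * d))"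
    by (rule has_integral_le)
  then show ?thesis using d by (simp add: y_def[symmetric] d_def[symmetric])
qed simp

text \<open>Translation of the periodic extension by \<open>c\<close> between 0 and
  \<open>T\<close>. A translation by \<open>- s\<close> is expressed as one by
  \<open>T - s\<close>.\<close>

definition periodic_shift :: "real \<Rightarrow> (real \<Rightarrow> 'b) \<Rightarrow> real \<Rightarrow> real \<Rightarrow> 'b" where
  "periodic_shift T u c t = (if t + c \<le> T then u (t + c) else u (t + c - T))"

lemma continuous_periodic_shift:
  fixes u :: "real \<Rightarrow> 'b::topological_space"
  assumes u: "continuous_on {0..T} u" and per: "u 0 = u T" and c: "0 \<le> c" "c \<le> T"
  shows "continuous_on {0..T} (periodic_shift T u c)"
  unfolding periodic_shift_def
proof (rule continuous_on_cases_le)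
  show "continuous_on {t \<in> {0..T}. t + c \<le> T} (\<lambda>t. u (t + c))"
    by (rule continuous_on_compose2[OF u]) (use c in \<open>auto intro!: continuous_intros\<close>)
  show "continuous_on {t \<in> {0..T}. T \<le> t + c} (\<lambda>t. u (t + c - T))"
    by (rule continuous_on_compose2[OF u]) (use c in \<open>auto intro!: continuous_intros\<close>)
qed (auto intro!: continuous_intros simp: per)

lemma has_integral_shift:
  fixes f :: "real \<Rightarrow> real"
  assumes "(f has_integral i) {a + c..b + c}"
  shows "((\<lambda>t. f (t + c)) has_integral i) {a..b}"
  using has_integral_affinity'[of f i "a + c" "b + c" 1 c] assms by simp

lemma negligible_time_AE:
  assumes "AE t in time_measure T. P t"
  shows "negligible {t \<in> {0..T}. \<not> P t}"
proof -
  have "AE t in lebesgue. t \<in> {0<..<T} \<longrightarrow> P t"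
    using assms by (simp add: AE_restrict_space_iff)
  then obtain N where N: "{t. \<not> (t \<in> {0<..<T} \<longrightarrow> P t)} \<subseteq> N" "N \<in> null_sets lebesgue"
    unfolding eventually_ae_filter by auto
  have "negligible (N \<union> {0, T})" using N(2) by (auto simp: negligible_iff_null_sets[symmetric] intro: negligible_Un)
  then show ?thesis 
  proof (rule negligible_subset)
    show "{t \<in> {0..T}. \<not> P t} \<subseteq> N \<union> {0, T}"
    proof
      fix t assume "t \<in> {t \<in> {0..T}. \<not> P t}"
      then show "t \<in> N \<union> {0, T}" using N(1) by (cases "t = 0 \<or> t = T") auto
    qed
  qed
qed

text \<open>This is the evenness of the pairing in the shift: substituting \<open>t + c\<close> for
  \<open>t\<close> gives \<open>g (t + c)\<close> paired with \<open>u t\<close>, which symmetry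
  turns into \<open>g t\<close> paired with \<open>u (t + c)\<close>. The wrap at \<open>T\<close>
  divides each integral into two pieces, and the substitution exchanges the first piece for
  \<open>c\<close> with the second for \<open>T - c\<close> and vice versa.\<close>

lemma integral_periodic_shift_symmetric:
  fixes g u :: "real \<Rightarrow> 'b::{second_countable_topology, real_inner, banach}"
  assumes u: "continuous_on {0..T} u" and per: "u 0 = u T"
    and g: "square_integrable (time_measure T) g" and c: "0 \<le> c" "c \<le> T"
    and E: "AE t in time_measure T. t \<in> E"
    and sym: "\<And>t r. t \<in> E \<Longrightarrow> r \<in> E \<Longrightarrow> g t \<bullet> u r = g r \<bullet> u t"
  shows "(\<integral>t. g t \<bullet> periodic_shift T u c t \<partial>time_measure T) = (\<integral>t. g t \<bullet> periodic_shift T u (T - c) t \<partial>time_measure T)"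
proof -
  define N where "N = {t \<in> {0..T}. t \<notin> E}"
  have N: "negligible N" unfolding N_def by (rule negligible_time_AE[OF E])
  have split: "\<exists>A. ((\<lambda>t. g t \<bullet> u (t + c)) has_integral A) {0..T - c} \<and>
      ((\<lambda>t. g t \<bullet> u (t + c - T)) has_integral (\<integral>t. g t \<bullet> periodic_shift T u c t \<partial>time_measure T) - A) {T - c..T}"
    if c: "0 \<le> c" "c \<le> T" for c
  proof -
    let ?f = "\<lambda>t. g t \<bullet> periodic_shift T u c t"
    have f: "(?f has_integral (\<integral>t. ?f t \<partial>time_measure T)) {0..T}"
      by (intro has_integral_time_measure_full square_integrable_inner g continuous_square_integrable_time
          continuous_periodic_shift u per c)
    then have "?f integrable_on {0..T - c}" "?f integrable_on {T - c..T}"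
      using c by (auto intro: integrable_on_subinterval)
    then have i: "(?f has_integral integral {0..T - c} ?f) {0..T - c}" "(?f has_integral integral {T - c..T} ?f) {T - c..T}"
      by (auto intro: integrable_integral)
    have "((\<lambda>t. g t \<bullet> u (t + c)) has_integral integral {0..T - c} ?f) {0..T - c}"
      by (rule has_integral_eq[OF _ i(1)]) (auto simp: periodic_shift_def)
    moreover have "((\<lambda>t. g t \<bullet> u (t + c - T)) has_integral integral {T - c..T} ?f) {T - c..T}"
    proof (rule has_integral_spike[OF _ _ i(2)])
      show "negligible {T - c}" by simp
    qed (auto simp: periodic_shift_def)
    moreover have "integral {0..T - c} ?f + integral {T - c..T} ?f = (\<integral>t. ?f t \<partial>time_measure T)"
      using Henstock_Kurzweil_Integration.integral_combine[of 0 "T - c" T ?f] f c by (auto simp: integral_unique has_integral_integrable)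
    then have eq: "integral {T - c..T} ?f = (\<integral>t. ?f t \<partial>time_measure T) - integral {0..T - c} ?f" by simp
    ultimately show ?thesis by (intro exI[of _ "integral {0..T - c} ?f"]) (simp only: eq)
  qed
  have swap: "((\<lambda>t. g t \<bullet> u (t + c)) has_integral B) {0..T - c}"
    if B: "((\<lambda>t. g t \<bullet> u (t - c)) has_integral B) {c..T}" and c: "0 \<le> c" "c \<le> T" for c B
  proof (rule has_integral_spike)
    show "((\<lambda>t. g (t + c) \<bullet> u (t + c - c)) has_integral B) {0..T - c}"
      by (rule has_integral_shift) (use B in simp)
    \<comment> \<open>Both \<open>t\<close> and \<open>t + c\<close> have to be times in
      \<open>E\<close>, so the null set is removed together with its translate.\<close>
    show "negligible (N \<union> (+) (- c) ` N)" using N by (intro negligible_Un negligible_translation)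
    fix t assume t: "t \<in> {0..T - c} - (N \<union> (+) (- c) ` N)"
    then have "t \<in> E" using c by (auto simp: N_def)
    moreover have "t + c \<notin> N"
    proof
      assume "t + c \<in> N"
      then have "- c + (t + c) \<in> (+) (- c) ` N" by (rule imageI)
      then show False using t by simp
    qed
    then have "t + c \<in> E" using t c by (auto simp: N_def)
    ultimately show "g t \<bullet> u (t + c) = g (t + c) \<bullet> u (t + c - c)" using sym by simp
  qed
  let ?I = "\<lambda>c. \<integral>t. g t \<bullet> periodic_shift T u c t \<partial>time_measure T"
  obtain A where A: "((\<lambda>t. g t \<bullet> u (t + c)) has_integral A) {0..T - c}"
      "((\<lambda>t. g t \<bullet> u (t + c - T)) has_integral ?I c - A) {T - c..T}"
    using split[OF c] by auto
  obtain A' where A': "((\<lambda>t. g t \<bullet> u (t + (T - c))) has_integral A') {0..T - (T - c)}"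
      "((\<lambda>t. g t \<bullet> u (t + (T - c) - T)) has_integral ?I (T - c) - A') {T - (T - c)..T}"
    using split[of "T - c"] c by auto
  have "((\<lambda>t. g t \<bullet> u (t + c)) has_integral ?I (T - c) - A') {0..T - c}"
    by (rule swap) (use A'(2) c in simp_all)
  then have "A = ?I (T - c) - A'" using A(1) by (rule has_integral_unique[rotated])
  moreover have "((\<lambda>t. g t \<bullet> u (t + (T - c))) has_integral ?I c - A) {0..T - (T - c)}"
    by (rule swap) (use A(2) c in \<open>simp_all add: algebra_simps\<close>)
  then have "A' = ?I c - A" using A'(1) by (rule has_integral_unique[rotated])
  ultimately show ?thesis by simp
qed

text \<open>Away from the ends the squared difference is at most \<open>2 * s\<close> times the
  energy of \<open>v\<close> between \<open>t - s\<close> and \<open>t + s\<close>; integrating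
  these energies telescopes and contributes \<open>4 * s^2\<close>. Each of the two end pieces has
  length \<open>s\<close> and is bounded crudely by \<open>6 * s\<close> times the energy, so the
  total is \<open>4 + 6 + 6 = 16\<close>.\<close>

lemma periodic_shift_difference_bound:
  fixes u v :: "real \<Rightarrow> 'b::{second_countable_topology, real_inner, banach}"
  assumes prim: "is_primitive T u v" and v: "square_integrable (time_measure T) v"
    and u: "continuous_on {0..T} u" and per: "u 0 = u T" and s: "0 < s" "2 * s < T"
  shows "(\<integral>t. (norm (periodic_shift T u s t - periodic_shift T u (T - s) t))\<^sup>2 \<partial>time_measure T)
    \<le> 16 * s\<^sup>2 * (\<integral>t. (norm (v t))\<^sup>2 \<partial>time_measure T)"
proof -
  define \<Phi> where "\<Phi> = (\<integral>t. (norm (v t))\<^sup>2 \<partial>time_measure T)"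
  define F where "F t = integral {0..t} (\<lambda>t. (norm (v t))\<^sup>2)" for t
  define D where "D t = (norm (periodic_shift T u s t - periodic_shift T u (T - s) t))\<^sup>2" for t
  have hi: "((\<lambda>t. (norm (v t))\<^sup>2) has_integral \<Phi>) {0..T}"
    unfolding \<Phi>_def by (rule has_integral_time_measure_full[OF square_integrable_norm_sq[OF v]])
  then have int: "(\<lambda>t. (norm (v t))\<^sup>2) integrable_on {a..b}" if "0 \<le> a" "b \<le> T" for a b
    using that by (auto intro: integrable_on_subinterval)
  have F: "integral {a..b} (\<lambda>t. (norm (v t))\<^sup>2) = F b - F a" if "0 \<le> a" "a \<le> b" "b \<le> T" for a b
  proof -
    have "integral {0..a} (\<lambda>t. (norm (v t))\<^sup>2) + integral {a..b} (\<lambda>t. (norm (v t))\<^sup>2) = integral {0..b} (\<lambda>t. (norm (v t))\<^sup>2)"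
      by (rule Henstock_Kurzweil_Integration.integral_combine) (use that int in auto)
    then show ?thesis by (simp add: F_def)
  qed
  have F0: "F 0 = 0" by (simp add: F_def)
  have FT: "F T = \<Phi>" using hi by (simp add: F_def integral_unique)
  have mono: "F a \<le> F b" if "0 \<le> a" "a \<le> b" "b \<le> T" for a b
  proof -
    have "0 \<le> integral {a..b} (\<lambda>t. (norm (v t))\<^sup>2)"
      by (rule Henstock_Kurzweil_Integration.integral_nonneg) (use that int in auto)
    then show ?thesis using F[OF that] by simp
  qed
  have Fb: "0 \<le> F t" "F t \<le> \<Phi>" if "0 \<le> t" "t \<le> T" for t
    using mono[of 0 t] mono[of t T] that F0 FT by auto
  have \<Phi>0: "0 \<le> \<Phi>" using Fb[of 0] s by auto
  have Fc: "continuous_on {0..T} F"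
    unfolding F_def using s by (intro indefinite_integral_continuous_1 int) auto
  have diff: "(norm (u b - u a))\<^sup>2 \<le> (b - a) * (F b - F a)" if "0 \<le> a" "a \<le> b" "b \<le> T" for a b
    using norm_sq_primitive_le[OF prim v that] F[OF that] by simp
  have diff': "(norm (u b - u a))\<^sup>2 \<le> r * \<Phi>" if "0 \<le> a" "a \<le> b" "b \<le> T" "b - a \<le> r" for a b r
  proof -
    have "(b - a) * (F b - F a) \<le> r * \<Phi>"
      using that Fb[of a] Fb[of b] mono[of a b] \<Phi>0 by (intro mult_mono) auto
    then show ?thesis using diff[OF that(1-3)] by linarith
  qed
  \<comment> \<open>The difference is routed through the seam \<open>u 0 = u T\<close>: the two legs
    have total length at most \<open>3 * s\<close>, and squaring the triangle inequality doubles
    this.\<close>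
  have wrap: "(norm (u a - u b))\<^sup>2 \<le> 6 * s * \<Phi>"
    if "0 \<le> a" "a \<le> p" "T - q \<le> b" "b \<le> T" "p + q \<le> 3 * s" "a \<le> T" "0 \<le> b" for a b p q
  proof -
    have "u a - u b = (u a - u 0) + (u T - u b)" by (simp add: per)
    then have "(norm (u a - u b))\<^sup>2 \<le> 2 * (norm (u a - u 0))\<^sup>2 + 2 * (norm (u T - u b))\<^sup>2"
      using norm_sum_sq_le by metis
    also have "\<dots> \<le> 2 * (p * \<Phi>) + 2 * (q * \<Phi>)"
      using that by (intro add_mono mult_left_mono diff') auto
    also have "\<dots> = 2 * (p + q) * \<Phi>" by (simp add: algebra_simps)
    also have "\<dots> \<le> 6 * s * \<Phi>" using that \<Phi>0 by (intro mult_right_mono) auto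
    finally show ?thesis .
  qed
  have Dc: "continuous_on {0..T} D"
    unfolding D_def[abs_def] using s by (intro continuous_intros continuous_periodic_shift u per) auto
  then have Di: "D integrable_on {a..b}" if "0 \<le> a" "b \<le> T" for a b
    using that by (intro integrable_continuous_real continuous_on_subset[OF Dc]) auto
  have piece1: "integral {0..s} D \<le> integral {0..s} (\<lambda>_. 6 * s * \<Phi>)"
  proof (rule integral_le)
    fix t assume t: "t \<in> {0..s}"
    then have "D t = (norm (u (t + s) - u (t + (T - s))))\<^sup>2" using s by (auto simp: D_def periodic_shift_def)
    also have "\<dots> \<le> 6 * s * \<Phi>" using t s by (intro wrap[of _ "2 * s" s]) auto
    finally show "D t \<le> 6 * s * \<Phi>" .
  qed (use s in \<open>auto intro!: Di\<close>)
  have piece3: "integral {T - s..T} D \<le> integral {T - s..T} (\<lambda>_. 6 * s * \<Phi>)"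
  proof (rule integral_le)
    fix t assume t: "t \<in> {T - s..T}"
    \<comment> \<open>At \<open>t = T - s\<close> the shift evaluates \<open>u\<close> at
      \<open>T\<close> instead of 0; periodicity makes the formula valid there as well.\<close>
    have "D t = (norm (u (t + s - T) - u (t - s)))\<^sup>2"
      using t s per by (cases "t = T - s") (auto simp: D_def periodic_shift_def)
    also have "\<dots> \<le> 6 * s * \<Phi>" using t s by (intro wrap[of _ s "2 * s"]) auto
    finally show "D t \<le> 6 * s * \<Phi>" .
  qed (use s in \<open>auto intro!: Di\<close>)
  have Fi: "F integrable_on {a..b}" if "0 \<le> a" "b \<le> T" for a b
    using that by (intro integrable_continuous_real continuous_on_subset[OF Fc]) auto
  have up: "((\<lambda>t. F (t + s)) has_integral integral {2 * s..T} F) {s..T - s}"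
    by (rule has_integral_shift) (use integrable_integral[OF Fi[of "2 * s" T]] s in simp)
  have dn: "((\<lambda>t. F (t - s)) has_integral integral {0..T - 2 * s} F) {s..T - s}"
    using has_integral_shift[of F "integral {0..T - 2 * s} F" s "- s" "T - s"]
      integrable_integral[OF Fi[of 0 "T - 2 * s"]] s by (simp add: algebra_simps)
  have piece2: "integral {s..T - s} D \<le> 2 * s * (integral {2 * s..T} F - integral {0..T - 2 * s} F)"
  proof (rule has_integral_le)
    show "(D has_integral integral {s..T - s} D) {s..T - s}"
      by (rule integrable_integral, rule Di) (use s in auto)
    show "((\<lambda>t. 2 * s * (F (t + s) - F (t - s))) has_integral 2 * s * (integral {2 * s..T} F - integral {0..T - 2 * s} F)) {s..T - s}"
      by (intro has_integral_mult_right has_integral_diff up dn)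
    fix t assume t: "t \<in> {s..T - s}"
    have "D t = (norm (u (t + s) - u (t - s)))\<^sup>2"
      using t s per by (cases "t = s") (auto simp: D_def periodic_shift_def)
    also have "\<dots> \<le> (t + s - (t - s)) * (F (t + s) - F (t - s))" using t s by (intro diff) auto
    finally show "D t \<le> 2 * s * (F (t + s) - F (t - s))" by simp
  qed
  \<comment> \<open>Both integrals share the middle range, so only an end piece of length
    \<open>2 * s\<close> minus an initial piece of the same length remains, and \<open>F\<close>
    lies between 0 and \<Phi>.\<close>
  have "integral {2 * s..T} F - integral {0..T - 2 * s} F \<le> 2 * s * \<Phi>"
  proof -
    have "integral {0..2 * s} F + integral {2 * s..T} F = integral {0..T} F"
      "integral {0..T - 2 * s} F + integral {T - 2 * s..T} F = integral {0..T} F"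
      using s by (intro Henstock_Kurzweil_Integration.integral_combine Fi; simp)+
    moreover have "0 \<le> integral {0..2 * s} F"
      by (rule Henstock_Kurzweil_Integration.integral_nonneg) (use s Fi Fb in auto)
    moreover have "integral {T - 2 * s..T} F \<le> integral {T - 2 * s..T} (\<lambda>_. \<Phi>)"
      by (rule integral_le) (use s Fi Fb in auto)
    ultimately show ?thesis using s by simp
  qed
  then have "2 * s * (integral {2 * s..T} F - integral {0..T - 2 * s} F) \<le> 2 * s * (2 * s * \<Phi>)"
    using s by (intro mult_left_mono) auto
  moreover have "integral {0..s} D + integral {s..T - s} D = integral {0..T - s} D"
    "integral {0..T - s} D + integral {T - s..T} D = integral {0..T} D"
    using s by (intro Henstock_Kurzweil_Integration.integral_combine Di; simp)+
  ultimately have "integral {0..T} D \<le> 16 * s\<^sup>2 * \<Phi>"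
    using piece1 piece2 piece3 s by (simp add: power2_eq_square algebra_simps)
  moreover have "square_integrable (time_measure T) (\<lambda>t. periodic_shift T u s t - periodic_shift T u (T - s) t)"
    using s by (intro continuous_square_integrable_time continuous_intros continuous_periodic_shift u per) auto
  then have "(D has_integral (\<integral>t. D t \<partial>time_measure T)) {0..T}"
    unfolding D_def by (intro has_integral_time_measure_full square_integrable_norm_sq)
  ultimately show ?thesis by (simp add: integral_unique D_def \<Phi>_def)
qed

lemma symmetric_difference_quotient:
  fixes G :: "real \<Rightarrow> real"
  assumes G: "(G has_real_derivative l) (at x)" and s: "\<And>n. s n \<noteq> 0" "s \<longlonglongrightarrow> 0"
  shows "(\<lambda>n. (G (x + s n) - G (x - s n)) / (2 * s n)) \<longlonglongrightarrow> l"
proof -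
  have lim: "((\<lambda>h. (G (x + h) - G x) / h) \<longlongrightarrow> l) (at 0)"
    using G by (simp add: has_field_derivative_iff DERIV_LIM_iff)
  have "filterlim s (at 0) sequentially" "filterlim (\<lambda>n. - s n) (at 0) sequentially"
    using s tendsto_minus[OF s(2)] by (auto simp: filterlim_at)
  then have "(\<lambda>n. ((G (x + s n) - G x) / s n + (G (x + - s n) - G x) / - s n) / 2) \<longlonglongrightarrow> (l + l) / 2"
    by (intro tendsto_divide tendsto_add tendsto_const filterlim_compose[OF lim]) auto
  moreover have "((G (x + s n) - G x) / s n + (G (x + - s n) - G x) / - s n) / 2
      = (G (x + s n) - G (x - s n)) / (2 * s n)" for n
    using s(1)[of n] by (simp add: field_simps)
  ultimately show ?thesis by (simp only: field_sum_of_halves add_divide_distrib)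
qed

text \<open>The symmetric difference quotients \<open>w n\<close> have zero pairing with
  \<open>g\<close> for every \<open>n\<close> and are bounded in L2. Tested with the indicator of an
  interval they become difference quotients of a primitive of \<open>u\<close>, so
  \<open>w n - v\<close> is weakly null and the zero pairing passes to \<open>v\<close>.\<close>

lemma integral_symmetric_kernel_eq_0:
  fixes g u v :: "real \<Rightarrow> 'b::{second_countable_topology, real_inner, banach}"
  assumes T: "0 < T" and u: "continuous_on {0..T} u" and per: "u 0 = u T"
    and prim: "is_primitive T u v" and v: "square_integrable (time_measure T) v"
    and g: "square_integrable (time_measure T) g"
    and E: "AE t in time_measure T. t \<in> E"
    and sym: "\<And>t r. t \<in> E \<Longrightarrow> r \<in> E \<Longrightarrow> g t \<bullet> u r = g r \<bullet> u t"
  shows "(\<integral>t. g t \<bullet> v t \<partial>time_measure T) = 0"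
proof -
  let ?M = "time_measure T"
  \<comment> \<open>The offset 3 ensures \<open>2 * s n < T\<close> already for
    \<open>n = 0\<close>.\<close>
  define s where "s n = T / real (n + 3)" for n
  have s: "0 < s n" "2 * s n < T" "s n \<le> T" for n
    using T by (auto simp: s_def field_simps intro: add_pos_nonneg)
  have s0: "s \<longlonglongrightarrow> 0"
    unfolding s_def[abs_def] by (rule LIMSEQ_ignore_initial_segment[OF lim_const_over_n])
  define \<Phi> where "\<Phi> = (\<integral>t. (norm (v t))\<^sup>2 \<partial>?M)"
  define w where "w n t = (1 / (2 * s n)) *\<^sub>R (periodic_shift T u (s n) t - periodic_shift T u (T - s n) t)" for n t
  have rc: "continuous_on {0..T} (periodic_shift T u (s n))" "continuous_on {0..T} (periodic_shift T u (T - s n))" for n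
    using s[of n] by (intro continuous_periodic_shift u per; simp)+
  have wc: "continuous_on {0..T} (w n)" for n
    unfolding w_def by (intro continuous_intros rc)
  note w = continuous_square_integrable_time[OF wc]
  have wb: "(\<integral>t. (norm (w n t))\<^sup>2 \<partial>?M) \<le> 4 * \<Phi>" for n
  proof -
    have "(norm (w n t))\<^sup>2 = (norm (periodic_shift T u (s n) t - periodic_shift T u (T - s n) t))\<^sup>2 / (4 * (s n)\<^sup>2)" for t
      by (simp add: w_def power_mult_distrib power_divide)
    then have "(\<integral>t. (norm (w n t))\<^sup>2 \<partial>?M) =
        (\<integral>t. (norm (periodic_shift T u (s n) t - periodic_shift T u (T - s n) t))\<^sup>2 \<partial>?M) / (4 * (s n)\<^sup>2)" by simp
    also have "\<dots> \<le> (16 * (s n)\<^sup>2 * \<Phi>) / (4 * (s n)\<^sup>2)"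
      unfolding \<Phi>_def by (intro divide_right_mono periodic_shift_difference_bound prim v u per s) simp
    also have "\<dots> = 4 * \<Phi>" using s(1)[of n] by simp
    finally show ?thesis .
  qed
  have zb: "(\<integral>t. (norm (w n t - v t))\<^sup>2 \<partial>?M) \<le> 10 * \<Phi>" for n
  proof -
    have "(\<integral>t. (norm (w n t - v t))\<^sup>2 \<partial>?M) \<le> (\<integral>t. 2 * (norm (w n t))\<^sup>2 + 2 * (norm (v t))\<^sup>2 \<partial>?M)"
    proof (rule Bochner_Integration.integral_mono)
      show "integrable ?M (\<lambda>t. (norm (w n t - v t))\<^sup>2)"
        by (intro square_integrable_norm_sq square_integrable_diff w v)
      show "integrable ?M (\<lambda>t. 2 * (norm (w n t))\<^sup>2 + 2 * (norm (v t))\<^sup>2)"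
        using w[of n] v by (auto simp: square_integrable_norm_sq)
      show "(norm (w n t - v t))\<^sup>2 \<le> 2 * (norm (w n t))\<^sup>2 + 2 * (norm (v t))\<^sup>2" for t
        using norm_sum_sq_le[of "w n t" "- v t"] by simp
    qed
    also have "\<dots> = 2 * (\<integral>t. (norm (w n t))\<^sup>2 \<partial>?M) + 2 * \<Phi>"
      using w[of n] v by (simp add: square_integrable_norm_sq \<Phi>_def)
    finally show ?thesis using wb[of n] by linarith
  qed
  have "(\<lambda>n. \<integral>t. g t \<bullet> (w n t - v t) \<partial>?M) \<longlonglongrightarrow> 0"
  proof (rule weakly_null[OF _ _ square_integrable_diff[OF w v] zb _ g])
    fix a b :: real and y :: 'b assume ab: "cbox a b \<subseteq> {0<..<T}"
    show "(\<lambda>n. \<integral>t. indicator (box a b) t *\<^sub>R y \<bullet> (w n t - v t) \<partial>?M) \<longlonglongrightarrow> 0"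
    proof (cases "a \<le> b")
      case True
      then have ab: "0 < a" "a \<le> b" "b < T" using ab by auto
      interpret finite_measure ?M by (rule finite_measure_time)
      \<comment> \<open>Integrating the translated curves over \<open>{a..b}\<close> gives values of
        \<open>G\<close> near \<open>a\<close> and \<open>b\<close>; regrouped by end point, these
        are symmetric difference quotients of \<open>G\<close>.\<close>
      define G where "G x = integral {0..x} (\<lambda>t. u t \<bullet> y)" for x
      have uy: "continuous_on {0..T} (\<lambda>t. u t \<bullet> y)" by (intro continuous_intros u)
      have G': "(G has_real_derivative u x \<bullet> y) (at x)" if "0 < x" "x < T" for x
      proof -
        have "(G has_real_derivative u x \<bullet> y) (at x within {0..T})"
          unfolding G_def by (rule integral_has_real_derivative[OF uy]) (use that in auto)
        then show ?thesis using that by (simp add: at_within_Icc_at)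
      qed
      have G: "((\<lambda>t. u t \<bullet> y) has_integral (G d - G c)) {c..d}" if "0 \<le> c" "c \<le> d" "d \<le> T" for c d
      proof -
        have i: "(\<lambda>t. u t \<bullet> y) integrable_on {x..z}" if "0 \<le> x" "z \<le> T" for x z
          using that by (intro integrable_continuous_real continuous_on_subset[OF uy]) auto
        have "G c + integral {c..d} (\<lambda>t. u t \<bullet> y) = G d"
          unfolding G_def by (rule Henstock_Kurzweil_Integration.integral_combine) (use that i in auto)
        then have "integral {c..d} (\<lambda>t. u t \<bullet> y) = G d - G c" by simp
        then show ?thesis using integrable_integral[OF i[of c d]] that by simp
      qed
      have "(\<lambda>n. (G (b + s n) - G (b - s n)) / (2 * s n) - (G (a + s n) - G (a - s n)) / (2 * s n))
          \<longlonglongrightarrow> u b \<bullet> y - u a \<bullet> y"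
        using ab s s0 by (intro tendsto_diff symmetric_difference_quotient G') (auto simp: less_imp_neq[symmetric])
      moreover have "\<forall>\<^sub>F n in sequentially. (G (b + s n) - G (b - s n)) / (2 * s n) - (G (a + s n) - G (a - s n)) / (2 * s n)
        = (\<integral>t. indicator {a<..<b} t * (w n t \<bullet> y) \<partial>?M)"
      proof -
        \<comment> \<open>From then on no translate of \<open>{a..b}\<close> leaves
          \<open>{0..T}\<close>, and \<open>w n\<close> is the plain difference quotient
          there.\<close>
        have "\<forall>\<^sub>F n in sequentially. s n < min a (T - b)"
          using order_tendstoD(2)[OF s0, of "min a (T - b)"] ab by simp
        then show ?thesis
        proof eventually_elim
          case (elim n)
          have "((\<lambda>t. (u (t + s n) \<bullet> y - u (t + - s n) \<bullet> y) / (2 * s n)) has_integral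
             ((G (b + s n) - G (a + s n)) - (G (b + - s n) - G (a + - s n))) / (2 * s n)) {a..b}"
            using elim ab s(1)[of n]
            by (intro has_integral_divide has_integral_diff has_integral_shift[where f = "\<lambda>t. u t \<bullet> y"] G) auto
          then have "((\<lambda>t. w n t \<bullet> y) has_integral
             ((G (b + s n) - G (a + s n)) - (G (b + - s n) - G (a + - s n))) / (2 * s n)) {a..b}"
            by (rule has_integral_eq[rotated])
               (use elim ab s(1)[of n] in \<open>auto simp: w_def periodic_shift_def inner_diff_left\<close>)
          moreover have "((\<lambda>t. w n t \<bullet> y) has_integral (\<integral>t. indicator {a<..<b} t * (w n t \<bullet> y) \<partial>?M)) {a..b}"
            using ab by (intro has_integral_time_measure square_integrable_integrable square_integrable_inner_const w) auto
          ultimately have "((G (b + s n) - G (a + s n)) - (G (b + - s n) - G (a + - s n))) / (2 * s n) =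
              (\<integral>t. indicator {a<..<b} t * (w n t \<bullet> y) \<partial>?M)"
            by (rule has_integral_unique)
          then show ?case by (simp add: diff_divide_distrib)
        qed
      qed
      ultimately have "(\<lambda>n. \<integral>t. indicator {a<..<b} t * (w n t \<bullet> y) \<partial>?M) \<longlonglongrightarrow> u b \<bullet> y - u a \<bullet> y"
        by (rule Lim_transform_eventually)
      moreover have vy: "integrable ?M (\<lambda>t. v t \<bullet> y)"
        by (intro square_integrable_integrable square_integrable_inner_const v)
      have "(\<integral>t. indicator {a<..<b} t * (v t \<bullet> y) \<partial>?M) = u b \<bullet> y - u a \<bullet> y"
      proof (rule has_integral_unique)
        show "((\<lambda>t. v t \<bullet> y) has_integral (\<integral>t. indicator {a<..<b} t * (v t \<bullet> y) \<partial>?M)) {a..b}"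
          using ab by (intro has_integral_time_measure vy) auto
        show "((\<lambda>t. v t \<bullet> y) has_integral (u b \<bullet> y - u a \<bullet> y)) {a..b}"
          using prim ab unfolding is_primitive_def inner_diff_left by simp
      qed
      ultimately have "(\<lambda>n. (\<integral>t. indicator {a<..<b} t * (w n t \<bullet> y) \<partial>?M) - (\<integral>t. indicator {a<..<b} t * (v t \<bullet> y) \<partial>?M)) \<longlonglongrightarrow> 0"
        by (simp add: LIM_zero)
      moreover have "(\<integral>t. indicator {a<..<b} t * (w n t \<bullet> y) \<partial>?M) - (\<integral>t. indicator {a<..<b} t * (v t \<bullet> y) \<partial>?M)
          = (\<integral>t. indicator (box a b) t *\<^sub>R y \<bullet> (w n t - v t) \<partial>?M)" for n
      proof -
        have ms: "{a<..<b} \<in> sets ?M" using ab by (auto simp: sets_restrict_space_iff)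
        have "integrable ?M (\<lambda>t. indicator {a<..<b} t * (w n t \<bullet> y))"
          using integrable_mult_indicator[OF ms, of "\<lambda>t. w n t \<bullet> y"]
            square_integrable_integrable[OF square_integrable_inner_const[OF w[of n]], of y] by simp
        moreover have "integrable ?M (\<lambda>t. indicator {a<..<b} t * (v t \<bullet> y))"
          using integrable_mult_indicator[OF ms vy] by simp
        ultimately show ?thesis
          by (subst Bochner_Integration.integral_diff[symmetric])
             (auto simp: box_real inner_diff_left inner_diff_right inner_commute right_diff_distrib)
      qed
      ultimately show ?thesis by simp
    qed (simp add: box_real)
  qed auto
  moreover have "(\<integral>t. g t \<bullet> (w n t - v t) \<partial>?M) = - (\<integral>t. g t \<bullet> v t \<partial>?M)" for n
  proof -
    note r = rc[THEN continuous_square_integrable_time, of n]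
    have "(\<integral>t. g t \<bullet> w n t \<partial>?M) = (1 / (2 * s n)) *
        ((\<integral>t. g t \<bullet> periodic_shift T u (s n) t \<partial>?M) - (\<integral>t. g t \<bullet> periodic_shift T u (T - s n) t \<partial>?M))"
      unfolding w_def inner_scaleR_right inner_diff_right
      using square_integrable_inner[OF g r(1)] square_integrable_inner[OF g r(2)] by simp
    also have "\<dots> = 0"
      using integral_periodic_shift_symmetric[OF u per g _ _ E sym, of "s n"] s[of n] by simp
    finally show ?thesis
      using square_integrable_inner[OF g w[of n]] square_integrable_inner[OF g v] by (simp add: inner_diff_right)
  qed
  ultimately show ?thesis by (simp add: LIMSEQ_const_iff)
qed

section \<open>Finite-dimensional subspaces\<close>

text \<open>Values in \<open>l2\<close> have no canonical \<open>Basis\<close>; coordinates in a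
  finite-dimensional span are taken with respect to an explicit orthonormal set.\<close>

locale orthonormal_system =
  fixes E :: "'b::real_inner set"
  assumes finite: "finite E" and unit: "e \<in> E \<Longrightarrow> norm e = 1"
    and orthogonal: "e \<in> E \<Longrightarrow> e' \<in> E \<Longrightarrow> e \<noteq> e' \<Longrightarrow> e \<bullet> e' = 0"
begin

lemma expansion:
  assumes "x \<in> span E" shows "(\<Sum>e\<in>E. (x \<bullet> e) *\<^sub>R e) = x"
  using assms
proof (induction rule: span_induct_alt)
  case (step c b y)
  have "(\<Sum>e\<in>E. ((c *\<^sub>R b + y) \<bullet> e) *\<^sub>R e) = (\<Sum>e\<in>E. (c * (b \<bullet> e)) *\<^sub>R e) + (\<Sum>e\<in>E. (y \<bullet> e) *\<^sub>R e)"
    by (simp add: inner_add_left scaleR_add_left sum.distrib)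
  also have "(\<Sum>e\<in>E. (c * (b \<bullet> e)) *\<^sub>R e) = (\<Sum>e\<in>E. if e = b then c *\<^sub>R b else 0)"
    using step(1) unit orthogonal by (intro sum.cong) (auto simp: norm_eq_1)
  also have "\<dots> = c *\<^sub>R b" using finite step(1) by simp
  finally show ?case using step(2) by simp
qed simp

lemma norm_sq_expansion:
  assumes "x \<in> span E" shows "(norm x)\<^sup>2 = (\<Sum>e\<in>E. (x \<bullet> e)\<^sup>2)"
proof -
  have "(norm x)\<^sup>2 = (\<Sum>e\<in>E. (x \<bullet> e) *\<^sub>R e) \<bullet> x"
    by (simp add: expansion[OF assms] power2_norm_eq_inner)
  also have "\<dots> = (\<Sum>e\<in>E. (x \<bullet> e)\<^sup>2)"
    unfolding inner_sum_left inner_scaleR_left power2_eq_square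
    by (intro sum.cong refl) (simp add: inner_commute)
  finally show ?thesis .
qed

end

text \<open>Gram-Schmidt: a new vector is either in the span already or contributes its normalised
  residual.\<close>

lemma finite_orthonormal_basis:
  fixes B :: "'b::real_inner set"
  assumes "finite B"
  shows "\<exists>E. orthonormal_system E \<and> span E = span B"
  using assms
proof (induction B rule: finite_induct)
  case empty
  show ?case by (intro exI[of _ "{}"]) (auto intro: orthonormal_system.intro)
next
  case (insert x B)
  then obtain E where orth_E: "orthonormal_system E" and E: "span E = span B" by auto
  interpret orthonormal_system E by (rule orth_E)
  define c where "c = (\<Sum>e\<in>E. (x \<bullet> e) *\<^sub>R e)"
  define y where "y = x - c"
  have c: "c \<in> span E" unfolding c_def by (intro span_sum span_scale span_base)
  have orth: "y \<bullet> e = 0" if "e \<in> E" for e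
  proof -
    have "c \<bullet> e = (\<Sum>e'\<in>E. if e' = e then x \<bullet> e else 0)"
      unfolding c_def inner_sum_left using unit[OF that] orthogonal[OF _ that]
      by (intro sum.cong) (auto simp: norm_eq_1)
    then show ?thesis using finite that by (simp add: y_def inner_diff_left)
  qed
  show ?case
  proof (cases "y = 0")
    case True
    then have "x \<in> span B" using c E by (simp add: y_def)
    then have "span (insert x B) = span B" by (rule span_redundant)
    then show ?thesis using E orth_E by (intro exI[of _ E]) simp
  next
    case False
    define z where "z = (1 / norm y) *\<^sub>R y"
    have z: "norm z = 1" "\<And>e. e \<in> E \<Longrightarrow> z \<bullet> e = 0" using False orth by (auto simp: z_def)
    have "span (insert z E) = span (insert x B)"
      unfolding span_eq
    proof
      have EB: "e \<in> span (insert x B)" if "e \<in> span E" for e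
        using that E span_mono[of B "insert x B"] by auto
      have "y \<in> span (insert x B)" unfolding y_def by (intro span_diff EB c span_base) simp
      then have "z \<in> span (insert x B)" unfolding z_def by (rule span_scale)
      then show "insert z E \<subseteq> span (insert x B)" using EB span_base by auto
      have EZ: "e \<in> span (insert z E)" if "e \<in> span E" for e
        using that span_mono[of E "insert z E"] by auto
      have "x = norm y *\<^sub>R z + c" using False by (simp add: z_def y_def)
      also have "\<dots> \<in> span (insert z E)" by (intro span_add span_scale EZ c span_base) simp
      finally show "insert x B \<subseteq> span (insert z E)" using EZ E span_base by auto
    qed
    moreover have "orthonormal_system (insert z E)"
      by unfold_locales (use finite unit orthogonal z in \<open>auto simp: inner_commute\<close>)
    ultimately show ?thesis by blast
  qed
qed

text \<open>The squared distance to the span is continuous, nonnegative and zero almost everywhere,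
  hence zero. This is needed at the mesh points and end points, about which an almost-everywhere
  statement says nothing.\<close>

lemma continuous_AE_in_span:
  fixes p :: "real \<Rightarrow> 'b::real_inner"
  assumes B: "finite B" and p: "continuous_on {0..T} p" and T: "0 < T"
    and AE: "AE t in time_measure T. p t \<in> span B" and t: "t \<in> {0..T}"
  shows "p t \<in> span B"
proof -
  obtain E where "orthonormal_system E" and E: "span E = span B"
    using finite_orthonormal_basis[OF B] by auto
  then interpret orthonormal_system E by simp
  define \<phi> where "\<phi> t = (norm (p t - (\<Sum>e\<in>E. (p t \<bullet> e) *\<^sub>R e)))\<^sup>2" for t
  have c: "continuous_on {0..T} \<phi>" unfolding \<phi>_def by (intro continuous_intros p)
  have "AE t in time_measure T. \<phi> t = 0"
    using AE by eventually_elim (simp add: \<phi>_def expansion E)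
  then have "(\<integral>t. \<phi> t \<partial>time_measure T) = 0" by (rule integral_eq_zero_AE)
  moreover have "integrable (time_measure T) \<phi>"
    by (rule finite_measure.square_integrable_integrable[OF finite_measure_time continuous_square_integrable_time[OF c]])
  ultimately have "integral {0..T} \<phi> = 0"
    using has_integral_time_measure_full[of T \<phi>] by (simp add: integral_unique)
  then have "\<phi> t = 0" using integral_eq_0_iff[OF c T] t by (auto simp: \<phi>_def)
  then have "p t = (\<Sum>e\<in>E. (p t \<bullet> e) *\<^sub>R e)" by (simp add: \<phi>_def)
  also have "\<dots> \<in> span E" by (intro span_sum span_scale span_base)
  finally show ?thesis using E by simp
qed

text \<open>Each \<open>z\<close> comes with its own null set. A countable dense part of
  \<open>Z\<close> needs only a countable union of them, and continuity of the inner product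
  recovers the rest.\<close>

lemma AE_orthogonal_separable:
  fixes a :: "'m \<Rightarrow> 'c::{real_inner, second_countable_topology}"
  assumes "\<And>z. z \<in> Z \<Longrightarrow> AE t in M. a t \<bullet> z = 0"
  shows "AE t in M. \<forall>z\<in>Z. a t \<bullet> z = 0"
proof -
  obtain D where D: "countable D" "D \<subseteq> Z" "Z \<subseteq> closure D" using separable[of Z] by blast
  have "AE t in M. \<forall>z\<in>D. a t \<bullet> z = 0"
    using D assms by (subst AE_ball_countable) auto
  then show ?thesis
  proof eventually_elim
    case (elim t)
    have "closed {z. a t \<bullet> z = 0}" by (intro closed_Collect_eq continuous_intros)
    then have "closure D \<subseteq> {z. a t \<bullet> z = 0}" using elim by (intro closure_minimal) auto
    then show ?case using D(3) by auto
  qed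
qed

section \<open>Piecewise linear interpolation\<close>

lemma mesh_le:
  assumes "is_mesh T m t" "i \<le> j" "j \<le> m" shows "t i \<le> t j"
  using mesh_less[OF assms(1), of i j] assms(2,3) by (cases "i = j") auto

lemma mesh_cover:
  assumes mesh: "is_mesh T m t" and s: "0 < s" "s \<le> T"
  shows "\<exists>i<m. t i \<le> s \<and> s \<le> t (Suc i)"
proof -
  define k where "k = (LEAST k. s \<le> t k)"
  have "s \<le> t m" using mesh s by (simp add: is_mesh_def)
  then have k: "s \<le> t k" "k \<le> m" unfolding k_def by (auto intro: LeastI Least_le)
  have "k \<noteq> 0"
  proof
    assume "k = 0"
    then have "s \<le> t 0" using k(1) by (simp only:)
    then show False using s mesh by (simp add: is_mesh_def)
  qed
  then obtain i where i: "k = Suc i" by (cases k) auto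
  have "\<not> s \<le> t i" using not_less_Least[of i "\<lambda>k. s \<le> t k"] i unfolding k_def by simp
  then show ?thesis using k i by (intro exI[of _ i]) auto
qed

lemma continuous_interpolant:
  fixes w :: "real \<Rightarrow> 'b::real_normed_vector"
  assumes mesh: "is_mesh T m t"
  shows "continuous_on {0..T} (interpolant t w)"
proof -
  have "continuous_on {t 0..t j} (interpolant t w)" if "j \<le> m" for j
    using that
  proof (induction j)
    case (Suc j)
    have "continuous_on {t j..t (Suc j)} (interpolant t w)
        \<longleftrightarrow> continuous_on {t j..t (Suc j)} (\<lambda>s. w (t j) + ((s - t j) / (t (Suc j) - t j)) *\<^sub>R (w (t (Suc j)) - w (t j)))"
      using Suc.prems interpolant_affine[OF mesh, of j] by (intro continuous_on_cong) auto
    moreover have "continuous_on {t j..t (Suc j)} (\<lambda>s. w (t j) + ((s - t j) / (t (Suc j) - t j)) *\<^sub>R (w (t (Suc j)) - w (t j)))"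
      using mesh_less[OF mesh, of j "Suc j"] Suc.prems by (intro continuous_intros) auto
    ultimately have "continuous_on ({t 0..t j} \<union> {t j..t (Suc j)}) (interpolant t w)"
      using Suc by (intro continuous_on_closed_Un) auto
    moreover have "{t 0..t j} \<union> {t j..t (Suc j)} = {t 0..t (Suc j)}"
      using mesh_le[OF mesh, of 0 j] mesh_le[OF mesh, of j "Suc j"] Suc.prems by (intro ivl_disj_un_two_touch) auto
    ultimately show ?case by simp
  qed auto
  from this[of m] show ?thesis using mesh by (simp add: is_mesh_def)
qed

lemma interpolant_in_subspace:
  assumes mesh: "is_mesh T m t" and s: "0 < s" "s \<le> T" and S: "subspace S"
    and w: "\<And>r. r \<in> {0..T} \<Longrightarrow> w r \<in> S"
  shows "interpolant t w s \<in> S"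
proof -
  obtain i where i: "i < m" "t i \<le> s" "s \<le> t (Suc i)" using mesh_cover[OF mesh s] by blast
  have "t i \<in> {0..T}" "t (Suc i) \<in> {0..T}"
    using mesh_le[OF mesh, of 0 i] mesh_le[OF mesh, of i m] mesh_le[OF mesh, of 0 "Suc i"]
      mesh_le[OF mesh, of "Suc i" m] i mesh by (auto simp: is_mesh_def)
  then show ?thesis
    unfolding interpolant_affine[OF mesh i] by (intro subspace_add subspace_scale subspace_diff S w)
qed

lemma interpolant_inner: "interpolant t (\<lambda>s. w s \<bullet> y) s = interpolant t w s \<bullet> y"
  by (simp add: interpolant_def Let_def inner_add_left inner_diff_left)

lemma L2_time_iff:
  "u \<in> L2_time T X \<longleftrightarrow> square_integrable (time_measure T) u \<and> (AE t in time_measure T. u t \<in> X)"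
  by (auto simp: L2_time_def square_integrable_def)

text \<open>Interpolation acts on each coordinate separately, so the scalar estimate applies to
  every coordinate in an orthonormal basis of the span; summing the squares gives the vector
  estimate with the same constant.\<close>

lemma interpolation_error:
  fixes p p' :: "real \<Rightarrow> 'b::{second_countable_topology, real_inner, banach}"
  assumes T: "0 < T" and B: "finite B" and mesh: "is_mesh T m t"
    and C\<^sub>J: "\<And>w w'. w \<in> periodic_H1 T \<Longrightarrow> w' \<in> L2_time T UNIV \<Longrightarrow>
           has_weak_time_derivative T w w' \<Longrightarrow>
           L2_time_norm T (\<lambda>s. w s - interpolant t w s) \<le> C\<^sub>J * L2_time_norm T w'"
    and pc: "continuous_on {0..T} p" and per: "p 0 = p T"
    and pS: "\<And>s. s \<in> {0..T} \<Longrightarrow> p s \<in> span B"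
    and p': "square_integrable (time_measure T) p'" "AE s in time_measure T. p' s \<in> span B"
    and weak: "has_weak_time_derivative T p p'"
  shows "(\<integral>s. (norm (p s - interpolant t p s))\<^sup>2 \<partial>time_measure T)
    \<le> C\<^sub>J\<^sup>2 * (\<integral>s. (norm (p' s))\<^sup>2 \<partial>time_measure T)"
proof -
  let ?M = "time_measure T"
  obtain E where "orthonormal_system E" and E: "span E = span B"
    using finite_orthonormal_basis[OF B] by auto
  then interpret orthonormal_system E by simp
  note p = continuous_square_integrable_time[OF pc]
  have qc: "continuous_on {0..T} (\<lambda>s. p s - interpolant t p s)"
    by (intro continuous_intros pc continuous_interpolant[OF mesh])
  note q = continuous_square_integrable_time[OF qc]
  have sq: "integrable ?M (\<lambda>s. (x s \<bullet> e)\<^sup>2)" if "square_integrable ?M x" for x :: "real \<Rightarrow> 'b" and e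
    using square_integrable_norm_sq[OF square_integrable_inner_const[OF that]] by simp
  have scalar: "(\<integral>s. ((p s - interpolant t p s) \<bullet> e)\<^sup>2 \<partial>?M) \<le> C\<^sub>J\<^sup>2 * (\<integral>s. (p' s \<bullet> e)\<^sup>2 \<partial>?M)" for e
  proof -
    have w: "has_weak_time_derivative T (\<lambda>s. p s \<bullet> e) (\<lambda>s. p' s \<bullet> e)"
      by (rule has_weak_time_derivative_inner[OF p p'(1) weak])
    have w': "(\<lambda>s. p' s \<bullet> e) \<in> L2_time T UNIV"
      by (simp add: L2_time_iff square_integrable_inner_const p')
    have "(\<lambda>s. p s \<bullet> e) \<in> periodic_H1 T"
      unfolding periodic_H1_def H1_time_def
      using w w' per pc p by (auto simp: L2_time_iff square_integrable_inner_const intro!: continuous_intros)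
    from C\<^sub>J[OF this w' w]
    have "sqrt (\<integral>s. ((p s - interpolant t p s) \<bullet> e)\<^sup>2 \<partial>?M) \<le> C\<^sub>J * sqrt (\<integral>s. (p' s \<bullet> e)\<^sup>2 \<partial>?M)"
      by (simp add: L2_time_norm_def interpolant_inner inner_diff_left)
    then have "(sqrt (\<integral>s. ((p s - interpolant t p s) \<bullet> e)\<^sup>2 \<partial>?M))\<^sup>2 \<le> (C\<^sub>J * sqrt (\<integral>s. (p' s \<bullet> e)\<^sup>2 \<partial>?M))\<^sup>2"
      by (intro power_mono) auto
    then show ?thesis by (simp add: power_mult_distrib)
  qed
  have "(\<integral>s. (norm (p s - interpolant t p s))\<^sup>2 \<partial>?M) = (\<integral>s. (\<Sum>e\<in>E. ((p s - interpolant t p s) \<bullet> e)\<^sup>2) \<partial>?M)"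
  proof (rule Bochner_Integration.integral_cong[OF refl])
    fix s assume "s \<in> space ?M"
    then have "0 < s" "s \<le> T" by auto
    then have "p s - interpolant t p s \<in> span B"
      using pS by (intro span_diff interpolant_in_subspace[OF mesh]) auto
    then show "(norm (p s - interpolant t p s))\<^sup>2 = (\<Sum>e\<in>E. ((p s - interpolant t p s) \<bullet> e)\<^sup>2)"
      by (intro norm_sq_expansion) (simp add: E)
  qed
  also have "\<dots> = (\<Sum>e\<in>E. \<integral>s. ((p s - interpolant t p s) \<bullet> e)\<^sup>2 \<partial>?M)"
    by (rule Bochner_Integration.integral_sum) (rule sq[OF q])
  also have "\<dots> \<le> (\<Sum>e\<in>E. C\<^sub>J\<^sup>2 * (\<integral>s. (p' s \<bullet> e)\<^sup>2 \<partial>?M))"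
    by (intro sum_mono scalar)
  also have "\<dots> = C\<^sub>J\<^sup>2 * (\<integral>s. (\<Sum>e\<in>E. (p' s \<bullet> e)\<^sup>2) \<partial>?M)"
    by (subst Bochner_Integration.integral_sum) (auto simp: sum_distrib_left intro: sq p')
  also have "(\<integral>s. (\<Sum>e\<in>E. (p' s \<bullet> e)\<^sup>2) \<partial>?M) = (\<integral>s. (norm (p' s))\<^sup>2 \<partial>?M)"
  proof (rule integral_cong_AE)
    show "(\<lambda>s. \<Sum>e\<in>E. (p' s \<bullet> e)\<^sup>2) \<in> borel_measurable ?M"
      by (intro borel_measurable_sum borel_measurable_integrable sq p')
    show "(\<lambda>s. (norm (p' s))\<^sup>2) \<in> borel_measurable ?M"
      by (intro borel_measurable_integrable square_integrable_norm_sq p')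
    show "AE s in ?M. (\<Sum>e\<in>E. (p' s \<bullet> e)\<^sup>2) = (norm (p' s))\<^sup>2"
      using p'(2) by eventually_elim (simp add: norm_sq_expansion E)
  qed
  finally show ?thesis .
qed

section \<open>The energy estimate\<close>

text \<open>Minkowski's inequality for a dominated function. \<open>h\<close> carries no
  measurability assumption: if its square is not integrable, the integral is 0 by convention and the
  estimate persists, which \<open>integral_mono_AE'\<close> covers.\<close>

lemma L2_norm_sum_le:
  fixes \<alpha> \<beta> h :: "'m \<Rightarrow> real"
  assumes \<alpha>: "square_integrable M \<alpha>" and \<beta>: "square_integrable M \<beta>"
    and h: "AE x in M. 0 \<le> h x \<and> h x \<le> \<alpha> x + \<beta> x"
    and X: "(\<integral>x. (\<alpha> x)\<^sup>2 \<partial>M) \<le> X\<^sup>2" "0 \<le> X" and Y: "(\<integral>x. (\<beta> x)\<^sup>2 \<partial>M) \<le> Y\<^sup>2" "0 \<le> Y"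
  shows "sqrt (\<integral>x. (h x)\<^sup>2 \<partial>M) \<le> X + Y"
proof -
  have i: "integrable M (\<lambda>x. (\<alpha> x)\<^sup>2)" "integrable M (\<lambda>x. (\<beta> x)\<^sup>2)" "integrable M (\<lambda>x. \<alpha> x * \<beta> x)"
    using square_integrable_norm_sq[OF \<alpha>] square_integrable_norm_sq[OF \<beta>] square_integrable_inner[OF \<alpha> \<beta>] by simp_all
  have "(\<integral>x. (h x)\<^sup>2 \<partial>M) \<le> (\<integral>x. (\<alpha> x)\<^sup>2 + 2 * (\<alpha> x * \<beta> x) + (\<beta> x)\<^sup>2 \<partial>M)"
  proof (rule integral_mono_AE')
    show "integrable M (\<lambda>x. (\<alpha> x)\<^sup>2 + 2 * (\<alpha> x * \<beta> x) + (\<beta> x)\<^sup>2)" using i by simp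
    show "AE x in M. (h x)\<^sup>2 \<le> (\<alpha> x)\<^sup>2 + 2 * (\<alpha> x * \<beta> x) + (\<beta> x)\<^sup>2"
      using h
    proof eventually_elim
      case (elim x)
      then have "(h x)\<^sup>2 \<le> (\<alpha> x + \<beta> x)\<^sup>2" by (intro power_mono) auto
      then show ?case by (simp add: power2_sum)
    qed
    show "AE x in M. 0 \<le> (\<alpha> x)\<^sup>2 + 2 * (\<alpha> x * \<beta> x) + (\<beta> x)\<^sup>2"
    proof (rule AE_I2)
      fix x show "0 \<le> (\<alpha> x)\<^sup>2 + 2 * (\<alpha> x * \<beta> x) + (\<beta> x)\<^sup>2"
        using zero_le_power2[of "\<alpha> x + \<beta> x"] by (simp add: power2_sum)
    qed
  qed
  also have "\<dots> = (\<integral>x. (\<alpha> x)\<^sup>2 \<partial>M) + 2 * (\<integral>x. \<alpha> x * \<beta> x \<partial>M) + (\<integral>x. (\<beta> x)\<^sup>2 \<partial>M)"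
    using i by simp
  also have "\<dots> \<le> X\<^sup>2 + 2 * (X * Y) + Y\<^sup>2"
  proof -
    have "(\<integral>x. \<alpha> x * \<beta> x \<partial>M)\<^sup>2 \<le> (\<integral>x. (\<alpha> x)\<^sup>2 \<partial>M) * (\<integral>x. (\<beta> x)\<^sup>2 \<partial>M)"
      using integral_inner_Cauchy_Schwarz[OF \<alpha> \<beta>] by simp
    also have "\<dots> \<le> X\<^sup>2 * Y\<^sup>2" using X Y by (intro mult_mono) auto
    finally have "(\<integral>x. \<alpha> x * \<beta> x \<partial>M)\<^sup>2 \<le> (X * Y)\<^sup>2" by (simp add: power_mult_distrib)
    then have "(\<integral>x. \<alpha> x * \<beta> x \<partial>M) \<le> X * Y" by (rule power2_le_imp_le) (use X Y in simp)
    then show ?thesis using X Y by simp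
  qed
  also have "\<dots> = (X + Y)\<^sup>2" by (simp add: power2_sum)
  finally show ?thesis using X Y by (intro real_le_lsqrt) auto
qed

text \<open>Testing the equation with the time derivative: the elliptic term drops out by periodicity.\<close>

lemma energy_identity:
  fixes f u v :: "real \<Rightarrow> 'b::{second_countable_topology, real_inner, banach}"
  assumes T: "0 < T" and u: "continuous_on {0..T} u" "u 0 = u T" and prim: "is_primitive T u v"
    and v: "square_integrable (time_measure T) v" and f: "square_integrable (time_measure T) f"
    and E: "AE t in time_measure T. t \<in> E"
    and sym: "\<And>t r. t \<in> E \<Longrightarrow> r \<in> E \<Longrightarrow> (f t - v t) \<bullet> u r = (f r - v r) \<bullet> u t"
  shows "(\<integral>t. (norm (v t))\<^sup>2 \<partial>time_measure T) + (\<integral>t. (norm (f t - v t))\<^sup>2 \<partial>time_measure T)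
    = (\<integral>t. (norm (f t))\<^sup>2 \<partial>time_measure T)"
proof -
  note g = square_integrable_diff[OF f v]
  have "(\<integral>t. (f t - v t) \<bullet> v t \<partial>time_measure T) = 0"
    by (rule integral_symmetric_kernel_eq_0[OF T u prim v g E sym])
  moreover have "(norm (f t))\<^sup>2 = (norm (v t))\<^sup>2 + (norm (f t - v t))\<^sup>2 + 2 * ((f t - v t) \<bullet> v t)" for t
    by (simp add: power2_norm_eq_inner inner_diff_left inner_diff_right inner_commute)
  ultimately show ?thesis
    using square_integrable_norm_sq[OF v] square_integrable_norm_sq[OF g] square_integrable_inner[OF g v] by simp
qed

lemma convex_polytopal_bounded_domain:
  assumes "convex_polytopal_domain \<Omega>" shows "bounded_domain \<Omega>"
proof -
  obtain P where P: "polytope P" "\<Omega> = interior P" using assms by (auto simp: convex_polytopal_domain_def)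
  have "bounded \<Omega>" using P polytope_imp_bounded interior_subset bounded_subset by metis
  then show ?thesis using P(2) by unfold_locales (auto intro: lmeasurable_open)
qed

context bounded_domain
begin

text \<open>With \<open>u - p = (u - q) + (q - p)\<close>, the Galerkin relation removes the part
  tested with \<open>q - p\<close>, and Ritz orthogonality reduces the remaining gradient term to
  that of \<open>u - q\<close>. What is left is controlled by the two projection estimates;
  \<open>G\<close> stands for the norm of the Laplacian of \<open>u\<close>.\<close>

lemma semidiscrete_pointwise_estimate:
  assumes S: "subspace S" "S \<subseteq> H1_on \<Omega>" and u: "u \<in> H1_on \<Omega>" and p: "p \<in> S" and q: "q \<in> S"
    and ritz: "\<And>v. v \<in> S \<Longrightarrow> weak_gradient \<Omega> (u - q) \<bullet> weak_gradient \<Omega> v = 0"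
    and galerkin: "\<And>v. v \<in> S \<Longrightarrow> d \<bullet> v + \<nu> * (weak_gradient \<Omega> (u - p) \<bullet> weak_gradient \<Omega> v) = 0"
    and H10: "H10_norm \<Omega> (u - q) \<le> C * G" and L2: "norm (u - q) \<le> C * H10_norm \<Omega> (u - q)"
    and nonneg: "0 \<le> \<nu>" "0 \<le> C"
  shows "\<nu> * (H10_norm \<Omega> (u - p))\<^sup>2 + d \<bullet> (u - p) \<le> C\<^sup>2 * (norm d * G + \<nu> * G\<^sup>2)"
proof -
  let ?D = "weak_gradient \<Omega>"
  have qp: "q - p \<in> S" using S p q by (intro subspace_diff)
  have H1: "q - p \<in> H1_on \<Omega>" "u - q \<in> H1_on \<Omega>"
    using qp S u q by (auto intro: subspace_diff[OF H1_on_subspace])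
  have e: "u - p = (u - q) + (q - p)" by simp
  have De: "?D (u - p) = ?D (u - q) + ?D (q - p)"
    unfolding e using weak_gradient_add[OF H1(2,1)] by simp
  have "(H10_norm \<Omega> (u - p))\<^sup>2 = ?D (u - p) \<bullet> ?D (u - q) + ?D (u - p) \<bullet> ?D (q - p)"
    unfolding H10_norm_def power2_norm_eq_inner by (simp add: De inner_add_right inner_add_left)
  moreover have "?D (u - p) \<bullet> ?D (u - q) = (H10_norm \<Omega> (u - q))\<^sup>2"
    using ritz[OF qp] by (simp add: De inner_add_left inner_add_right H10_norm_def power2_norm_eq_inner inner_commute)
  moreover have "d \<bullet> (u - p) = d \<bullet> (u - q) + d \<bullet> (q - p)" by (subst e) (simp only: inner_add_right)
  ultimately have "\<nu> * (H10_norm \<Omega> (u - p))\<^sup>2 + d \<bullet> (u - p) = d \<bullet> (u - q) + \<nu> * (H10_norm \<Omega> (u - q))\<^sup>2"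
    using galerkin[OF qp] by (simp add: algebra_simps)
  also have "d \<bullet> (u - q) \<le> norm d * (C * (C * G))"
  proof -
    have "norm (u - q) \<le> C * (C * G)" using L2 mult_left_mono[OF H10 nonneg(2)] by linarith
    then show ?thesis using norm_cauchy_schwarz[of d "u - q"] mult_left_mono[of "norm (u - q)" "C * (C * G)" "norm d"] by simp
  qed
  also have "\<nu> * (H10_norm \<Omega> (u - q))\<^sup>2 \<le> \<nu> * (C * G)\<^sup>2"
    using H10 nonneg by (intro mult_left_mono power_mono) (auto simp: H10_norm_def)
  finally show ?thesis by (simp add: power2_eq_square algebra_simps)
qed

text \<open>The weak gradient is not continuous in the L2 norm, but on a finite-dimensional span it
  is a finite combination with coefficients continuous in \<open>t\<close>.\<close>

lemma weak_gradient_measurable_span: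
  assumes B: "finite B" "span B \<subseteq> H1_on \<Omega>" and p: "continuous_on {0..T} p"
    and pS: "\<And>t. t \<in> {0..T} \<Longrightarrow> p t \<in> span B"
  shows "square_integrable (time_measure T) (\<lambda>t. weak_gradient \<Omega> (p t))"
proof -
  obtain E where "orthonormal_system E" and E: "span E = span B"
    using finite_orthonormal_basis[OF B(1)] by auto
  then interpret orthonormal_system E by simp
  have EH: "e \<in> H1_on \<Omega>" if "e \<in> E" for e using that E B(2) span_base by blast
  have sum: "(\<Sum>e\<in>A. c e *\<^sub>R e) \<in> H1_on \<Omega> \<and> weak_gradient \<Omega> (\<Sum>e\<in>A. c e *\<^sub>R e) = (\<Sum>e\<in>A. c e *\<^sub>R weak_gradient \<Omega> e)"
    if "A \<subseteq> E" for A and c :: "_ \<Rightarrow> real"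
    using finite_subset[OF that finite] that
  proof (induction A rule: finite_induct)
    case empty
    then show ?case by (simp add: weak_gradient_0 subspace_0[OF H1_on_subspace])
  next
    case (insert x A)
    then have "c x *\<^sub>R x \<in> H1_on \<Omega>" using EH by (auto intro: subspace_scale[OF H1_on_subspace])
    then show ?case
      using insert EH by (simp add: weak_gradient_add weak_gradient_scaleR subspace_add[OF H1_on_subspace])
  qed
  have "weak_gradient \<Omega> (p t) = (\<Sum>e\<in>E. (p t \<bullet> e) *\<^sub>R weak_gradient \<Omega> e)" if "t \<in> {0..T}" for t
    using sum[of E "\<lambda>e. p t \<bullet> e"] expansion[of "p t"] pS[OF that] E by simp
  then have "continuous_on {0..T} (\<lambda>t. weak_gradient \<Omega> (p t)) \<longleftrightarrow> 
      continuous_on {0..T} (\<lambda>t. \<Sum>e\<in>E. (p t \<bullet> e) *\<^sub>R weak_gradient \<Omega> e)"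
    by (intro continuous_on_cong) auto
  moreover have "continuous_on {0..T} (\<lambda>t. \<Sum>e\<in>E. (p t \<bullet> e) *\<^sub>R weak_gradient \<Omega> e)"
    by (intro continuous_intros p)
  ultimately show ?thesis by (intro continuous_square_integrable_time) simp
qed

end

text \<open>Only the summand 4 under the root is used. The others are quotients by squares,
  nonnegative for all parameters, also where a denominator is 0 and the quotient is 0 by
  convention.\<close>

lemma K2_ge: "0 < \<nu> \<Longrightarrow> 2 / \<nu> \<le> K2 \<nu> lam T \<kappa>"
proof -
  assume "0 < \<nu>"
  have "sqrt (2\<^sup>2) \<le> sqrt (4 + 5 / (1 - exp (- \<nu> * lam * T))\<^sup>2
     + (1 + 1 / (1 - exp (- \<nu> * lam * T))\<^sup>2) * (1 / (1 - \<kappa>)\<^sup>2))"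
    by (intro real_sqrt_le_mono) (auto intro!: add_nonneg_nonneg mult_nonneg_nonneg)
  then show ?thesis
    using \<open>0 < \<nu>\<close> by (simp add: K2_def divide_right_mono)
qed

theorem theorem4p1:
  fixes \<Omega> :: "'a::euclidean_space set"
    and \<nu> T C\<^sub>\<Omega> C\<^sub>i\<^sub>n\<^sub>v C\<^sub>J :: real
    and S :: "('a, real) l2 set"
    and P :: "('a, real) l2 \<Rightarrow> ('a, real) l2"
    and f u p :: "real \<Rightarrow> ('a, real) l2"
    and m :: nat and t :: "nat \<Rightarrow> real"
  assumes dim: "DIM('a) \<in> {1, 2, 3}"
    and domain: "convex_polytopal_domain \<Omega>"
    and nu: "0 < \<nu>" and T: "0 < T"
    and S_subspace: "\<exists>B. finite B \<and> S = span B" "S \<subseteq> H10 \<Omega>"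
    and P: "is_H10_projection \<Omega> S P"
    and C\<^sub>\<Omega>_pos: "0 < C\<^sub>\<Omega>"
    and C\<^sub>\<Omega>_H10: "\<And>v g. v \<in> H10 \<Omega> \<Longrightarrow> has_weak_laplacian \<Omega> v g \<Longrightarrow>
           H10_norm \<Omega> (v - P v) \<le> C\<^sub>\<Omega> * norm g"
    and C\<^sub>\<Omega>_L2: "\<And>v. v \<in> H10 \<Omega> \<Longrightarrow> norm (v - P v) \<le> C\<^sub>\<Omega> * H10_norm \<Omega> (v - P v)"
    and C\<^sub>i\<^sub>n\<^sub>v_pos: "0 < C\<^sub>i\<^sub>n\<^sub>v"
    and C\<^sub>i\<^sub>n\<^sub>v: "\<And>v. v \<in> S \<Longrightarrow> H10_norm \<Omega> v \<le> C\<^sub>i\<^sub>n\<^sub>v * norm v"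
    and mesh: "is_mesh T m t"
    and C\<^sub>J_pos: "0 < C\<^sub>J"
    and C\<^sub>J: "\<And>w w'. w \<in> periodic_H1 T \<Longrightarrow> w' \<in> L2_time T UNIV \<Longrightarrow>
           has_weak_time_derivative T w w' \<Longrightarrow>
           L2_time_norm T (\<lambda>s. w s - interpolant t w s) \<le> C\<^sub>J * L2_time_norm T w'"
    and contraction: "evolution_norm \<Omega> \<nu> T S < 1"
    and f: "f \<in> L2_time T (L2_on \<Omega>)"
    and u: "periodic_heat_solution \<Omega> \<nu> T f u"
    and p: "is_semidiscrete_projection \<Omega> \<nu> T S u p"
  shows "L2_H10_norm \<Omega> T (\<lambda>s. u s - interpolant t p s)
    \<le> (K2 \<nu> (first_eigenvalue \<Omega>) T (evolution_norm \<Omega> \<nu> T S) * C\<^sub>\<Omega>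
        + C\<^sub>i\<^sub>n\<^sub>v * C\<^sub>J * ((2 - evolution_norm \<Omega> \<nu> T S) / (1 - evolution_norm \<Omega> \<nu> T S)))
      * L2_time_norm T f"
proof -
  interpret bounded_domain \<Omega> by (rule convex_polytopal_bounded_domain[OF domain])
  let ?M = "time_measure T" and ?D = "weak_gradient \<Omega>" and ?\<Pi> = "interpolant t p"
  obtain B where B: "finite B" and SB: "S = span B" using S_subspace(1) by blast
  have S: "subspace S" using SB by simp
  have H10_H1: "H10 \<Omega> \<subseteq> H1_on \<Omega>" by (auto simp: H10_def)
  have SH1: "S \<subseteq> H1_on \<Omega>" using S_subspace(2) H10_H1 by blast

  \<comment> \<open>Time derivatives, and equations valid off one null set\<close>
  have "u \<in> periodic_space \<Omega> T" using u by (simp add: periodic_heat_solution_def)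
  then have uc: "continuous_on {0..T} u" and uper: "u 0 = u T"
    and uH: "AE s in ?M. u s \<in> H10 \<Omega>" and Du: "square_integrable ?M (\<lambda>s. ?D (u s))"
    by (auto simp: periodic_space_def H1_time_def L2_H10_def L2_time_iff)
  obtain u' where u'_L2: "u' \<in> L2_time T (L2_on \<Omega>)"
    and weak_u: "has_weak_time_derivative T u u'"
    and eq_u: "\<And>w. w \<in> H10 \<Omega> \<Longrightarrow> AE s in ?M. u' s \<bullet> w + \<nu> * (?D (u s) \<bullet> ?D w) = f s \<bullet> w"
    using u unfolding periodic_heat_solution_def by blast
  from u'_L2 have u': "square_integrable ?M u'" "AE s in ?M. u' s \<in> L2_on \<Omega>"
    by (simp_all add: L2_time_iff)
  have fsq: "square_integrable ?M f" and fL2: "AE s in ?M. f s \<in> L2_on \<Omega>"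
    using f by (auto simp: L2_time_iff)
  have "p \<in> H1_time T S" and pper: "p 0 = p T" using p by (simp_all add: is_semidiscrete_projection_def)
  then have pc: "continuous_on {0..T} p" and pS_AE: "AE s in ?M. p s \<in> span B"
    by (auto simp: H1_time_def L2_time_iff SB)
  obtain p' where p'_L2: "p' \<in> L2_time T S" and weak_p: "has_weak_time_derivative T p p'"
    using \<open>p \<in> H1_time T S\<close> unfolding H1_time_def by blast
  from p'_L2 have p': "square_integrable ?M p'" "AE s in ?M. p' s \<in> S"
    by (simp_all add: L2_time_iff)
  obtain d where d_L2: "d \<in> L2_time T (L2_on \<Omega>)" and weak_d: "has_weak_time_derivative T (\<lambda>s. u s - p s) d"
    and eq_d: "\<And>v. v \<in> S \<Longrightarrow> AE s in ?M. d s \<bullet> v + \<nu> * (?D (u s - p s) \<bullet> ?D v) = 0"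
    using p unfolding is_semidiscrete_projection_def by blast
  from d_L2 have d: "square_integrable ?M d" by (simp add: L2_time_iff)
  have pS: "p s \<in> S" if "s \<in> {0..T}" for s
    using continuous_AE_in_span[OF B pc T pS_AE that] SB by simp

  have ec: "continuous_on {0..T} (\<lambda>s. u s - p s)" by (intro continuous_intros uc pc)
  note e = continuous_square_integrable_time[OF ec]
  note prim_u = is_primitive_weak_derivative[OF T uc u'(1) weak_u]
  note prim_p = is_primitive_weak_derivative[OF T pc p'(1) weak_p]
  note prim_e = is_primitive_weak_derivative[OF T ec d weak_d]
  \<comment> \<open>The derivative of \<open>u - p\<close> given with the projection is a separate
    witness; uniqueness identifies it with the difference of the two derivatives.\<close>
  have d_eq: "AE s in ?M. d s = u' s - p' s"
    by (rule is_primitive_unique[OF prim_e is_primitive_diff[OF prim_u prim_p] d square_integrable_diff[OF u'(1) p'(1)]])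

  \<comment> \<open>Pairing \<open>w\<close> with its gradient in the product space turns the
    equation into one orthogonality relation, so a single countable dense set serves both
    terms.\<close>
  have "AE s in ?M. \<forall>z\<in>(\<lambda>w. (w, ?D w)) ` H10 \<Omega>. (u' s - f s, \<nu> *\<^sub>R ?D (u s)) \<bullet> z = 0"
  proof (rule AE_orthogonal_separable)
    fix z assume "z \<in> (\<lambda>w. (w, ?D w)) ` H10 \<Omega>"
    then obtain w where w: "w \<in> H10 \<Omega>" "z = (w, ?D w)" by blast
    from eq_u[OF w(1)] show "AE s in ?M. (u' s - f s, \<nu> *\<^sub>R ?D (u s)) \<bullet> z = 0"
      by eventually_elim (simp add: w(2) inner_diff_left)
  qed
  then have heat: "AE s in ?M. \<forall>w\<in>H10 \<Omega>. (f s - u' s) \<bullet> w = \<nu> * (?D (u s) \<bullet> ?D w)"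
    by eventually_elim (simp add: inner_diff_left algebra_simps)
  have "AE s in ?M. \<forall>z\<in>(\<lambda>v. (v, ?D v)) ` S. (d s, \<nu> *\<^sub>R ?D (u s - p s)) \<bullet> z = 0"
  proof (rule AE_orthogonal_separable)
    fix z assume "z \<in> (\<lambda>v. (v, ?D v)) ` S"
    then obtain v where v: "v \<in> S" "z = (v, ?D v)" by blast
    from eq_d[OF v(1)] show "AE s in ?M. (d s, \<nu> *\<^sub>R ?D (u s - p s)) \<bullet> z = 0"
      by eventually_elim (simp add: v(2))
  qed
  then have gal: "AE s in ?M. \<forall>v\<in>S. d s \<bullet> v + \<nu> * (?D (u s - p s) \<bullet> ?D v) = 0"
    by eventually_elim simp

  \<comment> \<open>The times at which all relations hold for all test elements at once; the
    symmetry of kernels is required for every pair of such times.\<close>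
  define E where "E = {s \<in> {0<..<T}. u s \<in> H10 \<Omega> \<and> u' s \<in> L2_on \<Omega> \<and> f s \<in> L2_on \<Omega> \<and> d s = u' s - p' s
    \<and> (\<forall>w\<in>H10 \<Omega>. (f s - u' s) \<bullet> w = \<nu> * (?D (u s) \<bullet> ?D w))
    \<and> (\<forall>v\<in>S. d s \<bullet> v + \<nu> * (?D (u s - p s) \<bullet> ?D v) = 0)}"
  have "AE s in ?M. s \<in> {0<..<T}" by (rule AE_I2) simp
  then have E: "AE s in ?M. s \<in> E"
    using uH u'(2) fL2 d_eq heat gal by eventually_elim (simp add: E_def)
  have Dd: "?D (u s - p s) = ?D (u s) - ?D (p s)" if "s \<in> E" for s
    using that pS[of s] SH1 H10_H1 by (intro weak_gradient_diff) (auto simp: E_def)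

  \<comment> \<open>Energy bounds from the symmetric kernels\<close>
  let ?F = "\<integral>s. (norm (f s))\<^sup>2 \<partial>?M"
  define A where "A = (\<integral>s. (norm (u' s))\<^sup>2 \<partial>?M)"
  define G where "G = (\<integral>s. (norm (f s - u' s))\<^sup>2 \<partial>?M)"
  define Q where "Q = (\<integral>s. (norm (p' s))\<^sup>2 \<partial>?M)"
  have AG: "A + G = ?F"
    unfolding A_def G_def
  proof (rule energy_identity[OF T uc uper prim_u u'(1) fsq E])
    fix s r assume "s \<in> E" "r \<in> E"
    then show "(f s - u' s) \<bullet> u r = (f r - u' r) \<bullet> u s"
      by (simp add: E_def inner_commute)
  qed
  have "Q + (\<integral>s. (norm (f s - p' s))\<^sup>2 \<partial>?M) = ?F"
    unfolding Q_def
  proof (rule energy_identity[OF T pc pper prim_p p'(1) fsq E])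
    \<comment> \<open>Adding the Galerkin relation to the heat equation, both tested with
      \<open>p r\<close>, shows that \<open>p\<close> solves the semidiscrete problem with data
      \<open>f\<close>.\<close>
    have "(f s - p' s) \<bullet> p r = \<nu> * (?D (p s) \<bullet> ?D (p r))" if "s \<in> E" "r \<in> E" for s r
    proof -
      have "p r \<in> S" using that(2) by (intro pS) (auto simp: E_def)
      then have "d s \<bullet> p r + \<nu> * (?D (u s - p s) \<bullet> ?D (p r)) = 0" "d s = u' s - p' s"
        "(f s - u' s) \<bullet> p r = \<nu> * (?D (u s) \<bullet> ?D (p r))"
        using that(1) S_subspace(2) by (auto simp: E_def)
      then show ?thesis by (simp add: Dd[OF that(1)] inner_diff_left algebra_simps)
    qed
    then show "(f s - p' s) \<bullet> p r = (f r - p' r) \<bullet> p s" if "s \<in> E" "r \<in> E" for s r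
      using that by (simp add: inner_commute)
  qed
  moreover have "0 \<le> (\<integral>s. (norm (f s - p' s))\<^sup>2 \<partial>?M)" by simp
  ultimately have QF: "Q \<le> ?F" by linarith
  have nonneg: "0 \<le> A" "0 \<le> G" "0 \<le> Q" "0 \<le> ?F" by (simp_all add: A_def G_def Q_def)
  have ed: "(\<integral>s. (u s - p s) \<bullet> d s \<partial>?M) = 0"
    by (rule integral_symmetric_kernel_eq_0[OF T ec _ prim_e d e E]) (simp_all add: uper pper inner_commute)

  \<comment> \<open>The semidiscrete error\<close>
  define \<alpha> where "\<alpha> s = norm (?D (u s) - ?D (p s))" for s
  have Dp: "square_integrable ?M (\<lambda>s. ?D (p s))"
    using weak_gradient_measurable_span[OF B _ pc] SH1 pS SB by simp
  have \<alpha>: "square_integrable ?M \<alpha>"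
    unfolding \<alpha>_def[abs_def] by (intro square_integrable_norm square_integrable_diff Du Dp)
  have pointwise: "\<nu>\<^sup>2 * (\<alpha> s)\<^sup>2 + \<nu> * ((u s - p s) \<bullet> d s)
      \<le> C\<^sub>\<Omega>\<^sup>2 * ((norm (u' s))\<^sup>2 / 2 + (norm (p' s))\<^sup>2 / 2 + 2 * (norm (f s - u' s))\<^sup>2)" if s: "s \<in> E" for s
  proof -
    have sT: "s \<in> {0..T}" and us: "u s \<in> H10 \<Omega>" using s by (auto simp: E_def)
    \<comment> \<open>The equation at a fixed time, tested with test functions, identifies the
      Laplacian of \<open>u s\<close>; the regularity estimate then applies with
      \<open>norm (f s - u' s) / \<nu>\<close>.\<close>
    have "has_weak_laplacian \<Omega> (u s) ((1 / \<nu>) *\<^sub>R (u' s - f s))"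
      unfolding has_weak_laplacian_def
    proof (intro conjI ballI)
      show "(1 / \<nu>) *\<^sub>R (u' s - f s) \<in> L2_on \<Omega>"
        using s by (auto simp: E_def intro: subspace_scale[OF L2_on_subspace] subspace_diff[OF L2_on_subspace])
      fix \<phi> assume \<phi>: "\<phi> \<in> test_functions \<Omega>"
      have "(f s - u' s) \<bullet> abs_l2 \<phi> = \<nu> * (?D (u s) \<bullet> abs_l2 (gradient \<phi>))"
        using s test_function_H10[OF \<phi>] by (auto simp: E_def)
      then show "- (?D (u s) \<bullet> abs_l2 (gradient \<phi>)) = ((1 / \<nu>) *\<^sub>R (u' s - f s)) \<bullet> abs_l2 \<phi>"
        using nu by (simp add: inner_diff_left field_simps)
    qed
    from C\<^sub>\<Omega>_H10[OF us this]
    have reg: "H10_norm \<Omega> (u s - P (u s)) \<le> C\<^sub>\<Omega> * (norm (f s - u' s) / \<nu>)"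
      using nu by (simp add: norm_minus_commute)
    have "\<nu> * (H10_norm \<Omega> (u s - p s))\<^sup>2 + d s \<bullet> (u s - p s)
        \<le> C\<^sub>\<Omega>\<^sup>2 * (norm (d s) * (norm (f s - u' s) / \<nu>) + \<nu> * (norm (f s - u' s) / \<nu>)\<^sup>2)"
      by (rule semidiscrete_pointwise_estimate[OF S SH1 _ pS[OF sT] _ _ _ reg C\<^sub>\<Omega>_L2[OF us]])
         (use us H10_H1 P s nu C\<^sub>\<Omega>_pos in \<open>auto simp: is_H10_projection_def E_def\<close>)
    from mult_left_mono[OF this, of \<nu>] nu
    have "\<nu> * (\<nu> * (H10_norm \<Omega> (u s - p s))\<^sup>2 + d s \<bullet> (u s - p s))
        \<le> \<nu> * (C\<^sub>\<Omega>\<^sup>2 * (norm (d s) * (norm (f s - u' s) / \<nu>) + \<nu> * (norm (f s - u' s) / \<nu>)\<^sup>2))" by simp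
    also have "\<dots> = C\<^sub>\<Omega>\<^sup>2 * (norm (d s) * norm (f s - u' s) + (norm (f s - u' s))\<^sup>2)"
      using nu by (simp add: power_divide power2_eq_square[of \<nu>] distrib_left)
    finally have "\<nu>\<^sup>2 * (\<alpha> s)\<^sup>2 + \<nu> * ((u s - p s) \<bullet> d s)
        \<le> C\<^sub>\<Omega>\<^sup>2 * (norm (d s) * norm (f s - u' s) + (norm (f s - u' s))\<^sup>2)"
      by (simp add: \<alpha>_def H10_norm_def Dd[OF s] inner_commute power2_eq_square[of \<nu>] distrib_left mult.assoc)
    \<comment> \<open>Young's inequality for \<open>u'\<close> and for \<open>p'\<close> separately;
      the two halves of the squared norm of \<open>f s - u' s\<close> join the one already present,
      whence the factor 2.\<close>
    also have "norm (d s) * norm (f s - u' s) + (norm (f s - u' s))\<^sup>2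
        \<le> (norm (u' s))\<^sup>2 / 2 + (norm (p' s))\<^sup>2 / 2 + 2 * (norm (f s - u' s))\<^sup>2"
    proof -
      have "norm (d s) \<le> norm (u' s) + norm (p' s)"
        using s norm_triangle_ineq4[of "u' s" "p' s"] by (simp add: E_def)
      then have "norm (d s) * norm (f s - u' s) \<le> norm (u' s) * norm (f s - u' s) + norm (p' s) * norm (f s - u' s)"
        using mult_right_mono[of "norm (d s)" "norm (u' s) + norm (p' s)" "norm (f s - u' s)"]
        by (simp add: distrib_right)
      then show ?thesis
        using sum_squares_bound[of "norm (u' s)" "norm (f s - u' s)"] sum_squares_bound[of "norm (p' s)" "norm (f s - u' s)"]
        by simp
    qed
    finally show ?thesis using C\<^sub>\<Omega>_pos by (simp add: mult_left_mono)
  qed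
  have \<alpha>_int: "(\<integral>s. (\<alpha> s)\<^sup>2 \<partial>?M) \<le> (2 * C\<^sub>\<Omega> / \<nu> * sqrt ?F)\<^sup>2"
  proof -
    note i = square_integrable_norm_sq[OF u'(1)] square_integrable_norm_sq[OF p'(1)]
      square_integrable_norm_sq[OF square_integrable_diff[OF fsq u'(1)]]
      square_integrable_norm_sq[OF \<alpha>] square_integrable_inner[OF e d]
    have "(\<integral>s. \<nu>\<^sup>2 * (\<alpha> s)\<^sup>2 + \<nu> * ((u s - p s) \<bullet> d s) \<partial>?M)
        \<le> (\<integral>s. C\<^sub>\<Omega>\<^sup>2 * ((norm (u' s))\<^sup>2 / 2 + (norm (p' s))\<^sup>2 / 2 + 2 * (norm (f s - u' s))\<^sup>2) \<partial>?M)"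
    proof (rule integral_mono_AE)
      show "AE s in ?M. \<nu>\<^sup>2 * (\<alpha> s)\<^sup>2 + \<nu> * ((u s - p s) \<bullet> d s)
        \<le> C\<^sub>\<Omega>\<^sup>2 * ((norm (u' s))\<^sup>2 / 2 + (norm (p' s))\<^sup>2 / 2 + 2 * (norm (f s - u' s))\<^sup>2)"
        using E by eventually_elim (rule pointwise)
    qed (use i in auto)
    moreover have "(\<integral>s. \<nu>\<^sup>2 * (\<alpha> s)\<^sup>2 + \<nu> * ((u s - p s) \<bullet> d s) \<partial>?M) = \<nu>\<^sup>2 * (\<integral>s. (\<alpha> s)\<^sup>2 \<partial>?M)"
      using i ed by simp
    moreover have "(\<integral>s. C\<^sub>\<Omega>\<^sup>2 * ((norm (u' s))\<^sup>2 / 2 + (norm (p' s))\<^sup>2 / 2 + 2 * (norm (f s - u' s))\<^sup>2) \<partial>?M)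
        = C\<^sub>\<Omega>\<^sup>2 * (A / 2 + Q / 2 + 2 * G)"
      using i by (simp add: A_def Q_def G_def)
    \<comment> \<open>From \<open>A + G = ?F\<close> and \<open>Q \<le> ?F\<close> the bracket is at
      most \<open>5 / 2 * ?F\<close>. The bound by 4 is chosen as the square of the 2 in
      \<open>2 / \<nu>\<close>.\<close>
    moreover have "C\<^sub>\<Omega>\<^sup>2 * (A / 2 + Q / 2 + 2 * G) \<le> C\<^sub>\<Omega>\<^sup>2 * (4 * ?F)"
      using AG QF nonneg by (intro mult_left_mono) auto
    ultimately have "\<nu>\<^sup>2 * (\<integral>s. (\<alpha> s)\<^sup>2 \<partial>?M) \<le> C\<^sub>\<Omega>\<^sup>2 * (4 * ?F)" by linarith
    then show ?thesis
      using nu nonneg(4) by (simp add: power_mult_distrib power_divide field_simps)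
  qed

  \<comment> \<open>The interpolation error and the sum of both errors\<close>
  define \<beta> where "\<beta> s = C\<^sub>i\<^sub>n\<^sub>v * norm (p s - ?\<Pi> s)" for s
  have qc: "continuous_on {0..T} (\<lambda>s. p s - ?\<Pi> s)"
    by (intro continuous_intros pc continuous_interpolant[OF mesh])
  have \<beta>: "square_integrable ?M \<beta>"
    unfolding \<beta>_def[abs_def] by (intro continuous_square_integrable_time continuous_intros qc)
  have \<beta>_int: "(\<integral>s. (\<beta> s)\<^sup>2 \<partial>?M) \<le> (C\<^sub>i\<^sub>n\<^sub>v * C\<^sub>J * sqrt ?F)\<^sup>2"
  proof -
    have "(\<integral>s. (\<beta> s)\<^sup>2 \<partial>?M) = C\<^sub>i\<^sub>n\<^sub>v\<^sup>2 * (\<integral>s. (norm (p s - ?\<Pi> s))\<^sup>2 \<partial>?M)"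
      by (simp add: \<beta>_def power_mult_distrib)
    also have "\<dots> \<le> C\<^sub>i\<^sub>n\<^sub>v\<^sup>2 * (C\<^sub>J\<^sup>2 * Q)"
      unfolding Q_def
      by (intro mult_left_mono interpolation_error[OF T B mesh C\<^sub>J pc pper _ p'(1) _ weak_p])
         (use pS p'(2) SB in auto)
    also have "\<dots> \<le> C\<^sub>i\<^sub>n\<^sub>v\<^sup>2 * (C\<^sub>J\<^sup>2 * ?F)" using QF by (intro mult_left_mono) auto
    finally show ?thesis using nonneg(4) by (simp add: power_mult_distrib mult.assoc)
  qed
  have "AE s in ?M. 0 \<le> H10_norm \<Omega> (u s - ?\<Pi> s) \<and> H10_norm \<Omega> (u s - ?\<Pi> s) \<le> \<alpha> s + \<beta> s"
    using E
  proof eventually_elim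
    case (elim s)
    then have s: "0 < s" "s \<le> T" "u s \<in> H1_on \<Omega>" and ps: "p s \<in> S" using H10_H1 pS[of s] by (auto simp: E_def)
    have q: "p s - ?\<Pi> s \<in> S"
      by (intro subspace_diff[OF S] ps interpolant_in_subspace[OF mesh s(1,2) S pS])
    have "u s - p s \<in> H1_on \<Omega>" using s(3) ps SH1 by (auto intro: subspace_diff[OF H1_on_subspace])
    moreover have "u s - ?\<Pi> s = (u s - p s) + (p s - ?\<Pi> s)" by simp
    ultimately have "?D (u s - ?\<Pi> s) = ?D (u s - p s) + ?D (p s - ?\<Pi> s)"
      using q SH1 weak_gradient_add[of "u s - p s" "p s - ?\<Pi> s"] by auto
    then have "H10_norm \<Omega> (u s - ?\<Pi> s) \<le> \<alpha> s + H10_norm \<Omega> (p s - ?\<Pi> s)"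
      using norm_triangle_ineq[of "?D (u s - p s)" "?D (p s - ?\<Pi> s)"]
      by (simp add: H10_norm_def \<alpha>_def Dd[OF elim])
    also have "H10_norm \<Omega> (p s - ?\<Pi> s) \<le> \<beta> s" unfolding \<beta>_def by (rule C\<^sub>i\<^sub>n\<^sub>v[OF q])
    finally show ?case by (simp add: H10_norm_def)
  qed
  then have "L2_H10_norm \<Omega> T (\<lambda>s. u s - ?\<Pi> s) \<le> 2 * C\<^sub>\<Omega> / \<nu> * sqrt ?F + C\<^sub>i\<^sub>n\<^sub>v * C\<^sub>J * sqrt ?F"
    unfolding L2_H10_norm_def using nu C\<^sub>\<Omega>_pos C\<^sub>i\<^sub>n\<^sub>v_pos C\<^sub>J_pos nonneg(4)
    by (intro L2_norm_sum_le[OF \<alpha> \<beta> _ \<alpha>_int _ \<beta>_int]) auto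
  also have "\<dots> = (2 / \<nu> * C\<^sub>\<Omega> + C\<^sub>i\<^sub>n\<^sub>v * C\<^sub>J * 1) * L2_time_norm T f"
    by (simp add: L2_time_norm_def algebra_simps)
  also have "\<dots> \<le> (K2 \<nu> (first_eigenvalue \<Omega>) T (evolution_norm \<Omega> \<nu> T S) * C\<^sub>\<Omega>
        + C\<^sub>i\<^sub>n\<^sub>v * C\<^sub>J * ((2 - evolution_norm \<Omega> \<nu> T S) / (1 - evolution_norm \<Omega> \<nu> T S)))
      * L2_time_norm T f"
  proof (intro mult_right_mono add_mono mult_left_mono)
    show "2 / \<nu> \<le> K2 \<nu> (first_eigenvalue \<Omega>) T (evolution_norm \<Omega> \<nu> T S)" by (rule K2_ge[OF nu])
    \<comment> \<open>The quotient equals \<open>1 + 1 / (1 - \<kappa>)\<close> for the evolution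
      norm \<kappa>, and the contraction property makes the second term positive.\<close>
    show "1 \<le> (2 - evolution_norm \<Omega> \<nu> T S) / (1 - evolution_norm \<Omega> \<nu> T S)"
      using contraction by (simp add: field_simps)
  qed (use C\<^sub>\<Omega>_pos C\<^sub>i\<^sub>n\<^sub>v_pos C\<^sub>J_pos in \<open>auto simp: L2_time_norm_def\<close>)
  finally show ?thesis .
qed

end
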